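(* For every rational prime $p\geq 5$ and every $(a,b)\in\mathbb{Z}^2$ such that $x^9+ax+b$ is irreducible over $\mathbb{Q}$ (and such that for every rational prime $q$ one has $\nu_q(a)\leq 7$ or $\nu_q(b)\leq 8$), $p$ does not divide the index $i(K)$, where $K$ is the number field defined by $x^9+ax+b$.
   Context: $\nu_q$ denotes the $q$-adic valuation on $\mathbb{Q}$ and $\mathbb{Z}_K$ the ring of integers of $K$. The index $i(K)$ is $\gcd\{(\mathbb{Z}_K:\mathbb{Z}[\theta]) : \theta\in\mathbb{Z}_K,\ K=\mathbb{Q}(\theta)\}$. *)

theory Defs
  imports
    Complex_Main
    "HOL-Library.Extended_Nat"
    "HOL-Computational_Algebra.Computational_Algebra"
begin

text \<open>Number fields are realised as subfields of the complex numbers.\<close>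

inductive_set Q_adjoin :: "complex \<Rightarrow> complex set" for \<theta> :: complex where
  rat: "of_rat r \<in> Q_adjoin \<theta>"
| gen: "\<theta> \<in> Q_adjoin \<theta>"
| add: "x \<in> Q_adjoin \<theta> \<Longrightarrow> y \<in> Q_adjoin \<theta> \<Longrightarrow> x + y \<in> Q_adjoin \<theta>"
| uminus: "x \<in> Q_adjoin \<theta> \<Longrightarrow> - x \<in> Q_adjoin \<theta>"
| mult: "x \<in> Q_adjoin \<theta> \<Longrightarrow> y \<in> Q_adjoin \<theta> \<Longrightarrow> x * y \<in> Q_adjoin \<theta>"
| inverse: "x \<in> Q_adjoin \<theta> \<Longrightarrow> inverse x \<in> Q_adjoin \<theta>"

definition Z_adjoin :: "complex \<Rightarrow> complex set" where
  "Z_adjoin \<theta> = {poly (map_poly of_int g) \<theta> | g :: int poly. True}"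

definition ring_of_integers :: "complex set \<Rightarrow> complex set" where
  "ring_of_integers K = {x \<in> K. algebraic_int x}"

definition add_index :: "complex set \<Rightarrow> complex set \<Rightarrow> nat" where
  "add_index A B = card (A // {(x, y) \<in> A \<times> A. x - y \<in> B})"

definition field_index :: "complex set \<Rightarrow> nat" where
  "field_index K =
     Gcd {add_index (ring_of_integers K) (Z_adjoin \<theta>) | \<theta>.
            \<theta> \<in> ring_of_integers K \<and> K = Q_adjoin \<theta>}"

text \<open>The value at \<open>0\<close> is infinite, whereas \<^term>\<open>multiplicity q 0 = 0\<close>.\<close>

definition padic_val :: "nat \<Rightarrow> int \<Rightarrow> enat" where
  "padic_val q x = (if x = 0 then \<infinity> else enat (multiplicity (int q) x))"

definition trinomial9 :: "int \<Rightarrow> int \<Rightarrow> int poly" where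
  "trinomial9 a b = monom 1 9 + monom a 1 + monom b 0"

end

theory Submission
  imports Defs "HOL-Algebra.Sylow" "HOL-Algebra.FiniteProduct"
    "HOL-Computational_Algebra.Field_as_Ring"
begin

text \<open>
  Let \<open>R\<close> be the ring of integers of \<open>K = \<rat>(\<alpha>)\<close>. It suffices to find an algebraic integer
  \<open>\<theta> \<in> K\<close> whose powers \<open>1, \<theta>, \<dots>, \<theta>\<^sup>8\<close> are linearly independent modulo \<open>p R\<close>: then
  \<open>K = \<rat>(\<theta>)\<close>, and \<open>R / \<int>[\<theta>]\<close> is finite without \<open>p\<close>-torsion.

  Independence is tested in a valuation ring of \<open>\<complex>\<close> in which \<open>p\<close> is not a unit, simultaneously
  at all conjugates of \<open>\<theta>\<close>: if \<open>P(\<theta>) / p\<close> is integral, then so is \<open>P(\<theta>') / p\<close> for every conjugate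
  \<open>\<theta>'\<close>, and counting roots in the residue field shows that \<open>p\<close> divides \<open>P\<close>. Put
  \<open>\<Delta> = 8\<^sup>8 a\<^sup>9 + 9\<^sup>9 b\<^sup>8\<close>.

  \<^item> If \<open>p\<close> does not divide \<open>\<Delta>\<close>, the trinomial is separable modulo \<open>p\<close> and \<open>\<theta> = \<alpha>\<close> works.

  \<^item> If \<open>p\<close> divides \<open>a\<close> and \<open>b\<close>, the Newton polygon has one side of slope \<open>k/9\<close>, or one side of slope
    \<open>m/8\<close> and one of length \<open>1\<close>. With \<open>E = 9\<close> or \<open>8\<close>, \<open>N = k\<close> or \<open>m\<close> and \<open>\<pi>\<^sup>E = p\<close>, the number
    \<open>\<gamma> = \<alpha> / \<pi>\<^sup>N\<close> is a root of a trinomial that is separable modulo \<open>\<pi>\<close>, and for \<open>d = gcd N E\<close>,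
    \<open>d e = E\<close> one takes \<open>\<theta> = \<gamma>\<^sup>e + t \<pi>\<^sup>d \<gamma>\<^sup>i\<close>, the sum of a generator of the residue algebra and a
    uniformiser, with \<open>i\<close> chosen such that \<open>\<theta> \<in> K\<close>.

  \<^item> Otherwise the trinomial has exactly one multiple root modulo \<open>p\<close>, of multiplicity two. Expanding
    around an integer \<open>s\<close> close to it as \<open>y\<^sup>2 G(y) + p\<^sup>2\<^sup>k (c\<^sub>1 y + c\<^sub>0)\<close>, where \<open>y = \<alpha> - s\<close> and
    \<open>p\<^sup>2\<close> does not divide \<open>c\<^sub>0\<close>, one takes \<open>\<theta> = y + u G(y) + w y G(y) / p\<^sup>k\<close>. Here \<open>u\<close> and \<open>w\<close> move
    the two values that came from the double root away from the residues of the roots of \<open>G\<close>; this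
    is possible since \<open>0\<close> is not a root and \<open>f(x) + f(-x) = 2 b\<close> is a unit.
\<close>

section \<open>Valuation rings\<close>

locale field_subring =
  fixes A :: "'a :: field set"
  assumes one: "1 \<in> A"
    and diff: "x \<in> A \<Longrightarrow> y \<in> A \<Longrightarrow> x - y \<in> A"
    and mult: "x \<in> A \<Longrightarrow> y \<in> A \<Longrightarrow> x * y \<in> A"
begin

lemma zero: "0 \<in> A"
  using diff[OF one one] by simp

lemma uminus: "x \<in> A \<Longrightarrow> - x \<in> A"
  using diff[OF zero] by simp

lemma add: "x \<in> A \<Longrightarrow> y \<in> A \<Longrightarrow> x + y \<in> A"
  using diff[OF _ uminus] by fastforce

lemma sum: "(\<And>i. i \<in> I \<Longrightarrow> f i \<in> A) \<Longrightarrow> sum f I \<in> A"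
  by (induction I rule: infinite_finite_induct) (auto intro: zero add)

lemma prod: "(\<And>i. i \<in> I \<Longrightarrow> f i \<in> A) \<Longrightarrow> prod f I \<in> A"
  by (induction I rule: infinite_finite_induct) (auto intro: one mult)

lemma power: "x \<in> A \<Longrightarrow> x ^ n \<in> A"
  by (induction n) (auto intro: one mult)

lemma of_nat: "of_nat n \<in> A"
  by (induction n) (auto intro: one zero add)

lemma of_int: "of_int n \<in> A"
  by (cases n) (auto intro!: of_nat uminus diff one simp del: of_nat_Suc)

lemma numeral: "numeral n \<in> A"
  using of_nat[of "numeral n"] by simp

lemma poly: "(\<And>i. coeff q i \<in> A) \<Longrightarrow> x \<in> A \<Longrightarrow> poly q x \<in> A"
  unfolding poly_altdef by (intro sum mult power) auto

lemmas closed = zero one add diff mult uminus power of_nat of_int numeral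

end

lemma (in field_subring) field_subring_adjoin:
  "field_subring {poly q x | q. \<forall>i. coeff q i \<in> A}"
proof
  show "1 \<in> {poly q x | q. \<forall>i. coeff q i \<in> A}"
    by (intro CollectI exI[of _ 1]) (auto intro: zero one)
next
  fix y z
  assume "y \<in> {poly q x | q. \<forall>i. coeff q i \<in> A}" "z \<in> {poly q x | q. \<forall>i. coeff q i \<in> A}"
  then obtain q r where qr: "y = poly q x" "z = poly r x" "\<forall>i. coeff q i \<in> A" "\<forall>i. coeff r i \<in> A"
    by auto
  show "y - z \<in> {poly q x | q. \<forall>i. coeff q i \<in> A}"
    using qr by (intro CollectI exI[of _ "q - r"]) (auto intro: diff)
  show "y * z \<in> {poly q x | q. \<forall>i. coeff q i \<in> A}"
    using qr by (intro CollectI exI[of _ "q * r"]) (auto intro!: sum mult simp: coeff_mult)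
qed

locale valuation_ring = field_subring +
  assumes total: "x \<in> A \<or> inverse x \<in> A"

text \<open>A subring that is maximal among those not containing \<open>inverse z\<close> is a valuation ring: if
  neither \<open>x\<close> nor \<open>inverse x\<close> belonged to it, then \<open>1\<close> would be a polynomial in \<open>x\<close> and a
  polynomial in \<open>inverse x\<close>, both with coefficients divisible by \<open>z\<close>, and the shorter of the two
  relations could be used to shorten the other one.\<close>

lemma exists_valuation_ring:
  assumes "field_subring A0" "z \<in> A0" "inverse z \<notin> A0"
  obtains V where "valuation_ring V" "A0 \<subseteq> V" "inverse z \<notin> V"
proof -
  define \<A> where "\<A> = {A. field_subring A \<and> A0 \<subseteq> A \<and> inverse z \<notin> A}"
  have "\<exists>M\<in>\<A>. \<forall>X\<in>\<A>. M \<subseteq> X \<longrightarrow> X = M"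
  proof (rule subset_Zorn)
    fix C assume C: "subset.chain \<A> C"
    show "\<exists>U\<in>\<A>. \<forall>X\<in>C. X \<subseteq> U"
    proof (cases "C = {}")
      case True
      then show ?thesis using assms by (auto simp: \<A>_def)
    next
      case False
      have ring: "field_subring X" "A0 \<subseteq> X" "inverse z \<notin> X" if "X \<in> C" for X
        using C that by (auto simp: subset.chain_def \<A>_def)
      have common: "\<exists>X\<in>C. x \<in> X \<and> y \<in> X" if "x \<in> \<Union>C" "y \<in> \<Union>C" for x y
        using that C unfolding subset_chain_def by (meson UnionE subset_iff)
      have "field_subring (\<Union>C)"
      proof
        show "1 \<in> \<Union>C"
          using False ring(1) field_subring.one by blast
      next
        fix x y assume "x \<in> \<Union>C" "y \<in> \<Union>C"
        then obtain X where "X \<in> C" "x \<in> X" "y \<in> X"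
          using common by blast
        then show "x - y \<in> \<Union>C" "x * y \<in> \<Union>C"
          using ring(1) field_subring.diff field_subring.mult by blast+
      qed
      then have "\<Union>C \<in> \<A>"
        using ring False unfolding \<A>_def by blast
      then show ?thesis by auto
    qed
  qed
  then obtain V where "V \<in> \<A>" and V_max: "\<forall>X\<in>\<A>. V \<subseteq> X \<longrightarrow> X = V"
    by (elim bexE)
  then have V: "field_subring V" "A0 \<subseteq> V" "inverse z \<notin> V"
    by (auto simp: \<A>_def)
  have maxi: "X = V" if "field_subring X" "inverse z \<notin> X" "V \<subseteq> X" for X
    using V_max V(2) that unfolding \<A>_def by blast
  interpret V: field_subring V by fact
  have zV: "z \<in> V" and z0: "z \<noteq> 0"
    using V assms V.zero by auto
  \<comment> \<open>By maximality of \<open>V\<close>, adjoining any element outside it must produce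
    \<open>inverse z\<close>.\<close>
  have adjoin: "\<exists>q. (\<forall>i. coeff q i \<in> V) \<and> poly q x = inverse z" if "x \<notin> V" for x
  proof (rule ccontr)
    assume *: "\<not> ?thesis"
    let ?X = "{poly q x | q. \<forall>i. coeff q i \<in> V}"
    have "v \<in> ?X" if "v \<in> V" for v
      using that by (intro CollectI exI[of _ "[:v:]"]) (auto simp: coeff_pCons V.zero split: nat.splits)
    moreover have "x \<in> ?X"
      by (intro CollectI exI[of _ "[:0, 1:]"]) (auto simp: coeff_pCons V.zero V.one split: nat.splits)
    ultimately show False
      using maxi[OF V.field_subring_adjoin, of x] * that by fastforce
  qed
  \<comment> \<open>\<open>z\<close> lies in the Jacobson radical of \<open>V\<close>. If
    \<open>u = 1 - z * b\<close> had no inverse in \<open>V\<close>, then \<open>inverse z\<close>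
    would be a polynomial in \<open>inverse u\<close>; clearing denominators puts
    \<open>u ^ n * inverse z\<close> into \<open>V\<close>, and \<open>u ^ n\<close> is 1 modulo
    \<open>z\<close>, so \<open>inverse z\<close> would lie in \<open>V\<close> too.\<close>
  have unit: "inverse (1 - z * b) \<in> V" if b: "b \<in> V" for b
  proof (rule ccontr)
    define u where "u = 1 - z * b"
    assume "inverse (1 - z * b) \<notin> V"
    then obtain q where q: "\<forall>i. coeff q i \<in> V" "poly q (inverse u) = inverse z"
      using adjoin u_def by blast
    have u0: "u \<noteq> 0"
      using \<open>inverse (1 - z * b) \<notin> V\<close> V.zero u_def by auto
    have "poly (reflect_poly q) u = u ^ degree q * inverse z"
      using q(2) u0 by (simp add: poly_reflect_poly_nz)
    moreover have "poly (reflect_poly q) u \<in> V"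
      using q(1) b zV by (intro V.poly) (auto simp: coeff_reflect_poly u_def intro: V.closed)
    ultimately have 1: "u ^ degree q * inverse z \<in> V" by simp
    have "\<exists>c\<in>V. u ^ n = 1 - z * c" for n
    proof (induction n)
      case (Suc n)
      then obtain c where c: "c \<in> V" "u ^ n = 1 - z * c" by auto
      have "u ^ Suc n = 1 - z * (c + b - z * b * c)"
        by (simp add: c(2)) (simp add: u_def algebra_simps)
      then show ?case
        using b zV c(1) by (intro bexI[of _ "c + b - z * b * c"]) (auto intro!: V.closed)
    qed (auto intro: V.zero)
    then obtain c where c: "c \<in> V" "u ^ degree q = 1 - z * c" by blast
    have "inverse z = u ^ degree q * inverse z + c"
      using c z0 by (simp add: field_simps)
    with 1 c V(3) V.add show False by metis
  qed
  \<comment> \<open>Values at \<open>x\<close> of polynomials with at most \<open>n\<close> terms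
    and coefficients in \<open>z V\<close>; \<open>1 \<in> S n x\<close> is a relation of length
    \<open>n\<close>.\<close>
  define S where "S n x = {\<Sum>i<n. z * a i * x ^ i | a. \<forall>i. a i \<in> V}" for n :: nat and x
  have S_add: "s + t \<in> S n x" if "s \<in> S n x" "t \<in> S n x" for s t n x
  proof -
    obtain a b where "s = (\<Sum>i<n. z * a i * x ^ i)" "t = (\<Sum>i<n. z * b i * x ^ i)"
      "\<forall>i. a i \<in> V" "\<forall>i. b i \<in> V" using \<open>s \<in> S n x\<close> \<open>t \<in> S n x\<close> by (auto simp: S_def)
    then show ?thesis unfolding S_def
      by (intro CollectI exI[of _ "\<lambda>i. a i + b i"])
         (auto simp: algebra_simps sum.distrib intro: V.add)
  qed
  have S_mult: "c * s \<in> S n x" if "s \<in> S n x" "c \<in> V" for c s n x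
  proof -
    obtain a where "s = (\<Sum>i<n. z * a i * x ^ i)" "\<forall>i. a i \<in> V" using \<open>s \<in> S n x\<close> by (auto simp: S_def)
    then show ?thesis using \<open>c \<in> V\<close> unfolding S_def
      by (intro CollectI exI[of _ "\<lambda>i. c * a i"])
         (auto simp: algebra_simps sum_distrib_left intro!: V.mult)
  qed
  have S_shift: "x ^ k * s \<in> S (m + k) x" if s: "s \<in> S m x" for s m k x
  proof -
    obtain a where a: "s = (\<Sum>i<m. z * a i * x ^ i)" "\<forall>i. a i \<in> V" using s by (auto simp: S_def)
    have "(\<Sum>i<m + k. z * (if i < k then 0 else a (i - k)) * x ^ i) =
        (\<Sum>i\<in>{k..<m + k}. z * a (i - k) * x ^ i)"
      by (rule sum.mono_neutral_cong_right) auto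
    also have "\<dots> = (\<Sum>i<m. z * a i * x ^ (i + k))"
      by (rule sum.reindex_bij_witness[of _ "\<lambda>i. i + k" "\<lambda>i. i - k"]) auto
    also have "\<dots> = x ^ k * s"
      by (simp add: a(1) sum_distrib_left power_add algebra_simps)
    finally show ?thesis
      using a(2) unfolding S_def
      by (intro CollectI exI[of _ "\<lambda>i. if i < k then 0 else a (i - k)"]) (auto intro: V.zero)
  qed
  have S_Suc: "\<exists>s\<in>S n x. \<exists>c\<in>V. t = s + z * c * x ^ n" if "t \<in> S (Suc n) x" for t n x
    using that unfolding S_def by auto
  have ex: "\<exists>n. 1 \<in> S n x" if "x \<notin> V" for x
  proof -
    obtain q where q: "\<forall>i. coeff q i \<in> V" "poly q x = inverse z"
      using adjoin \<open>x \<notin> V\<close> by blast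
    have "1 = z * poly q x" using q z0 by simp
    also have "\<dots> = (\<Sum>i<Suc (degree q). z * coeff q i * x ^ i)"
      unfolding poly_altdef lessThan_Suc_atMost by (simp add: sum_distrib_left algebra_simps)
    finally show ?thesis using q(1) unfolding S_def by blast
  qed
  have S0: "1 \<notin> S 0 x" for x by (auto simp: S_def)
  \<comment> \<open>The relation in \<open>inverse x\<close>, multiplied by \<open>x ^ m'\<close>
    and divided by the unit \<open>1 - z * b 0\<close>, expresses \<open>x ^ m'\<close> by lower
    powers. As \<open>m \<le> n\<close>, it also rewrites the top power \<open>x ^ n'\<close> of the
    other relation, contradicting the minimality of \<open>n\<close>.\<close>
  have main: False
    if "x \<noteq> 0" and n: "1 \<in> S n x" "\<forall>k<n. 1 \<notin> S k x" and m: "1 \<in> S m (inverse x)" and "m \<le> n"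
    for x n m
  proof -
    obtain m' n' where mn: "m = Suc m'" "n = Suc n'"
      using m n S0 \<open>m \<le> n\<close> by (metis not0_implies_Suc)
    obtain b where b: "1 = (\<Sum>i<Suc m'. z * b i * inverse x ^ i)" "\<forall>i. b i \<in> V"
      using m unfolding S_def mn by auto
    have "x ^ m' = x ^ m' * (\<Sum>i<Suc m'. z * b i * inverse x ^ i)"
      using b(1) by simp
    also have "\<dots> = (\<Sum>i<Suc m'. z * b i * x ^ (m' - i))"
      unfolding sum_distrib_left
      by (rule sum.cong) (use \<open>x \<noteq> 0\<close> in \<open>auto simp: power_diff field_simps\<close>)
    also have "\<dots> = z * b 0 * x ^ m' + (\<Sum>i<m'. z * b (Suc i) * x ^ (m' - Suc i))"
      by (subst sum.lessThan_Suc_shift) simp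
    also have "(\<Sum>i<m'. z * b (Suc i) * x ^ (m' - Suc i)) = (\<Sum>i<m'. z * b (m' - i) * x ^ i)"
      by (rule sum.reindex_bij_witness[of _ "\<lambda>i. m' - Suc i" "\<lambda>i. m' - Suc i"]) auto
    finally have eq: "(1 - z * b 0) * x ^ m' = (\<Sum>i<m'. z * b (m' - i) * x ^ i)"
      by (simp add: algebra_simps)
    have in_S: "(\<Sum>i<m'. z * b (m' - i) * x ^ i) \<in> S m' x"
      unfolding S_def using b(2) by (intro CollectI exI[of _ "\<lambda>i. b (m' - i)"]) auto
    have "1 - z * b 0 \<noteq> 0"
    proof
      assume "1 - z * b 0 = 0"
      then have "inverse z = b 0" using z0 by (simp add: field_simps)
      then show False using V(3) b(2) by metis
    qed
    then have "x ^ m' = inverse (1 - z * b 0) * (\<Sum>i<m'. z * b (m' - i) * x ^ i)"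
      by (simp add: eq[symmetric])
    also have "\<dots> \<in> S m' x"
      using unit b(2) in_S by (intro S_mult) auto
    finally have "x ^ (n' - m') * x ^ m' \<in> S (m' + (n' - m')) x"
      by (rule S_shift)
    then have xn: "x ^ n' \<in> S n' x"
      using \<open>m \<le> n\<close> mn by (simp flip: power_add)
    obtain s c where "s \<in> S n' x" "c \<in> V" "1 = s + z * c * x ^ n'"
      using S_Suc n(1) mn by blast
    then have "1 \<in> S n' x"
      using S_add S_mult xn zV V.mult by metis
    then show False using n(2) mn by auto
  qed
  have "valuation_ring V"
  proof
    fix x
    show "x \<in> V \<or> inverse x \<in> V"
    proof (rule ccontr)
      assume "\<not> ?thesis"
      then have x: "x \<notin> V" "inverse x \<notin> V" "x \<noteq> 0" using V.zero by auto
      define n where "n = (LEAST n. 1 \<in> S n x)"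
      define m where "m = (LEAST n. 1 \<in> S n (inverse x))"
      have n: "1 \<in> S n x" "\<forall>k<n. 1 \<notin> S k x"
        using LeastI_ex[OF ex[OF x(1)]] not_less_Least unfolding n_def by blast+
      have m: "1 \<in> S m (inverse x)" "\<forall>k<m. 1 \<notin> S k (inverse x)"
        using LeastI_ex[OF ex[OF x(2)]] not_less_Least unfolding m_def by blast+
      show False
        using main[of x n m] main[of "inverse x" m n] n m x(3) by (cases "m \<le> n") auto
    qed
  qed
  then show ?thesis using that V by blast
qed

text \<open>If \<open>x\<close> were outside \<open>A\<close>, its inverse would be inside, and
  dividing the monic equation by \<open>x ^ (n - 1)\<close> would write \<open>x\<close> as a
  polynomial in \<open>inverse x\<close>.\<close>

lemma (in valuation_ring) integrally_closed:
  assumes "lead_coeff q = 1" "\<And>i. coeff q i \<in> A" "poly q x = 0"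
  shows "x \<in> A"
proof (rule ccontr)
  assume "x \<notin> A"
  then have x: "x \<noteq> 0" "inverse x \<in> A"
    using total zero by auto
  define n where "n = degree q"
  have "n \<noteq> 0"
  proof
    assume "n = 0"
    then obtain c where "q = [:c:]"
      unfolding n_def by (rule degree_eq_zeroE)
    then show False using assms by simp
  qed
  have "0 = (\<Sum>i\<le>n. coeff q i * x ^ i)"
    using assms(3) by (simp add: poly_altdef n_def)
  also have "\<dots> = (\<Sum>i<n. coeff q i * x ^ i) + x ^ n"
    using assms(1) by (simp add: n_def flip: lessThan_Suc_atMost)
  finally have "x ^ n = - (\<Sum>i<n. coeff q i * x ^ i)"
    by (metis add.commute eq_neg_iff_add_eq_0)
  then have "x = - (\<Sum>i<n. coeff q i * x ^ i) * inverse x ^ (n - 1)"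
    using x(1) \<open>n \<noteq> 0\<close> by (cases n) (auto simp: field_simps)
  also have "\<dots> = - (\<Sum>i<n. coeff q i * inverse x ^ (n - 1 - i))"
    unfolding minus_mult_left[symmetric] sum_distrib_right
    using x(1) by (intro arg_cong[where f = uminus] sum.cong) (auto simp: power_diff field_simps)
  also have "\<dots> \<in> A"
    using assms(2) x(2) by (intro uminus sum mult power) auto
  finally show False using \<open>x \<notin> A\<close> by simp
qed

text \<open>The integral closure of the integers is the intersection of all valuation rings. If
  \<open>x\<close> is not integral, then \<open>inverse x\<close> is not invertible in the ring it
  generates, so some valuation ring contains \<open>inverse x\<close> but not
  \<open>x\<close>.\<close>

lemma algebraic_int_iff_valuation:
  fixes x :: "'a :: field_char_0"
  shows "algebraic_int x \<longleftrightarrow> (\<forall>V. valuation_ring V \<longrightarrow> x \<in> V)"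
proof
  assume "algebraic_int x"
  then obtain q where q: "lead_coeff q = 1" "\<forall>i. coeff q i \<in> \<int>" "poly q x = 0"
    by (auto simp: algebraic_int.simps)
  show "\<forall>V. valuation_ring V \<longrightarrow> x \<in> V"
  proof (intro allI impI)
    fix V :: "'a set" assume "valuation_ring V"
    then interpret valuation_ring V .
    show "x \<in> V"
      by (rule integrally_closed[OF q(1) _ q(3)]) (metis Ints_cases q(2) of_int)
  qed
next
  assume *: "\<forall>V. valuation_ring V \<longrightarrow> x \<in> V"
  show "algebraic_int x"
  proof (rule ccontr)
    assume x: "\<not> algebraic_int x"
    then have x0: "x \<noteq> 0" by auto
    interpret Z: field_subring "\<int> :: 'a set"
      by standard auto
    let ?A = "{poly q (inverse x) | q. \<forall>i. coeff q i \<in> \<int>}"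
    \<comment> \<open>A relation \<open>x = q(1/x)\<close> makes \<open>1/x\<close> a root of
      \<open>1 - X q\<close>, whose constant coefficient is 1; its reversal is a monic integral
      equation for \<open>x\<close>.\<close>
    have 1: "inverse (inverse x) \<notin> ?A"
    proof
      assume "inverse (inverse x) \<in> ?A"
      then obtain q where q: "\<forall>i. coeff q i \<in> \<int>" "poly q (inverse x) = x" by auto
      define r where "r = 1 - [:0, 1:] * q"
      have "poly r (inverse x) = 0" "coeff r 0 = 1" "\<forall>i. coeff r i \<in> \<int>"
        using q x0 by (auto simp: r_def coeff_pCons split: nat.splits)
      then show False
        using algebraic_int_inverse[of r "inverse x"] x by simp
    qed
    have 2: "inverse x \<in> ?A"
      by (intro CollectI exI[of _ "[:0, 1:]"]) (auto simp: coeff_pCons split: nat.splits)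
    obtain V where "valuation_ring V" "inverse (inverse x) \<notin> V"
      by (rule exists_valuation_ring[OF Z.field_subring_adjoin 2 1])
    then show False using * by simp
  qed
qed

text \<open>Every valuation ring is closed under difference and product, hence so is their
  intersection.\<close>

lemma field_subring_algebraic_int: "field_subring {x :: 'a :: field_char_0. algebraic_int x}"
proof
  fix x y :: 'a assume "x \<in> {x. algebraic_int x}" "y \<in> {x. algebraic_int x}"
  then show "x - y \<in> {x. algebraic_int x}" "x * y \<in> {x. algebraic_int x}"
    unfolding algebraic_int_iff_valuation mem_Collect_eq
    using valuation_ring.axioms(1) field_subring.diff field_subring.mult by blast+
qed simp

lemma algebraic_int_add:
  "algebraic_int x \<Longrightarrow> algebraic_int y \<Longrightarrow> algebraic_int (x + y :: 'a :: field_char_0)"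
  and algebraic_int_diff:
  "algebraic_int x \<Longrightarrow> algebraic_int y \<Longrightarrow> algebraic_int (x - y :: 'a :: field_char_0)"
  and algebraic_int_mult:
  "algebraic_int x \<Longrightarrow> algebraic_int y \<Longrightarrow> algebraic_int (x * y :: 'a :: field_char_0)"
  and algebraic_int_power:
  "algebraic_int x \<Longrightarrow> algebraic_int (x ^ n :: 'a :: field_char_0)"
  using field_subring.add[OF field_subring_algebraic_int]
    field_subring.diff[OF field_subring_algebraic_int]
    field_subring.mult[OF field_subring_algebraic_int]
    field_subring.power[OF field_subring_algebraic_int] by auto

lemma algebraic_int_poly:
  fixes x :: "'a :: field_char_0"
  shows "(\<And>i. algebraic_int (coeff q i)) \<Longrightarrow> algebraic_int x \<Longrightarrow> algebraic_int (poly q x)"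
  using field_subring.poly[OF field_subring_algebraic_int, of q x] by auto

text \<open>Transitivity of integrality, tested in one valuation ring at a time.\<close>

lemma algebraic_int_integrally_closed:
  fixes x :: "'a :: field_char_0"
  assumes "lead_coeff q = 1" "\<And>i. algebraic_int (coeff q i)" "poly q x = 0"
  shows "algebraic_int x"
  using assms valuation_ring.integrally_closed[of _ q x]
  unfolding algebraic_int_iff_valuation by blast

section \<open>Units and nonunits\<close>

context field_subring
begin

text \<open>Since \<open>inverse 0 = 0\<close> lies in \<open>A\<close>, zero has to be put among
  the nonunits explicitly. In a valuation ring this set is the maximal ideal.\<close>

definition nonunits :: "'a set" where "nonunits = {x \<in> A. x = 0 \<or> inverse x \<notin> A}"
definition units :: "'a set" where "units = {x \<in> A. x \<noteq> 0 \<and> inverse x \<in> A}"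

lemma nonunits_closed: "x \<in> nonunits \<Longrightarrow> x \<in> A"
  by (simp add: nonunits_def)

lemma units_closed: "x \<in> units \<Longrightarrow> x \<in> A"
  by (simp add: units_def)

lemma units_inverse: "x \<in> units \<Longrightarrow> inverse x \<in> A"
  by (simp add: units_def)

lemma units_nonzero: "x \<in> units \<Longrightarrow> x \<noteq> 0"
  by (simp add: units_def)

lemma units_iff: "x \<in> units \<longleftrightarrow> x \<in> A \<and> x \<notin> nonunits"
  by (auto simp: units_def nonunits_def)

lemma units_mult: "x \<in> units \<Longrightarrow> y \<in> units \<Longrightarrow> x * y \<in> units"
  by (auto simp: units_def intro: mult)

lemma units_one: "1 \<in> units"
  by (auto simp: units_def one)

lemma units_power: "x \<in> units \<Longrightarrow> x ^ n \<in> units"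
  by (induction n) (auto intro: units_mult units_one)

lemma units_uminus: "x \<in> units \<Longrightarrow> - x \<in> units"
  by (auto simp: units_def intro: uminus)

lemma nonunits_zero: "0 \<in> nonunits"
  by (simp add: nonunits_def zero)

lemma nonunits_mult: "x \<in> nonunits \<Longrightarrow> y \<in> A \<Longrightarrow> x * y \<in> nonunits"
proof -
  assume xy: "x \<in> nonunits" "y \<in> A"
  show ?thesis
  proof (rule ccontr)
    assume "x * y \<notin> nonunits"
    then have "x * y \<noteq> 0" "inverse (x * y) \<in> A"
      using xy mult by (auto simp: nonunits_def)
    moreover from this have "inverse x = y * inverse (x * y)"
      by (simp add: field_simps)
    ultimately show False
      using xy mult by (auto simp: nonunits_def simp del: inverse_mult_distrib)
  qed
qed

lemma nonunits_mult': "x \<in> nonunits \<Longrightarrow> y \<in> A \<Longrightarrow> y * x \<in> nonunits"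
  using nonunits_mult by (simp add: mult.commute)

lemma units_multD: "x * y \<in> units \<Longrightarrow> x \<in> A \<Longrightarrow> y \<in> A \<Longrightarrow> x \<in> units \<and> y \<in> units"
  using nonunits_mult nonunits_mult' units_iff by blast

lemma nonunits_multD: "x * y \<in> nonunits \<Longrightarrow> x \<in> A \<Longrightarrow> y \<in> A \<Longrightarrow> x \<in> nonunits \<or> y \<in> nonunits"
  using units_mult units_iff by blast

lemma nonunits_unit_multD: "x * y \<in> nonunits \<Longrightarrow> x \<in> units \<Longrightarrow> y \<in> A \<Longrightarrow> y \<in> nonunits"
  using nonunits_multD units_iff by blast

lemma nonunits_uminus: "x \<in> nonunits \<Longrightarrow> - x \<in> nonunits"
  using nonunits_mult[of x "- 1"] uminus[OF one] by simp

lemma nonunits_power: "x \<in> nonunits \<Longrightarrow> n > 0 \<Longrightarrow> x ^ n \<in> nonunits"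
  by (cases n) (auto intro: nonunits_mult power nonunits_closed)

lemma nonunits_powerD: "x ^ n \<in> nonunits \<Longrightarrow> x \<in> A \<Longrightarrow> x \<in> nonunits"
  using units_power units_iff power by blast

lemma nonunits_prodD:
  "finite I \<Longrightarrow> (\<Prod>i\<in>I. f i) \<in> nonunits \<Longrightarrow> (\<And>i. i \<in> I \<Longrightarrow> f i \<in> A) \<Longrightarrow> \<exists>i\<in>I. f i \<in> nonunits"
proof (induction I rule: finite_induct)
  case empty
  then show ?case using units_one units_iff by auto
next
  case (insert x I)
  then show ?case
    using nonunits_multD[of "f x" "prod f I"] prod[of I f] by auto
qed

end

context valuation_ring
begin

text \<open>One of the quotients of \<open>x\<close> and \<open>y\<close> lies in \<open>A\<close>,
  so the sum is an \<open>A\<close>-multiple of one of the summands.\<close>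

lemma nonunits_add:
  assumes "x \<in> nonunits" "y \<in> nonunits"
  shows "x + y \<in> nonunits"
proof (cases "x = 0 \<or> y = 0")
  case False
  have x: "x + y = x * (1 + y * inverse x)" and y: "x + y = y * (1 + x * inverse y)"
    using False by (auto simp: field_simps)
  have "y * inverse x \<in> A \<or> x * inverse y \<in> A"
    using total[of "y * inverse x"] by (simp add: mult.commute)
  then show ?thesis
  proof
    assume "y * inverse x \<in> A"
    then show ?thesis
      unfolding x using assms one add by (intro nonunits_mult) auto
  next
    assume "x * inverse y \<in> A"
    then show ?thesis
      unfolding y using assms one add by (intro nonunits_mult) auto
  qed
qed (use assms in auto)

lemma nonunits_diff: "x \<in> nonunits \<Longrightarrow> y \<in> nonunits \<Longrightarrow> x - y \<in> nonunits"
  using nonunits_add[OF _ nonunits_uminus] by fastforce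

lemma nonunits_sum: "(\<And>i. i \<in> I \<Longrightarrow> f i \<in> nonunits) \<Longrightarrow> sum f I \<in> nonunits"
  by (induction I rule: infinite_finite_induct) (auto intro: nonunits_zero nonunits_add)

lemma nonunits_addD: "x + y \<in> nonunits \<Longrightarrow> x \<in> nonunits \<Longrightarrow> y \<in> nonunits"
  using nonunits_diff[of "x + y" x] by simp

lemma units_add_nonunits: "x \<in> units \<Longrightarrow> y \<in> nonunits \<Longrightarrow> x + y \<in> units"
  using nonunits_addD[of y x] units_iff nonunits_closed add by (auto simp: add.commute)

lemma units_cong: "x - y \<in> nonunits \<Longrightarrow> x \<in> units \<Longrightarrow> y \<in> units"
  using units_add_nonunits[of x "y - x"] nonunits_uminus[of "x - y"] by simp

lemma nonunits_cong: "x - y \<in> nonunits \<Longrightarrow> x \<in> nonunits \<Longrightarrow> y \<in> nonunits"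
  using nonunits_diff[of x "x - y"] by simp

lemma nonunits_power_diff:
  assumes "x - y \<in> nonunits" "x \<in> A" "y \<in> A"
  shows "x ^ n - y ^ n \<in> nonunits"
proof (induction n)
  case (Suc n)
  have "x ^ Suc n - y ^ Suc n = x * (x ^ n - y ^ n) + (x - y) * y ^ n"
    by (simp add: algebra_simps)
  also have "\<dots> \<in> nonunits"
    using Suc assms by (intro nonunits_add nonunits_mult' nonunits_mult power) auto
  finally show ?case .
qed (simp add: nonunits_zero)

lemma nonunits_poly_diff:
  assumes "\<And>i. coeff q i \<in> A" "x - y \<in> nonunits" "x \<in> A" "y \<in> A"
  shows "poly q x - poly q y \<in> nonunits"
proof -
  have "poly q x - poly q y = (\<Sum>i\<le>degree q. coeff q i * (x ^ i - y ^ i))"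
    by (simp add: poly_altdef sum_subtractf algebra_simps)
  also have "\<dots> \<in> nonunits"
    using assms by (intro nonunits_sum nonunits_mult' nonunits_power_diff) auto
  finally show ?thesis .
qed

lemma coeff_synthetic_div_closed:
  "(\<And>i. coeff q i \<in> A) \<Longrightarrow> x \<in> A \<Longrightarrow> coeff (synthetic_div q x) i \<in> A"
proof (induction q arbitrary: i)
  case (pCons a q)
  have q: "coeff q i \<in> A" for i
    using pCons.prems(1)[of "Suc i"] by simp
  show ?case
    using pCons.IH[OF q pCons.prems(2)] poly[OF q pCons.prems(2)]
    by (auto simp: coeff_pCons split: nat.splits)
qed (simp add: zero)

text \<open>Over the residue field this says that a nonzero polynomial has at most as many roots as its
  degree.\<close>

lemma coeffs_nonunits_of_roots:
  assumes "finite S" "\<And>x. x \<in> S \<Longrightarrow> x \<in> A"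
    and "\<And>x y. x \<in> S \<Longrightarrow> y \<in> S \<Longrightarrow> x \<noteq> y \<Longrightarrow> x - y \<in> units"
    and "\<And>i. coeff q i \<in> A" "degree q < card S" "\<And>x. x \<in> S \<Longrightarrow> poly q x \<in> nonunits"
  shows "coeff q i \<in> nonunits"
  using assms
proof (induction S arbitrary: q i rule: finite_induct)
  case (insert x S)
  define r where "r = synthetic_div q x"
  have q: "q = [:- x, 1:] * r + [:poly q x:]"
    unfolding r_def by (rule synthetic_div_correct'[symmetric])
  have r: "coeff r i \<in> A" for i
    unfolding r_def by (rule coeff_synthetic_div_closed) (use insert.prems(1,3) in auto)
  have r': "coeff r i \<in> nonunits" for i
  proof (cases "degree q = 0")
    \<comment> \<open>A constant \<open>q\<close> is treated apart: its quotient has degree 0, which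
      is not below \<open>card S\<close> when \<open>S\<close> is empty.\<close>
    case True
    then have "r = 0" by (simp add: r_def synthetic_div_eq_0_iff)
    then show ?thesis by (simp add: nonunits_zero)
  next
    case False
    show ?thesis
    proof (rule insert.IH)
      show "degree r < card S"
        using False insert.prems(4) insert.hyps by (simp add: r_def degree_synthetic_div)
      fix y assume y: "y \<in> S"
      have "poly q y = (y - x) * poly r y + poly q x"
        using arg_cong[OF q, of "\<lambda>f. poly f y"] by (simp add: algebra_simps)
      moreover have "poly q y \<in> nonunits" "poly q x \<in> nonunits" "y - x \<in> units"
        using insert.prems(2,5) y insert.hyps by auto
      ultimately have "(y - x) * poly r y \<in> nonunits"
        using nonunits_diff[of "poly q y" "poly q x"] by simp
      moreover have "poly r y \<in> A"
        using insert.prems(1) y by (intro poly r) simp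
      ultimately show "poly r y \<in> nonunits"
        using \<open>y - x \<in> units\<close> nonunits_unit_multD by blast
    qed (use insert.prems(1,2) r in auto)
  qed
  have "coeff q i = coeff ([:- x, 1:] * r) i + coeff [:poly q x:] i"
    using arg_cong[OF q, of "\<lambda>f. coeff f i"] by (simp only: coeff_add)
  also have "coeff ([:- x, 1:] * r) i = (case i of 0 \<Rightarrow> - x * coeff r 0 | Suc j \<Rightarrow> coeff r j - x * coeff r (Suc j))"
    by (auto simp: coeff_pCons split: nat.splits)
  also have "\<dots> + coeff [:poly q x:] i \<in> nonunits"
    using r' insert.prems(1,5)
    by (auto simp: coeff_pCons split: nat.splits
        intro!: nonunits_add nonunits_diff nonunits_mult' nonunits_zero nonunits_uminus)
  finally show ?case .
qed simp

end

lemma poly_pderiv_prod_root: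
  assumes "finite S" "x \<in> S"
  shows "poly (pderiv (\<Prod>z\<in>S. [:- z, 1:])) x = (\<Prod>z\<in>S - {x}. x - (z :: 'a :: idom))"
proof -
  have "(\<Prod>z\<in>S. [:- z, 1:]) = [:- x, 1:] * (\<Prod>z\<in>S - {x}. [:- z, 1:])"
    using assms by (rule prod.remove)
  then show ?thesis
    by (simp add: pderiv_mult pderiv_pCons poly_prod del: mult_pCons_left)
qed

lemma rsquarefree_monic_roots:
  fixes F :: "complex poly"
  assumes "lead_coeff F = 1" "rsquarefree F"
  shows "F = (\<Prod>z | poly F z = 0. [:- z, 1:])" "finite {z. poly F z = 0}"
    "card {z. poly F z = 0} = degree F"
proof -
  show F: "F = (\<Prod>z | poly F z = 0. [:- z, 1:])"
    using complex_poly_decompose_rsquarefree[OF assms(2)] assms(1) by simp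
  show "finite {z. poly F z = 0}"
    using assms by (intro poly_roots_finite) auto
  have "degree (\<Prod>z | poly F z = 0. [:- z, 1:]) = (\<Sum>z | poly F z = 0. degree [:- z, 1:])"
    by (rule degree_prod_sum_eq) auto
  also have "\<dots> = card {z. poly F z = 0}"
    by simp
  finally show "card {z. poly F z = 0} = degree F"
    by (simp only: F[symmetric])
qed

section \<open>Number fields and the index\<close>

abbreviation ipoly :: "int poly \<Rightarrow> complex \<Rightarrow> complex" where
  "ipoly P x \<equiv> poly (map_poly of_int P) x"

abbreviation rpoly :: "rat poly \<Rightarrow> complex \<Rightarrow> complex" where
  "rpoly T x \<equiv> poly (map_poly of_rat T) x"

lemma map_poly_of_int_add:
  "map_poly of_int (P + Q) = (map_poly of_int P + map_poly of_int Q :: 'a :: comm_ring_1 poly)"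
  by (simp add: poly_eq_iff coeff_map_poly)

lemma map_poly_of_int_diff:
  "map_poly of_int (P - Q) = (map_poly of_int P - map_poly of_int Q :: 'a :: comm_ring_1 poly)"
  by (simp add: poly_eq_iff coeff_map_poly)

lemma map_poly_of_int_mult:
  "map_poly of_int (P * Q) = (map_poly of_int P * map_poly of_int Q :: 'a :: comm_ring_1 poly)"
  by (simp add: poly_eq_iff coeff_map_poly coeff_mult)

lemma map_poly_of_int_pderiv:
  "map_poly of_int (pderiv P) = pderiv (map_poly of_int P :: 'a :: idom poly)"
  by (simp add: poly_eq_iff coeff_map_poly coeff_pderiv)

lemma map_poly_of_rat_add:
  "map_poly of_rat (P + Q) = (map_poly of_rat P + map_poly of_rat Q :: 'a :: field_char_0 poly)"
  by (simp add: poly_eq_iff coeff_map_poly of_rat_add)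

lemma map_poly_of_rat_mult:
  "map_poly of_rat (P * Q) = (map_poly of_rat P * map_poly of_rat Q :: 'a :: field_char_0 poly)"
  by (simp add: poly_eq_iff coeff_map_poly coeff_mult of_rat_sum of_rat_mult)

lemma map_poly_of_rat_of_int:
  "map_poly of_rat (map_poly of_int P) = (map_poly of_int P :: 'a :: field_char_0 poly)"
  by (simp add: poly_eq_iff coeff_map_poly)

lemma rpoly_pcompose: "rpoly (pcompose P Q) x = rpoly P (rpoly Q x)"
  by (induction P)
     (simp_all add: pcompose_pCons map_poly_pCons map_poly_of_rat_add map_poly_of_rat_mult)

lemma clear_denominators:
  obtains m :: int and P where "m \<noteq> 0" "map_poly of_int P = smult (of_int m) (T :: rat poly)"
proof -
  have "\<exists>m P. m \<noteq> 0 \<and> map_poly of_int P = smult (of_int m) (T :: rat poly)"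
  proof (induction T)
    case 0
    then show ?case by (intro exI[of _ 1] exI[of _ 0]) auto
  next
    case (pCons c T)
    then obtain m P where mP: "m \<noteq> 0" "map_poly of_int P = smult (of_int m) T" by auto
    obtain a b where ab: "quotient_of c = (a, b)" by fastforce
    then have b: "b > 0" "c = of_int a / of_int b"
      using quotient_of_denom_pos quotient_of_div by auto
    have "map_poly of_int (pCons (m * a) (smult b P)) = smult (of_int (m * b)) (pCons c T)"
      using b mP(2) by (auto simp: map_poly_pCons poly_eq_iff coeff_map_poly coeff_pCons field_simps split: nat.splits)
    then show ?case using mP(1) b by (intro exI[of _ "m * b"] exI) auto
  qed
  then show ?thesis using that by blast
qed

lemma rpoly_smult_of_int:
  assumes "map_poly of_int P = smult (of_int m) T"
  shows "ipoly P x = of_int m * rpoly T x"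
proof -
  have "ipoly P x = rpoly (map_poly of_int P) x"
    by (simp add: map_poly_of_rat_of_int)
  also have "map_poly of_rat (map_poly of_int P) = smult (of_int m :: complex) (map_poly of_rat T)"
    unfolding assms by (simp add: poly_eq_iff coeff_map_poly of_rat_mult)
  finally show ?thesis by simp
qed

lemma field_subring_Z_adjoin: "field_subring (Z_adjoin x)"
proof
  show "1 \<in> Z_adjoin x"
    unfolding Z_adjoin_def by (intro CollectI exI[of _ 1]) simp
next
  fix u v assume "u \<in> Z_adjoin x" "v \<in> Z_adjoin x"
  then obtain P Q where "u = ipoly P x" "v = ipoly Q x" by (auto simp: Z_adjoin_def)
  then have "u - v = ipoly (P - Q) x" "u * v = ipoly (P * Q) x"
    by (simp_all add: map_poly_of_int_diff map_poly_of_int_mult)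
  then show "u - v \<in> Z_adjoin x" "u * v \<in> Z_adjoin x"
    unfolding Z_adjoin_def by blast+
qed

lemma algebraic_int_ipoly: "algebraic_int x \<Longrightarrow> algebraic_int (ipoly P x)"
  by (rule algebraic_int_poly) (auto simp: coeff_map_poly)

lemma rpoly_in_Q_adjoin: "x \<in> Q_adjoin y \<Longrightarrow> rpoly T x \<in> Q_adjoin y"
  by (induction T) (auto simp: map_poly_pCons intro!: Q_adjoin.intros rat[where r = 0, simplified])

lemma Q_adjoin_mono: "x \<in> Q_adjoin y \<Longrightarrow> Q_adjoin x \<subseteq> Q_adjoin y"
proof
  fix z assume "x \<in> Q_adjoin y" "z \<in> Q_adjoin x"
  from this(2,1) show "z \<in> Q_adjoin y"
    by induction (auto intro: Q_adjoin.intros)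
qed

section \<open>The field generated by a root of a monic irreducible integer polynomial\<close>

locale monic_irreducible =
  fixes f :: "int poly" and \<alpha> :: complex
  assumes irreducible: "irreducible (map_poly of_int f :: rat poly)"
    and monic: "lead_coeff f = 1"
    and root: "ipoly f \<alpha> = 0"
begin

abbreviation fQ :: "rat poly" where "fQ \<equiv> map_poly of_int f"
abbreviation fC :: "complex poly" where "fC \<equiv> map_poly of_int f"

lemma degree_fQ: "degree fQ = degree f" and degree_fC: "degree fC = degree f"
  by (simp_all add: map_poly_degree_eq monic)

lemma monic_fC: "lead_coeff fC = 1"
  using monic by (simp add: degree_fC coeff_map_poly)

lemma degree_pos: "degree f > 0"
proof (rule ccontr)
  assume "\<not> ?thesis"
  then have "f = 1"
    using monic by (metis degree_eq_zeroE gr0I lead_coeff_pCons(2) one_pCons)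
  then show False using irreducible by simp
qed

lemma algebraic_int_root: "ipoly f x = 0 \<Longrightarrow> algebraic_int x"
  using monic algebraic_int_altdef_ipoly by blast

lemma bezout:
  assumes "\<not> fQ dvd T"
  obtains u v where "u * T + v * fQ = 1"
proof -
  have "coprime fQ T"
    using irreducible assms by (intro prime_elem_imp_coprime irreducible_imp_prime_elem_gcd)
  then have "gcd T fQ = 1" by (metis coprime_imp_gcd_eq_1 gcd.commute)
  then show ?thesis
    using that bezout_coefficients_fst_snd[of T fQ] by metis
qed

lemma dvd_of_root:
  assumes "ipoly f x = 0" "rpoly T x = 0"
  shows "fQ dvd T"
proof (rule ccontr)
  assume "\<not> fQ dvd T"
  then obtain u v where uv: "u * T + v * fQ = 1" by (rule bezout)
  have "rpoly (u * T + v * fQ) x = 0"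
    using assms by (simp add: map_poly_of_rat_add map_poly_of_rat_mult map_poly_of_rat_of_int)
  then show False using uv by simp
qed

lemma conjugate_root:
  assumes "rpoly T \<alpha> = 0" "ipoly f x = 0"
  shows "rpoly T x = 0"
proof -
  obtain U where "T = fQ * U" using dvd_of_root[OF root assms(1)] by (auto elim: dvdE)
  then show ?thesis using assms(2) by (simp add: map_poly_of_rat_mult map_poly_of_rat_of_int)
qed

text \<open>If a monic integer polynomial \<open>q\<close> kills \<open>T(\<alpha>)\<close>, then
  the composition of \<open>q\<close> with \<open>T\<close> vanishes at \<open>\<alpha>\<close>,
  hence at every conjugate.\<close>

lemma conjugate_algebraic_int:
  assumes "algebraic_int (rpoly T \<alpha>)" "ipoly f x = 0"
  shows "algebraic_int (rpoly T x)"
proof -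
  obtain q where q: "ipoly q (rpoly T \<alpha>) = 0" "lead_coeff q = 1"
    using assms(1) algebraic_int_altdef_ipoly by blast
  have "rpoly (pcompose (map_poly of_int q) T) x = 0"
    by (rule conjugate_root) (use q assms(2) in \<open>simp_all add: rpoly_pcompose map_poly_of_rat_of_int\<close>)
  then show ?thesis
    using q(2) algebraic_int_altdef_ipoly by (auto simp: rpoly_pcompose map_poly_of_rat_of_int)
qed

text \<open>A common root would make the irreducible polynomial divide its derivative, which is
  nonzero of smaller degree.\<close>

lemma pderiv_root: "ipoly f x = 0 \<Longrightarrow> ipoly (pderiv f) x \<noteq> 0"
proof
  assume "ipoly f x = 0" "ipoly (pderiv f) x = 0"
  then have "fQ dvd map_poly of_int (pderiv f)"
    by (intro dvd_of_root) (simp_all only: map_poly_of_rat_of_int)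
  then have "fQ dvd pderiv fQ"
    by (simp only: map_poly_of_int_pderiv)
  then have "pderiv fQ = 0"
    using dvd_imp_degree_le[of fQ "pderiv fQ"] degree_pos by (auto simp: degree_pderiv degree_fQ)
  then show False
    using degree_pos by (simp add: pderiv_eq_0_iff degree_fQ)
qed

lemma rsquarefree_fC: "rsquarefree fC"
  unfolding rsquarefree_roots using pderiv_root by (auto simp: map_poly_of_int_pderiv)

lemmas roots = rsquarefree_monic_roots[OF monic_fC rsquarefree_fC]

lemma Q_adjoin_eq: "Q_adjoin \<alpha> = range (\<lambda>T. rpoly T \<alpha>)"
proof
  show "range (\<lambda>T. rpoly T \<alpha>) \<subseteq> Q_adjoin \<alpha>"
    by (auto intro: rpoly_in_Q_adjoin Q_adjoin.gen)
  show "Q_adjoin \<alpha> \<subseteq> range (\<lambda>T. rpoly T \<alpha>)"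
  proof
    fix x assume "x \<in> Q_adjoin \<alpha>"
    then show "x \<in> range (\<lambda>T. rpoly T \<alpha>)"
    proof induction
      case (rat r)
      show ?case by (intro range_eqI[of _ _ "[:r:]"]) (simp add: map_poly_pCons)
    next
      case gen
      show ?case by (intro range_eqI[of _ _ "[:0, 1:]"]) (simp add: map_poly_pCons)
    next
      case (add x y)
      then obtain P Q where "x = rpoly P \<alpha>" "y = rpoly Q \<alpha>" by auto
      then show ?case by (intro range_eqI[of _ _ "P + Q"]) (simp add: map_poly_of_rat_add)
    next
      case (uminus x)
      then obtain P where "x = rpoly P \<alpha>" by auto
      then show ?case
        by (intro range_eqI[of _ _ "[:-1:] * P"]) (simp only: map_poly_of_rat_mult, simp add: map_poly_pCons)
    next
      case (mult x y)
      then obtain P Q where "x = rpoly P \<alpha>" "y = rpoly Q \<alpha>" by auto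
      then show ?case by (intro range_eqI[of _ _ "P * Q"]) (simp add: map_poly_of_rat_mult)
    next
      case (inverse x)
      then obtain P where P: "x = rpoly P \<alpha>" by auto
      show ?case
      proof (cases "fQ dvd P")
        case True
        then obtain U where "P = fQ * U" by (rule dvdE)
        then have "x = 0"
          using P root by (simp add: map_poly_of_rat_mult map_poly_of_rat_of_int)
        then show ?thesis by (intro range_eqI[of _ _ 0]) simp
      next
        case False
        then obtain u v where uv: "u * P + v * fQ = 1" by (rule bezout)
        have "rpoly u \<alpha> * x = rpoly (u * P + v * fQ) \<alpha>"
          using P root by (simp add: map_poly_of_rat_add map_poly_of_rat_mult map_poly_of_rat_of_int)
        then have "rpoly u \<alpha> * x = 1" using uv by simp
        then have "inverse x = rpoly u \<alpha>" by (simp add: inverse_unique mult.commute)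
        then show ?thesis by auto
      qed
    qed
  qed
qed

lemma Z_adjoin_reduce:
  assumes "x \<in> Z_adjoin \<alpha>"
  obtains P where "x = ipoly P \<alpha>" "degree P < degree f"
proof -
  obtain g where g: "x = ipoly g \<alpha>" using assms by (auto simp: Z_adjoin_def)
  \<comment> \<open>As \<open>f\<close> is monic, pseudo-division is genuine division with remainder
    over the integers.\<close>
  obtain q r where qr: "pseudo_divmod g f = (q, r)" by fastforce
  have "f \<noteq> 0" using degree_pos by auto
  then have "g = f * q + r" and r: "r = 0 \<or> degree r < degree f"
    using pseudo_divmod[OF _ qr] monic by auto
  then have "x = ipoly r \<alpha>"
    using g root by (simp add: map_poly_of_int_add map_poly_of_int_mult)
  then show ?thesis using that[of r] r degree_pos by auto
qed

end

lemma (in field_subring) coeff_prod_closed: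
  assumes "\<And>i j. i \<in> I \<Longrightarrow> coeff (q i) j \<in> A"
  shows "coeff (\<Prod>i\<in>I. q i) j \<in> A"
  using assms
proof (induction I arbitrary: j rule: infinite_finite_induct)
  case (insert i I)
  then show ?case by (auto simp: coeff_mult intro!: sum mult)
qed (auto simp: coeff_1 zero one)

lemma integral_coeffs:
  assumes "\<And>i. algebraic_int (of_rat (coeff U i) :: complex)"
  obtains P where "U = map_poly of_int P"
proof -
  have "coeff U i = of_int \<lfloor>coeff U i\<rfloor>" for i
  proof -
    have "(of_rat (coeff U i) :: complex) \<in> \<int>"
      using assms by (intro rational_algebraic_int_is_int) auto
    then obtain k where "of_rat (coeff U i) = (of_int k :: complex)" by (auto elim: Ints_cases)
    then have "of_rat (coeff U i) = (of_rat (of_int k) :: complex)" by simp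
    then have "coeff U i = of_int k" unfolding of_rat_eq_iff .
    then show ?thesis by simp
  qed
  then have "U = map_poly of_int (map_poly floor U)"
    by (simp add: poly_eq_iff coeff_map_poly)
  then show ?thesis by (rule that)
qed

context monic_irreducible
begin

text \<open>By Lagrange interpolation, \<open>g f' mod f\<close> is the sum of the \<open>g(z) f(X) / (X - z)\<close> over the
  roots \<open>z\<close> of \<open>f\<close>.\<close>

lemma different_mult_integer:
  assumes "x \<in> ring_of_integers (Q_adjoin \<alpha>)"
  shows "x * ipoly (pderiv f) \<alpha> \<in> Z_adjoin \<alpha>"
proof -
  obtain g where g: "x = rpoly g \<alpha>" and int: "algebraic_int (rpoly g \<alpha>)"
    using assms by (auto simp: ring_of_integers_def Q_adjoin_eq)
  define S where "S = {z. ipoly f z = 0}"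
  have S: "finite S" "card S = degree f" "fC = (\<Prod>z\<in>S. [:- z, 1:])"
    using roots by (simp_all only: S_def degree_fC)
  define T where "T = (\<Sum>z\<in>S. smult (rpoly g z) (\<Prod>w\<in>S - {z}. [:- w, 1:]))"
  define U where "U = (g * pderiv fQ) mod fQ"
  have U_root: "rpoly U z = rpoly g z * ipoly (pderiv f) z" if "ipoly f z = 0" for z
  proof -
    have "rpoly (g * pderiv fQ) z = rpoly ((g * pderiv fQ) div fQ * fQ + U) z"
      by (simp only: U_def div_mult_mod_eq)
    also have "\<dots> = rpoly U z"
      using that by (simp add: map_poly_of_rat_add map_poly_of_rat_mult map_poly_of_rat_of_int)
    also have "rpoly (g * pderiv fQ) z = rpoly g z * rpoly (map_poly of_int (pderiv f)) z"
      by (simp only: map_poly_of_rat_mult map_poly_of_int_pderiv poly_mult)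
    finally show ?thesis by (simp only: map_poly_of_rat_of_int)
  qed
  have T_root: "poly T z = rpoly g z * ipoly (pderiv f) z" if z: "z \<in> S" for z
  proof -
    have "poly T z = (\<Sum>w\<in>S. rpoly g w * (\<Prod>v\<in>S - {w}. z - v))"
      by (simp add: T_def poly_sum poly_prod)
    also have "\<dots> = (\<Sum>w\<in>{z}. rpoly g w * (\<Prod>v\<in>S - {w}. z - v))"
      using S(1) z by (intro sum.mono_neutral_right) auto
    also have "\<dots> = rpoly g z * poly (pderiv fC) z"
      by (simp add: S(3) poly_pderiv_prod_root[OF S(1) z])
    finally show ?thesis by (simp only: map_poly_of_int_pderiv)
  qed
  \<comment> \<open>Both sides have degree below the number of roots and agree at each root. The
    coefficients are then rational, coming from \<open>U\<close>, and algebraic integers, coming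
    from \<open>T\<close>; so they are integers.\<close>
  have "map_poly of_rat U = T"
  proof (rule poly_eqI_degree)
    show "poly (map_poly of_rat U) z = poly T z" if "z \<in> S" for z
      using that U_root T_root by (simp add: S_def)
    have "fQ \<noteq> 0" using degree_fQ degree_pos by force
    then have "degree U < degree fQ"
      using degree_pos degree_mod_less'[of fQ "g * pderiv fQ"] degree_fQ
      by (cases "U = 0") (auto simp: U_def)
    then show "degree (map_poly of_rat U :: complex poly) < card S"
      using S(2) degree_fQ map_poly_degree_leq[of "of_rat :: rat \<Rightarrow> complex" U] by simp
    show "degree T < card S"
      unfolding T_def
    proof (rule degree_sum_less)
      show "0 < card S" using S(2) degree_pos by simp
      fix z assume z: "z \<in> S"
      have "degree (smult (rpoly g z) (\<Prod>w\<in>S - {z}. [:- w, 1:])) \<le> degree (\<Prod>w\<in>S - {z}. [:- w, 1:])"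
        by (rule degree_smult_le)
      also have "\<dots> = card (S - {z})"
        by (subst degree_prod_sum_eq) auto
      also have "\<dots> < card S" using z S(1) by (intro card_Diff1_less)
      finally show "degree (smult (rpoly g z) (\<Prod>w\<in>S - {z}. [:- w, 1:])) < card S" .
    qed
  qed
  moreover have "algebraic_int (coeff T i)" for i
  proof -
    interpret AI: field_subring "{x :: complex. algebraic_int x}"
      by (rule field_subring_algebraic_int)
    have "coeff T i \<in> {x. algebraic_int x}"
      unfolding T_def coeff_sum coeff_smult
    proof (intro AI.sum AI.mult AI.coeff_prod_closed)
      fix z assume "z \<in> S"
      then show "rpoly g z \<in> {x. algebraic_int x}"
        using conjugate_algebraic_int[OF int] by (simp add: S_def)
    next
      fix z w j assume "w \<in> S - {z}"
      then show "coeff [:- w, 1:] j \<in> {x. algebraic_int x}"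
        using algebraic_int_root[of w] by (auto simp: S_def coeff_pCons split: nat.splits)
    qed
    then show ?thesis by simp
  qed
  ultimately have "algebraic_int (of_rat (coeff U i) :: complex)" for i
    by (metis coeff_map_poly of_rat_0)
  then obtain P where P: "U = map_poly of_int P" by (rule integral_coeffs)
  have "x * ipoly (pderiv f) \<alpha> = ipoly P \<alpha>"
    using U_root[OF root] by (simp add: P g map_poly_of_rat_of_int)
  then show ?thesis by (auto simp: Z_adjoin_def)
qed

text \<open>Multiplication by \<open>f'(\<alpha>)\<close> carries the ring of integers into
  \<open>\<int>[\<alpha>]\<close>, and some nonzero integer multiple of
  \<open>1 / f'(\<alpha>)\<close> lies in \<open>\<int>[\<alpha>]\<close>.\<close>

lemma denominator_bound:
  obtains D :: int where "D \<noteq> 0"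
    "\<And>x. x \<in> ring_of_integers (Q_adjoin \<alpha>) \<Longrightarrow> of_int D * x \<in> Z_adjoin \<alpha>"
proof -
  let ?d = "ipoly (pderiv f) \<alpha>"
  have d: "?d \<noteq> 0" by (rule pderiv_root[OF root])
  have "?d \<in> Q_adjoin \<alpha>"
    unfolding Q_adjoin_eq by (rule range_eqI[of _ _ "map_poly of_int (pderiv f)"]) (simp only: map_poly_of_rat_of_int)
  then have "inverse ?d \<in> Q_adjoin \<alpha>" by (rule Q_adjoin.inverse)
  then obtain v where v: "inverse ?d = rpoly v \<alpha>" by (auto simp: Q_adjoin_eq)
  obtain m P where mP: "m \<noteq> 0" "map_poly of_int P = smult (of_int m) v"
    by (rule clear_denominators)
  show ?thesis
  proof (rule that[OF mP(1)])
    fix x assume "x \<in> ring_of_integers (Q_adjoin \<alpha>)"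
    then have 1: "x * ?d \<in> Z_adjoin \<alpha>" by (rule different_mult_integer)
    have "ipoly P \<alpha> = of_int m * inverse ?d"
      using rpoly_smult_of_int[OF mP(2)] v by simp
    then have "of_int m * x = ipoly P \<alpha> * (x * ?d)"
      using d by simp
    moreover have "ipoly P \<alpha> \<in> Z_adjoin \<alpha>" by (auto simp: Z_adjoin_def)
    ultimately show "of_int m * x \<in> Z_adjoin \<alpha>"
      using 1 field_subring.mult[OF field_subring_Z_adjoin] by metis
  qed
qed

lemma Z_adjoin_subset_integers: "Z_adjoin \<alpha> \<subseteq> ring_of_integers (Q_adjoin \<alpha>)"
proof
  fix x assume "x \<in> Z_adjoin \<alpha>"
  then obtain P where P: "x = ipoly P \<alpha>" by (auto simp: Z_adjoin_def)
  have "x = rpoly (map_poly of_int P) \<alpha>" by (simp only: map_poly_of_rat_of_int P)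
  then have "x \<in> Q_adjoin \<alpha>" unfolding Q_adjoin_eq by (rule range_eqI)
  then show "x \<in> ring_of_integers (Q_adjoin \<alpha>)"
    using algebraic_int_ipoly[OF algebraic_int_root[OF root]] P
    by (simp add: ring_of_integers_def)
qed

end

section \<open>The additive index and torsion in the quotient\<close>

lemma add_closed_ring_of_integers:
  assumes "x \<in> ring_of_integers (Q_adjoin \<alpha>)" "y \<in> ring_of_integers (Q_adjoin \<alpha>)"
  shows "x + y \<in> ring_of_integers (Q_adjoin \<alpha>)" "- x \<in> ring_of_integers (Q_adjoin \<alpha>)"
  using assms by (auto simp: ring_of_integers_def intro: Q_adjoin.intros algebraic_int_add)

lemma zero_in_ring_of_integers: "0 \<in> ring_of_integers (Q_adjoin \<alpha>)"
  using Q_adjoin.rat[of 0] by (simp add: ring_of_integers_def)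

text \<open>If \<open>p\<close> divided the order of the quotient group, Sylow's theorem would give
  a nontrivial subgroup of order \<open>p ^ a\<close>; a nontrivial element of it lifts to some
  \<open>x\<close> outside \<open>B\<close> with \<open>p ^ a * x\<close> in
  \<open>B\<close>.\<close>

lemma add_index_not_dvd:
  fixes A B :: "complex set"
  assumes A: "0 \<in> A" "\<And>x y. x \<in> A \<Longrightarrow> y \<in> A \<Longrightarrow> x + y \<in> A" "\<And>x. x \<in> A \<Longrightarrow> - x \<in> A"
    and B: "0 \<in> B" "\<And>x y. x \<in> B \<Longrightarrow> y \<in> B \<Longrightarrow> x + y \<in> B" "\<And>x. x \<in> B \<Longrightarrow> - x \<in> B" "B \<subseteq> A"
    and fin: "finite (A // {(x, y) \<in> A \<times> A. x - y \<in> B})"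
    and p: "prime p"
    and torsion: "\<And>x. x \<in> A \<Longrightarrow> of_nat p * x \<in> B \<Longrightarrow> x \<in> B"
  shows "\<not> p dvd add_index A B"
proof
  assume dvd: "p dvd add_index A B"
  define G where "G = \<lparr>carrier = A, monoid.mult = (+), one = (0 :: complex)\<rparr>"
  have "comm_group G"
    by (rule comm_groupI) (use A in \<open>auto simp: G_def add_ac intro!: bexI[of _ "- _"]\<close>)
  then interpret G: comm_group G .
  have inv: "inv\<^bsub>G\<^esub> x = - x" if "x \<in> A" for x
    using that A by (intro G.inv_equality) (auto simp: G_def)
  have "subgroup B G"
    by (rule G.subgroupI) (use B inv in \<open>auto simp: G_def subset_iff\<close>)
  then have "B \<lhd> G" by (rule G.subgroup_imp_normal)
  then interpret B: normal B G .
  define Q where "Q = G Mod B"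
  interpret Q: comm_group Q
    unfolding Q_def using \<open>subgroup B G\<close> by (rule G.abelian_FactGroup)
  have coset: "B #>\<^bsub>G\<^esub> x = {(x, y) \<in> A \<times> A. x - y \<in> B} `` {x}" if "x \<in> A" for x
  proof -
    have "\<exists>b\<in>B. y = b + x" if "y \<in> A" "x - y \<in> B" for y
      using that B(3)[of "x - y"] by (intro bexI[of _ "y - x"]) auto
    moreover have "b + x \<in> A" "- b \<in> B" if "b \<in> B" for b
      using that \<open>x \<in> A\<close> A B by auto
    ultimately show ?thesis
      using \<open>x \<in> A\<close> by (auto simp: r_coset_def G_def)
  qed
  have carrier_Q: "carrier Q = (\<lambda>x. B #>\<^bsub>G\<^esub> x) ` A"
    by (auto simp: Q_def FactGroup_def RCOSETS_def G_def)
  have "carrier Q = A // {(x, y) \<in> A \<times> A. x - y \<in> B}"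
    unfolding carrier_Q quotient_def using coset by auto
  then have order: "order Q = add_index A B" and fin_Q: "finite (carrier Q)"
    using fin by (simp_all add: order_def add_index_def)
  have pow: "(B #>\<^bsub>G\<^esub> x) [^]\<^bsub>Q\<^esub> (n :: nat) = B #>\<^bsub>G\<^esub> (of_nat n * x) \<and> of_nat n * x \<in> A"
    if x: "x \<in> A" for x n
  proof (induction n)
    case 0
    have "B #>\<^bsub>G\<^esub> 0 = B" using B(4) by (auto simp: r_coset_def G_def)
    then show ?case using A by (simp add: Q_def FactGroup_def)
  next
    case (Suc n)
    have "(B #>\<^bsub>G\<^esub> x) [^]\<^bsub>Q\<^esub> Suc n = (B #>\<^bsub>G\<^esub> (of_nat n * x)) <#>\<^bsub>G\<^esub> (B #>\<^bsub>G\<^esub> x)"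
      using Suc by (simp add: Q_def FactGroup_def)
    also have "\<dots> = B #>\<^bsub>G\<^esub> (of_nat n * x + x)"
      using B.rcos_sum[of "of_nat n * x" x] Suc x by (simp add: G_def)
    finally show ?case using Suc A x by (simp add: algebra_simps)
  qed
  have torsion': "x \<in> B" if "x \<in> A" "of_nat (p ^ n) * x \<in> B" for n x
    using that
  proof (induction n)
    case (Suc n)
    then show ?case using torsion[of "of_nat (p ^ n) * x"] pow[of x "p ^ n"] by (simp add: mult_ac)
  qed simp
  define a where "a = multiplicity p (order Q)"
  have "order Q > 0" using fin_Q Q.one_closed by (auto simp: order_def card_gt_0_iff)
  then have a: "a > 0" and "p ^ a dvd order Q"
    using dvd p by (auto simp: a_def order multiplicity_dvd prime_multiplicity_gt_zero_iff)
  then obtain m where "order Q = p ^ a * m" by (auto elim: dvdE)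
  then obtain H where H: "subgroup H Q" "card H = p ^ a"
    using sylow_thm[OF p Q.is_group _ fin_Q] by blast
  have H_sub: "H \<subseteq> carrier Q" using H(1) by (rule subgroup.subset)
  then have "finite H" using fin_Q finite_subset by blast
  have "card H > 1"
    using H(2) a p prime_gt_1_nat one_less_power by metis
  then have "H \<noteq> {\<one>\<^bsub>Q\<^esub>}" by auto
  then obtain C where C: "C \<in> H" "C \<noteq> \<one>\<^bsub>Q\<^esub>"
    using subgroup.one_closed[OF H(1)] by blast
  then have CQ: "C \<in> carrier Q" using H_sub by auto
  have inj: "inj_on (\<lambda>h. C \<otimes>\<^bsub>Q\<^esub> h) H"
    using CQ H_sub by (intro inj_onI) (metis Q.Units_l_cancel Q.Units_eq subset_iff)
  \<comment> \<open>Multiplication by \<open>C\<close> permutes \<open>H\<close>. Comparing the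
    product over \<open>H\<close> before and after shows that the power of \<open>C\<close> with
    exponent \<open>card H\<close> is trivial.\<close>
  have "finprod Q (\<lambda>h. h) H = finprod Q (\<lambda>h. h) ((\<lambda>h. C \<otimes>\<^bsub>Q\<^esub> h) ` H)"
  proof -
    have "(\<lambda>h. C \<otimes>\<^bsub>Q\<^esub> h) ` H = H"
    proof (rule card_subset_eq[OF \<open>finite H\<close>])
      show "(\<lambda>h. C \<otimes>\<^bsub>Q\<^esub> h) ` H \<subseteq> H"
        using subgroup.m_closed[OF H(1) C(1)] by auto
      show "card ((\<lambda>h. C \<otimes>\<^bsub>Q\<^esub> h) ` H) = card H"
        using inj by (rule card_image)
    qed
    then show ?thesis by simp
  qed
  also have "\<dots> = finprod Q (\<lambda>h. C \<otimes>\<^bsub>Q\<^esub> h) H"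
    using CQ H_sub inj by (intro Q.finprod_reindex) auto
  also have "\<dots> = finprod Q (\<lambda>_. C) H \<otimes>\<^bsub>Q\<^esub> finprod Q (\<lambda>h. h) H"
    using CQ H_sub by (intro Q.finprod_multf) auto
  also have "finprod Q (\<lambda>_. C) H = C [^]\<^bsub>Q\<^esub> card H"
    using CQ by (rule Q.finprod_const)
  finally have prod_eq: "finprod Q (\<lambda>h. h) H = C [^]\<^bsub>Q\<^esub> card H \<otimes>\<^bsub>Q\<^esub> finprod Q (\<lambda>h. h) H" .
  have "finprod Q (\<lambda>h. h) H \<in> carrier Q"
    using H_sub by (intro Q.finprod_closed) auto
  then have "C [^]\<^bsub>Q\<^esub> card H = \<one>\<^bsub>Q\<^esub>"
    using prod_eq Q.r_cancel_one' Q.nat_pow_closed[OF CQ] by blast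
  then have "C [^]\<^bsub>Q\<^esub> (p ^ a) = \<one>\<^bsub>Q\<^esub>" by (simp only: H(2))
  moreover obtain x where x: "x \<in> A" "C = B #>\<^bsub>G\<^esub> x" using CQ carrier_Q by auto
  ultimately have "B #>\<^bsub>G\<^esub> (of_nat (p ^ a) * x) = B"
    using pow[of x "p ^ a"] by (simp add: Q_def FactGroup_def)
  then have "of_nat (p ^ a) * x \<in> B"
    using B(1) by (auto simp: r_coset_def G_def)
  then have "x \<in> B" using torsion' x by blast
  moreover have "x \<in> carrier G" using x by (simp add: G_def)
  ultimately have "B #>\<^bsub>G\<^esub> x = B"
    using G.coset_join2 \<open>subgroup B G\<close> by blast
  then show False using C x by (simp add: Q_def FactGroup_def)
qed

context monic_irreducible
begin

text \<open>With \<open>D\<close> a common denominator, the class of \<open>x\<close> is determined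
  by the finitely many coefficients of \<open>D x\<close> modulo \<open>D\<close>.\<close>

lemma finite_quotient:
  "finite (ring_of_integers (Q_adjoin \<alpha>) //
     {(x, y) \<in> ring_of_integers (Q_adjoin \<alpha>) \<times> ring_of_integers (Q_adjoin \<alpha>). x - y \<in> Z_adjoin \<alpha>})"
  (is "finite (?A // ?r)")
proof -
  interpret Z: field_subring "Z_adjoin \<alpha>" by (rule field_subring_Z_adjoin)
  have equiv: "equiv ?A ?r"
  proof (rule equivI)
    show "?r \<subseteq> ?A \<times> ?A" by auto
    show "refl_on ?A ?r" by (auto simp: refl_on_def Z.zero)
    show "sym ?r"
      unfolding sym_def using Z.uminus by fastforce
    show "trans ?r"
      unfolding trans_def using Z.add by fastforce
  qed
  obtain D where D: "D \<noteq> 0" "\<And>x. x \<in> ?A \<Longrightarrow> of_int D * x \<in> Z_adjoin \<alpha>"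
    using denominator_bound by blast
  have "\<exists>P. of_int D * x = ipoly P \<alpha> \<and> degree P < degree f" if "x \<in> ?A" for x
    using Z_adjoin_reduce[OF D(2)[OF that]] by blast
  then obtain g where g: "\<And>x. x \<in> ?A \<Longrightarrow> of_int D * x = ipoly (g x) \<alpha> \<and> degree (g x) < degree f"
    by metis
  define rep where "rep C = (SOME x. x \<in> C)" for C :: "complex set"
  have rep: "rep C \<in> C" "rep C \<in> ?A" if "C \<in> ?A // ?r" for C
  proof -
    have "C \<noteq> {}" "C \<subseteq> ?A"
      using that equiv by (auto simp: in_quotient_imp_non_empty in_quotient_imp_subset)
    then show "rep C \<in> C" "rep C \<in> ?A"
      using some_in_eq[of C] unfolding rep_def by blast+
  qed
  have g_rep: "of_int D * rep C = ipoly (g (rep C)) \<alpha>" "degree (g (rep C)) < degree f"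
    if "C \<in> ?A // ?r" for C
    using g[OF rep(2)[OF that]] by auto
  define key where "key C = restrict (\<lambda>i. coeff (g (rep C)) i mod \<bar>D\<bar>) {..<degree f}" for C
  have "inj_on key (?A // ?r)"
  proof (rule inj_onI)
    fix C C' assume C: "C \<in> ?A // ?r" "C' \<in> ?A // ?r" and eq: "key C = key C'"
    have "D dvd coeff (g (rep C) - g (rep C')) i" for i
    proof (cases "i < degree f")
      case True
      then have "coeff (g (rep C)) i mod \<bar>D\<bar> = coeff (g (rep C')) i mod \<bar>D\<bar>"
        using fun_cong[OF eq, of i] by (simp add: key_def)
      then show ?thesis by (simp add: mod_eq_dvd_iff)
    next
      case False
      moreover have "degree (g (rep C)) < degree f" "degree (g (rep C')) < degree f"
        using g_rep C by auto
      ultimately show ?thesis by (simp add: coeff_eq_0)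
    qed
    then obtain h where h: "g (rep C) - g (rep C') = smult D h"
      using const_poly_dvd_iff[of D "g (rep C) - g (rep C')"] by (auto elim!: dvdE)
    have "of_int D * (rep C - rep C') = ipoly (g (rep C) - g (rep C')) \<alpha>"
      by (simp add: right_diff_distrib g_rep[OF C(1)] g_rep[OF C(2)] map_poly_of_int_diff)
    also have "\<dots> = of_int D * ipoly h \<alpha>"
      unfolding h by (simp add: map_poly_smult)
    finally have "rep C - rep C' = ipoly h \<alpha>" using D(1) by simp
    then have "(rep C, rep C') \<in> ?r"
      using rep(2)[OF C(1)] rep(2)[OF C(2)] by (auto simp: Z_adjoin_def)
    then show "C = C'"
      using quotient_eqI[OF equiv C rep(1)[OF C(1)] rep(1)[OF C(2)]] by blast
  qed
  moreover have "key ` (?A // ?r) \<subseteq> ({..<degree f} \<rightarrow>\<^sub>E {0..<\<bar>D\<bar>})"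
    using D(1) by (auto simp: key_def split: if_splits)
  moreover have "finite ({..<degree f} \<rightarrow>\<^sub>E {0..<\<bar>D\<bar>})"
    by (intro finite_PiE) auto
  ultimately show ?thesis
    using finite_imageD finite_subset by blast
qed

text \<open>The hypothesis \<open>maximal\<close> says that the powers of \<open>\<alpha>\<close>
  are independent modulo \<open>p\<close>; so \<open>p x \<in> \<int>[\<alpha>]\<close> has
  coordinates divisible by \<open>p\<close>, and the quotient has no
  \<open>p\<close>-torsion.\<close>

lemma index_not_dvd:
  assumes p: "prime p"
    and maximal: "\<And>P i. degree P < degree f \<Longrightarrow> algebraic_int (ipoly P \<alpha> / of_nat p) \<Longrightarrow> int p dvd coeff P i"
  shows "\<not> p dvd add_index (ring_of_integers (Q_adjoin \<alpha>)) (Z_adjoin \<alpha>)"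
proof (rule add_index_not_dvd[OF _ _ _ _ _ _ _ finite_quotient p])
  interpret Z: field_subring "Z_adjoin \<alpha>" by (rule field_subring_Z_adjoin)
  fix x assume x: "x \<in> ring_of_integers (Q_adjoin \<alpha>)" "of_nat p * x \<in> Z_adjoin \<alpha>"
  obtain P where P: "of_nat p * x = ipoly P \<alpha>" "degree P < degree f"
    using Z_adjoin_reduce[OF x(2)] by blast
  have p0: "of_nat p \<noteq> (0 :: complex)" using p prime_gt_0_nat by fastforce
  then have "x = ipoly P \<alpha> / of_nat p" using P(1) by (simp add: field_simps)
  then have "int p dvd coeff P i" for i
    using maximal[OF P(2)] x(1) by (simp add: ring_of_integers_def)
  then obtain h where "P = smult (int p) h"
    using const_poly_dvd_iff[of "int p" P] by (auto elim!: dvdE)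
  then have "of_nat p * x = of_nat p * ipoly h \<alpha>"
    using P(1) by (simp add: map_poly_smult)
  then show "x \<in> Z_adjoin \<alpha>" using p0 by (auto simp: Z_adjoin_def)
qed (auto intro: add_closed_ring_of_integers zero_in_ring_of_integers
  field_subring.closed[OF field_subring_Z_adjoin] Z_adjoin_subset_integers[THEN subsetD])

end

section \<open>Primitive elements and their minimal polynomials\<close>

lemma vector_space_rat_complex: "vector_space (\<lambda>(r :: rat) (z :: complex). of_rat r * z)"
  by unfold_locales (simp_all add: algebra_simps of_rat_add of_rat_mult)

interpretation QC: vector_space "\<lambda>(r :: rat) (z :: complex). of_rat r * z"
  by (rule vector_space_rat_complex)

text \<open>Vanishing of the coefficients from \<open>k\<close> on, unlike a strict degree bound,
  also gives the right set for \<open>k = 0\<close>.\<close>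

lemma span_powers_subset:
  "QC.span ((\<lambda>i. y ^ i) ` {..<k}) \<subseteq> {rpoly T y | T. \<forall>i\<ge>k. coeff T i = 0}"
proof (rule QC.span_minimal)
  show "(\<lambda>i. y ^ i) ` {..<k} \<subseteq> {rpoly T y | T. \<forall>i\<ge>k. coeff T i = 0}"
  proof clarify
    fix i assume "i < k"
    then show "\<exists>T. y ^ i = rpoly T y \<and> (\<forall>i\<ge>k. coeff T i = 0)"
      by (intro exI[of _ "monom 1 i"]) (auto simp: map_poly_monom poly_monom)
  qed
  show "QC.subspace {rpoly T y | T. \<forall>i\<ge>k. coeff T i = 0}"
  proof (rule QC.subspaceI)
    show "0 \<in> {rpoly T y | T. \<forall>i\<ge>k. coeff T i = 0}"
      by (intro CollectI exI[of _ 0]) simp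
  next
    fix u v assume "u \<in> {rpoly T y | T. \<forall>i\<ge>k. coeff T i = 0}" "v \<in> {rpoly T y | T. \<forall>i\<ge>k. coeff T i = 0}"
    then obtain T U where "u = rpoly T y" "\<forall>i\<ge>k. coeff T i = 0" "v = rpoly U y" "\<forall>i\<ge>k. coeff U i = 0"
      by auto
    then show "u + v \<in> {rpoly T y | T. \<forall>i\<ge>k. coeff T i = 0}"
      by (intro CollectI exI[of _ "T + U"]) (simp add: map_poly_of_rat_add)
  next
    fix c u assume "u \<in> {rpoly T y | T. \<forall>i\<ge>k. coeff T i = 0}"
    then obtain T where "u = rpoly T y" "\<forall>i\<ge>k. coeff T i = 0" by auto
    then show "of_rat c * u \<in> {rpoly T y | T. \<forall>i\<ge>k. coeff T i = 0}"
      by (intro CollectI exI[of _ "[:c:] * T"])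
         (simp only: map_poly_of_rat_mult poly_mult, simp add: map_poly_pCons)
  qed
qed

context monic_irreducible
begin

lemma Q_adjoin_subset_span: "Q_adjoin \<alpha> \<subseteq> QC.span ((\<lambda>i. \<alpha> ^ i) ` {..<degree f})"
proof
  fix x assume "x \<in> Q_adjoin \<alpha>"
  then obtain T where T: "x = rpoly T \<alpha>" by (auto simp: Q_adjoin_eq)
  define U where "U = T mod fQ"
  have "fQ \<noteq> 0" using degree_fQ degree_pos by force
  then have deg: "degree U < degree f"
    using degree_pos degree_mod_less'[of fQ T] degree_fQ by (cases "U = 0") (auto simp: U_def)
  have "rpoly (T div fQ * fQ + U) \<alpha> = rpoly U \<alpha>"
    using root by (simp add: map_poly_of_rat_add map_poly_of_rat_mult map_poly_of_rat_of_int)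
  then have "x = rpoly U \<alpha>"
    by (simp only: U_def div_mult_mod_eq T)
  also have "\<dots> = (\<Sum>i\<le>degree U. of_rat (coeff U i) * \<alpha> ^ i)"
    by (simp add: poly_altdef coeff_map_poly map_poly_degree_eq degree_map_poly)
  also have "\<dots> \<in> QC.span ((\<lambda>i. \<alpha> ^ i) ` {..<degree f})"
    using deg by (intro QC.span_sum QC.span_scale QC.span_base) auto
  finally show "x \<in> QC.span ((\<lambda>i. \<alpha> ^ i) ` {..<degree f})" .
qed

context
  fixes \<theta>
  assumes \<theta>: "\<theta> \<in> Q_adjoin \<alpha>" "algebraic_int \<theta>"
    and indep: "\<And>T. rpoly T \<theta> = 0 \<Longrightarrow> degree T < degree f \<Longrightarrow> T = 0"
begin

text \<open>By \<open>indep\<close> the first \<open>degree f\<close> powers of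
  \<open>\<theta>\<close> are linearly independent over the rationals; the space is spanned by that
  many powers of \<open>\<alpha>\<close>, so they form a basis.\<close>

lemma Q_adjoin_subset_range:
  assumes "x \<in> Q_adjoin \<alpha>"
  obtains T where "x = rpoly T \<theta>" "\<And>i. i \<ge> degree f \<Longrightarrow> coeff T i = 0"
proof -
  have *: "QC.independent ((\<lambda>i. \<theta> ^ i) ` {..<k}) \<and> card ((\<lambda>i. \<theta> ^ i) ` {..<k}) = k"
    if "k \<le> degree f" for k
    using that
  proof (induction k)
    case (Suc k)
    have notin: "\<theta> ^ k \<notin> QC.span ((\<lambda>i. \<theta> ^ i) ` {..<k})"
    proof
      assume "\<theta> ^ k \<in> QC.span ((\<lambda>i. \<theta> ^ i) ` {..<k})"
      then obtain T where T: "\<theta> ^ k = rpoly T \<theta>" "\<forall>i\<ge>k. coeff T i = 0"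
        using span_powers_subset by blast
      have "rpoly (monom (- 1) k + T) \<theta> = 0"
        using T(1) by (simp add: map_poly_of_rat_add map_poly_monom poly_monom)
      moreover have "degree (monom (- 1) k + T) \<le> k"
        using T(2) by (intro degree_le) auto
      ultimately have "monom (- 1) k + T = 0"
        using Suc.prems by (intro indep) auto
      then have "coeff (monom (- 1) k + T) k = 0" by simp
      then show False using T(2) by simp
    qed
    then have "\<theta> ^ k \<notin> (\<lambda>i. \<theta> ^ i) ` {..<k}"
      using QC.span_base[of "\<theta> ^ k"] by (rule contrapos_nn)
    then show ?case
      using Suc notin by (simp add: lessThan_Suc QC.independent_insert)
  qed (simp add: QC.independent_empty)
  have "x \<in> QC.span ((\<lambda>i. \<theta> ^ i) ` {..<degree f})"
  proof (rule ccontr)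
    assume x: "x \<notin> QC.span ((\<lambda>i. \<theta> ^ i) ` {..<degree f})"
    then have x': "x \<notin> (\<lambda>i. \<theta> ^ i) ` {..<degree f}"
      using QC.span_base[of x] by (rule contrapos_nn)
    let ?S = "insert x ((\<lambda>i. \<theta> ^ i) ` {..<degree f})"
    have "QC.independent ?S"
      using * x by (intro QC.independent_insertI) auto
    moreover have "\<theta> ^ i \<in> Q_adjoin \<alpha>" for i
      using rpoly_in_Q_adjoin[OF \<theta>(1), of "monom 1 i"] by (simp add: map_poly_monom poly_monom)
    then have "?S \<subseteq> QC.span ((\<lambda>i. \<alpha> ^ i) ` {..<degree f})"
      using assms Q_adjoin_subset_span by blast
    ultimately have "card ?S \<le> card ((\<lambda>i. \<alpha> ^ i) ` {..<degree f})"
      using QC.independent_span_bound by blast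
    also have "\<dots> \<le> degree f" using card_image_le[of "{..<degree f}"] by fastforce
    finally show False using * x' by simp
  qed
  then show ?thesis using span_powers_subset that by blast
qed

lemma Q_adjoin_primitive: "Q_adjoin \<theta> = Q_adjoin \<alpha>"
proof
  show "Q_adjoin \<theta> \<subseteq> Q_adjoin \<alpha>" using \<theta>(1) by (rule Q_adjoin_mono)
  obtain T where "\<alpha> = rpoly T \<theta>"
    using Q_adjoin_subset_range[OF Q_adjoin.gen] by blast
  then have "\<alpha> \<in> Q_adjoin \<theta>"
    using rpoly_in_Q_adjoin[OF Q_adjoin.gen] by metis
  then show "Q_adjoin \<alpha> \<subseteq> Q_adjoin \<theta>" by (rule Q_adjoin_mono)
qed

text \<open>Expressing \<open>\<theta> ^ n\<close> by lower powers gives a monic rational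
  \<open>H\<close>. By \<open>indep\<close> it divides a monic integer polynomial, so its roots are
  algebraic integers and its coefficients integers. It is irreducible because a factor vanishing at
  \<open>\<theta>\<close> must have full degree.\<close>

lemma primitive_minimal_polynomial:
  obtains h where "monic_irreducible h \<theta>" "degree h = degree f"
proof -
  define n where "n = degree f"
  have "\<theta> ^ n \<in> Q_adjoin \<alpha>"
    using rpoly_in_Q_adjoin[OF \<theta>(1), of "monom 1 n"] by (simp add: map_poly_monom poly_monom)
  then obtain T where T: "\<theta> ^ n = rpoly T \<theta>" "\<And>i. i \<ge> n \<Longrightarrow> coeff T i = 0"
    using Q_adjoin_subset_range n_def by metis
  define H where "H = monom 1 n - T"
  have H_n: "coeff H n = 1" using T(2) by (simp add: H_def)
  have "degree H \<le> n" using T(2) by (intro degree_le) (auto simp: H_def)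
  moreover have "degree H \<ge> n" using H_n by (intro le_degree) simp
  ultimately have deg: "degree H = n" by simp
  have "rpoly (H + T) \<theta> = \<theta> ^ n" by (simp add: H_def map_poly_monom poly_monom)
  then have H_root: "rpoly H \<theta> = 0" using T(1) by (simp add: map_poly_of_rat_add)
  obtain q where q: "ipoly q \<theta> = 0" "lead_coeff q = 1"
    using \<theta>(2) algebraic_int_altdef_ipoly by blast
  define R where "R = map_poly of_int q mod H"
  have H0: "H \<noteq> 0" using H_n by auto
  have "rpoly (map_poly of_int q div H * H + R) \<theta> = 0"
    unfolding R_def div_mult_mod_eq map_poly_of_rat_of_int by (rule q(1))
  then have "rpoly R \<theta> = 0"
    using H_root by (simp add: map_poly_of_rat_add map_poly_of_rat_mult)
  moreover have "degree R < n"
    using degree_mod_less'[OF H0, of "map_poly of_int q"] deg degree_pos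
    by (cases "R = 0") (auto simp: R_def n_def)
  ultimately have "R = 0" using indep n_def by blast
  then have dvd: "H dvd map_poly of_int q" by (simp add: R_def mod_eq_0_iff_dvd)
  let ?HC = "map_poly of_rat H :: complex poly"
  have HC: "lead_coeff ?HC = 1"
    using H_n deg by (simp add: degree_map_poly coeff_map_poly)
  obtain z where z: "smult (lead_coeff ?HC) (\<Prod>i<degree ?HC. [:- z i, 1:]) = ?HC"
    by (rule complex_poly_decompose')
  have z: "?HC = (\<Prod>i<degree ?HC. [:- z i, 1:])"
    using z HC by simp
  have alg: "algebraic_int (z i)" if "i < degree ?HC" for i
  proof -
    have "poly (\<Prod>i<degree ?HC. [:- z i, 1:]) (z i) = 0"
      using that by (auto simp: poly_prod)
    then have 0: "rpoly H (z i) = 0" by (simp only: z[symmetric])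
    obtain U where "map_poly of_int q = H * U" using dvd by (rule dvdE)
    then have "rpoly (map_poly of_int q) (z i) = 0"
      using 0 by (simp add: map_poly_of_rat_mult)
    then show ?thesis
      unfolding map_poly_of_rat_of_int using q(2) algebraic_int_altdef_ipoly by blast
  qed
  have "algebraic_int (of_rat (coeff H i) :: complex)" for i
  proof -
    interpret AI: field_subring "{x :: complex. algebraic_int x}"
      by (rule field_subring_algebraic_int)
    have "coeff (\<Prod>i<degree ?HC. [:- z i, 1:]) i \<in> {x. algebraic_int x}"
      by (rule AI.coeff_prod_closed) (use alg in \<open>auto simp: coeff_pCons split: nat.splits\<close>)
    then have "algebraic_int (coeff ?HC i)" by (simp only: z[symmetric] mem_Collect_eq)
    then show ?thesis by (simp add: coeff_map_poly)
  qed
  then obtain h where h: "H = map_poly of_int h" by (rule integral_coeffs)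
  have deg_h: "degree h = n" using deg h by (simp add: degree_map_poly)
  have "irreducible H"
  proof (rule irreducibleI)
    show "H \<noteq> 0" by fact
    show "\<not> H dvd 1" using deg degree_pos n_def by (simp add: is_unit_iff_degree[OF H0])
    fix u v assume uv: "H = u * v"
    then have nz: "u \<noteq> 0" "v \<noteq> 0" using H0 by auto
    then have sum: "degree u + degree v = n" using uv deg by (simp add: degree_mult_eq)
    have "rpoly u \<theta> * rpoly v \<theta> = 0" using H_root uv by (simp add: map_poly_of_rat_mult)
    then have "degree u \<ge> n \<or> degree v \<ge> n"
      using indep nz n_def by (metis linorder_not_le mult_eq_0_iff)
    then have "degree u = 0 \<or> degree v = 0" using sum by auto
    then show "u dvd 1 \<or> v dvd 1" using nz by (simp add: is_unit_iff_degree)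
  qed
  then have "monic_irreducible h \<theta>"
    using h H_n deg_h H_root by unfold_locales (auto simp: coeff_map_poly map_poly_of_rat_of_int)
  then show ?thesis using that deg_h n_def by blast
qed

end

text \<open>Reduction of the whole problem to one well-chosen integral
  \<open>\<theta> = T(\<alpha>)\<close>: its index is among those whose gcd is taken. That
  \<open>\<theta>\<close> generates the field is a consequence of \<open>maximal\<close>.\<close>

lemma field_index_not_dvd:
  assumes p: "prime p" and int: "algebraic_int (rpoly T \<alpha>)"
    and maximal: "\<And>P i. degree P < degree f \<Longrightarrow> algebraic_int (ipoly P (rpoly T \<alpha>) / of_nat p) \<Longrightarrow>
      int p dvd coeff P i"
  shows "\<not> p dvd field_index (Q_adjoin \<alpha>)"
proof -
  let ?\<theta> = "rpoly T \<alpha>"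
  have \<theta>: "?\<theta> \<in> Q_adjoin \<alpha>" by (auto simp: Q_adjoin_eq)
  \<comment> \<open>A rational relation scales to a primitive integer polynomial vanishing at
    \<open>\<theta>\<close>. Since \<open>0 / p\<close> is integral, \<open>maximal\<close> would
    make \<open>p\<close> divide its content 1.\<close>
  have indep: "U = 0" if U: "rpoly U ?\<theta> = 0" "degree U < degree f" for U
  proof (rule ccontr)
    assume "U \<noteq> 0"
    obtain m P where mP: "m \<noteq> 0" "map_poly of_int P = smult (of_int m) U"
      by (rule clear_denominators)
    have "P \<noteq> 0" using mP \<open>U \<noteq> 0\<close> by auto
    have "degree P = degree U"
      using arg_cong[OF mP(2), of degree] mP(1) by (simp add: degree_map_poly)
    then have deg: "degree (primitive_part P) < degree f" using U(2) by simp
    have "ipoly P ?\<theta> = 0" using rpoly_smult_of_int[OF mP(2)] U(1) by simp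
    then have "ipoly (smult (content P) (primitive_part P)) ?\<theta> = 0" by simp
    then have "of_int (content P) * ipoly (primitive_part P) ?\<theta> = 0"
      by (simp add: map_poly_smult del: content_times_primitive_part)
    then have "ipoly (primitive_part P) ?\<theta> = 0" using \<open>P \<noteq> 0\<close> by simp
    then have "int p dvd coeff (primitive_part P) i" for i
      using maximal[OF deg] by simp
    then have "int p dvd content (primitive_part P)"
      by (metis const_poly_dvd_iff const_poly_dvd_iff_dvd_content)
    then show False using \<open>P \<noteq> 0\<close> p by simp
  qed
  obtain h where h: "monic_irreducible h ?\<theta>" "degree h = degree f"
    using primitive_minimal_polynomial[OF \<theta> int indep] by metis
  have K: "Q_adjoin ?\<theta> = Q_adjoin \<alpha>"
    by (rule Q_adjoin_primitive[OF \<theta> int indep])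
  have "\<not> p dvd add_index (ring_of_integers (Q_adjoin ?\<theta>)) (Z_adjoin ?\<theta>)"
    by (rule monic_irreducible.index_not_dvd[OF h(1) p]) (use maximal h(2) in auto)
  moreover have "add_index (ring_of_integers (Q_adjoin \<alpha>)) (Z_adjoin ?\<theta>) \<in>
      {add_index (ring_of_integers (Q_adjoin \<alpha>)) (Z_adjoin \<theta>) | \<theta>.
         \<theta> \<in> ring_of_integers (Q_adjoin \<alpha>) \<and> Q_adjoin \<alpha> = Q_adjoin \<theta>}"
    using K \<theta> int by (auto simp: ring_of_integers_def)
  then have "field_index (Q_adjoin \<alpha>) dvd add_index (ring_of_integers (Q_adjoin \<alpha>)) (Z_adjoin ?\<theta>)"
    unfolding field_index_def by (rule Gcd_dvd)
  ultimately show ?thesis using K dvd_trans by metis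
qed

end

section \<open>Places above a prime\<close>

text \<open>Divisibility of \<open>P(\<theta>)\<close> by \<open>p\<close> passes to all conjugates,
  so that a single valuation ring can be used together with all roots.\<close>

lemma (in monic_irreducible) conjugate_quotient:
  assumes "algebraic_int (ipoly P (rpoly T \<alpha>) / of_nat p)" "ipoly f x = 0"
  shows "algebraic_int (ipoly P (rpoly T x) / of_nat p)"
proof -
  have "rpoly ([:1 / of_nat p:] * pcompose (map_poly of_int P) T) y = ipoly P (rpoly T y) / of_nat p" for y
    by (simp only: map_poly_of_rat_mult poly_mult rpoly_pcompose map_poly_of_rat_of_int)
       (simp add: map_poly_pCons of_rat_divide)
  then show ?thesis
    using conjugate_algebraic_int[of "[:1 / of_nat p:] * pcompose (map_poly of_int P) T"] assms by simp
qed

locale p_valuation = valuation_ring A for A :: "complex set" +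
  fixes p :: nat
  assumes prime_p: "prime p" and p_nonunit: "of_nat p \<in> nonunits"

lemma exists_p_valuation:
  assumes "prime p"
  obtains A where "p_valuation A p"
proof -
  have Z: "field_subring (\<int> :: complex set)" by standard auto
  have "inverse (of_nat p) \<notin> (\<int> :: complex set)"
  proof
    assume "inverse (of_nat p) \<in> (\<int> :: complex set)"
    then obtain k where "inverse (of_nat p) = (of_int k :: complex)" by (auto elim: Ints_cases)
    then have "(of_int (k * int p) :: complex) = of_int 1"
      using assms prime_gt_0_nat[OF assms] by (simp add: field_simps)
    then have "k * int p = 1" by (simp only: of_int_eq_iff)
    then have "int p dvd 1" by (metis dvd_triv_right)
    then show False using assms by simp
  qed
  moreover have "of_nat p \<in> (\<int> :: complex set)" by simp
  ultimately obtain V where V: "valuation_ring V" "\<int> \<subseteq> V" "inverse (of_nat p) \<notin> (V :: complex set)"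
    using exists_valuation_ring[OF Z] by metis
  interpret V: valuation_ring V by fact
  have "p_valuation V p"
    by unfold_locales (use assms V V.of_nat in \<open>auto simp: V.nonunits_def\<close>)
  then show ?thesis by (rule that)
qed

context p_valuation
begin

lemma algebraic_int_closed: "algebraic_int x \<Longrightarrow> x \<in> A"
  using algebraic_int_iff_valuation valuation_ring_axioms by blast

lemma of_int_nonunits_iff: "of_int n \<in> nonunits \<longleftrightarrow> int p dvd n"
proof
  assume "int p dvd n"
  then obtain k where "n = int p * k" by (rule dvdE)
  then show "of_int n \<in> nonunits" using nonunits_mult[OF p_nonunit of_int[of k]] by simp
next
  assume n: "of_int n \<in> nonunits"
  show "int p dvd n"
  proof (rule ccontr)
    assume "\<not> int p dvd n"
    then have "coprime (int p) n" using prime_p by (simp add: prime_imp_coprime)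
    then obtain u v where "u * int p + v * n = 1"
      using bezout_int[of "int p" n] by auto
    then have "of_int (u * int p + v * n) = (1 :: complex)" by simp
    then have "of_int u * of_nat p + of_int v * of_int n = (1 :: complex)" by simp
    moreover have "of_int u * of_nat p + of_int v * of_int n \<in> nonunits"
      using n p_nonunit by (intro nonunits_add nonunits_mult' of_int)
    ultimately show False using units_one units_iff by simp
  qed
qed

lemma of_int_units_iff: "of_int n \<in> units \<longleftrightarrow> \<not> int p dvd n"
  using of_int_nonunits_iff units_iff of_int by blast

lemma coeff_ipoly_closed: "coeff (map_poly of_int P) i \<in> A"
  by (simp add: coeff_map_poly of_int)

lemma ipoly_closed: "x \<in> A \<Longrightarrow> ipoly P x \<in> A"
  by (intro poly coeff_ipoly_closed)

lemma ipoly_cong: "x - y \<in> nonunits \<Longrightarrow> x \<in> A \<Longrightarrow> y \<in> A \<Longrightarrow> ipoly P x - ipoly P y \<in> nonunits"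
  by (intro nonunits_poly_diff coeff_ipoly_closed)

text \<open>The derivative at a root \<open>x\<close> is the product of all differences
  \<open>x - z\<close>; if it is a unit, so is each factor, and the roots stay distinct in the
  residue field.\<close>

lemma separable_roots:
  assumes F: "lead_coeff F = 1" "\<And>i. coeff F i \<in> A"
    and sep: "\<And>x. poly F x = 0 \<Longrightarrow> poly (pderiv F) x \<in> units"
  shows "finite {x. poly F x = 0}" "card {x. poly F x = 0} = degree F"
    "\<And>x. poly F x = 0 \<Longrightarrow> x \<in> A"
    "\<And>x y. poly F x = 0 \<Longrightarrow> poly F y = 0 \<Longrightarrow> x \<noteq> y \<Longrightarrow> x - y \<in> units"
    "F = (\<Prod>z | poly F z = 0. [:- z, 1:])"
proof -
  have "rsquarefree F"
    unfolding rsquarefree_roots using sep units_nonzero by blast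
  note roots = rsquarefree_monic_roots[OF F(1) this]
  show "finite {x. poly F x = 0}" "card {x. poly F x = 0} = degree F"
    "F = (\<Prod>z | poly F z = 0. [:- z, 1:])" by (fact roots)+
  show closed: "x \<in> A" if "poly F x = 0" for x
    using integrally_closed[OF F that] .
  fix x y assume xy: "poly F x = 0" "poly F y = 0" "x \<noteq> y"
  have "poly (pderiv F) x = (\<Prod>z\<in>{z. poly F z = 0} - {x}. x - z)"
    using poly_pderiv_prod_root[OF roots(2), of x] xy roots(1)[symmetric] by simp
  also have "\<dots> = (x - y) * (\<Prod>z\<in>{z. poly F z = 0} - {x} - {y}. x - z)"
    using xy roots(2) by (intro prod.remove) auto
  finally have "(x - y) * (\<Prod>z\<in>{z. poly F z = 0} - {x} - {y}. x - z) \<in> units"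
    using sep[OF xy(1)] by simp
  moreover have "(\<Prod>z\<in>{z. poly F z = 0} - {x} - {y}. x - z) \<in> A"
    using closed xy(1) by (intro prod diff) auto
  ultimately show "x - y \<in> units"
    using units_multD diff[OF closed[OF xy(1)] closed[OF xy(2)]] by blast
qed

lemma int_coeffs_dvd_of_roots:
  assumes "finite S" "\<And>x. x \<in> S \<Longrightarrow> x \<in> A"
    and "\<And>x y. x \<in> S \<Longrightarrow> y \<in> S \<Longrightarrow> x \<noteq> y \<Longrightarrow> x - y \<in> units"
    and "degree Q < card S" "\<And>x. x \<in> S \<Longrightarrow> ipoly Q x \<in> nonunits"
  shows "int p dvd coeff Q i"
proof -
  have "degree (map_poly of_int Q :: complex poly) < card S"
    using assms(4) map_poly_degree_leq[of "of_int :: int \<Rightarrow> complex" Q] by simp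
  then have "coeff (map_poly of_int Q) i \<in> nonunits"
    using assms by (intro coeffs_nonunits_of_roots[of S] coeff_ipoly_closed) auto
  then show ?thesis by (simp add: coeff_map_poly of_int_nonunits_iff)
qed

end

section \<open>Independence modulo \<open>p\<close> at ramified places\<close>

lemma poly_int_dvd_factor:
  assumes "\<And>i. k dvd coeff (P :: int poly) i"
  obtains Q where "P = smult k Q"
  using assms const_poly_dvd_iff[of k P] by (auto elim!: dvdE)

lemma coeff_pcompose_monom:
  assumes "e > 0"
  shows "coeff (pcompose R (monom 1 e)) (e * i) = coeff (R :: 'a :: comm_ring_1 poly) i"
proof (induction R arbitrary: i)
  case (pCons c R)
  show ?case
  proof (cases i)
    case 0
    then show ?thesis using assms by (simp add: pcompose_pCons coeff_monom_mult)
  next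
    case (Suc k)
    then have "e * i \<noteq> 0" "e * i - e = e * k" "e \<le> e * i" using assms by auto
    then show ?thesis
      using pCons.IH[of k] Suc assms by (simp add: pcompose_pCons coeff_monom_mult coeff_pCons split: nat.splits)
  qed
qed simp

context p_valuation
begin

text \<open>Induction on \<open>l\<close> by division by \<open>\<Phi> = X ^ d + c\<close>. The
  remainder \<open>R\<close> has degree below \<open>d\<close> and vanishes modulo
  \<open>\<pi>\<close> at the residues \<open>x ^ e\<close>, hence is divisible by \<open>p\<close>.
  At the unit roots \<open>\<Phi>(\<theta>)\<close> is \<open>\<pi> ^ d\<close> times a unit, so the
  quotient is divisible by \<open>\<pi> ^ (d * l)\<close> there. For \<open>l = 0\<close> the degree
  bound is contradictory.\<close>

lemma ramified_coeffs_dvd: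
  fixes c :: int
  assumes \<pi>: "\<pi> \<in> A" "\<pi> ^ (d * e) = of_nat p" and d: "d > 0" and e: "e > 0"
    and \<Gamma>: "finite \<Gamma>" "\<And>x. x \<in> \<Gamma> \<Longrightarrow> x \<in> A"
      "\<And>x y. x \<in> \<Gamma> \<Longrightarrow> y \<in> \<Gamma> \<Longrightarrow> x \<noteq> y \<Longrightarrow> x - y \<in> units" "card \<Gamma> = d * e + \<delta>"
      "\<And>x. x \<in> \<Gamma> \<Longrightarrow> x \<in> nonunits \<Longrightarrow> \<delta> > 0"
    and \<theta>: "\<And>x. x \<in> \<Gamma> \<Longrightarrow> \<theta> x \<in> A" "\<And>x. x \<in> \<Gamma> \<Longrightarrow> \<theta> x - x ^ e \<in> nonunits"
    and \<phi>: "\<And>x. x \<in> \<Gamma> \<Longrightarrow> x \<in> units \<Longrightarrow> \<exists>u\<in>units. \<theta> x ^ d + of_int c = \<pi> ^ d * u"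
  shows "l \<le> e \<Longrightarrow> degree P < d * l \<Longrightarrow>
    (\<And>x. x \<in> \<Gamma> \<Longrightarrow> x \<in> units \<Longrightarrow> \<exists>y\<in>A. ipoly P (\<theta> x) = \<pi> ^ (d * l) * y) \<Longrightarrow> int p dvd coeff P i"
proof (induction l arbitrary: P i)
  case (Suc l)
  have "\<pi> ^ (d * e) \<in> nonunits" using \<pi>(2) p_nonunit by simp
  then have \<pi>_nonunit: "\<pi> \<in> nonunits" using \<pi>(1) by (rule nonunits_powerD)
  have \<pi>0: "\<pi> \<noteq> 0" using \<pi>(2) d e prime_gt_0_nat[OF prime_p] by (auto simp: power_0_left)
  define \<Phi> where "\<Phi> = monom 1 d + [:c:]"
  have \<Phi>_deg: "degree \<Phi> = d" and \<Phi>_lead: "lead_coeff \<Phi> = 1"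
  proof -
    show *: "degree \<Phi> = d"
      unfolding \<Phi>_def using d by (subst degree_add_eq_left) (auto simp: degree_monom_eq)
    show "lead_coeff \<Phi> = 1" unfolding * using d by (simp add: \<Phi>_def coeff_pCons split: nat.splits)
  qed
  have \<Phi>_eval: "ipoly \<Phi> x = x ^ d + of_int c" for x
    by (simp add: \<Phi>_def map_poly_of_int_add map_poly_monom poly_monom map_poly_pCons)
  have \<Phi>0: "\<Phi> \<noteq> 0" using \<Phi>_lead by auto
  obtain Q R where "pseudo_divmod P \<Phi> = (Q, R)" by fastforce
  from pseudo_divmod[OF \<Phi>0 this] have P: "P = \<Phi> * Q + R" and R: "R = 0 \<or> degree R < d"
    using \<Phi>_lead \<Phi>_deg by auto
  have P_eval: "ipoly P x = (x ^ d + of_int c) * ipoly Q x + ipoly R x" for x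
    by (simp add: P map_poly_of_int_add map_poly_of_int_mult \<Phi>_eval)
  have "int p dvd coeff R i" for i
  proof -
    \<comment> \<open>Substituting \<open>X ^ e\<close> turns a polynomial in
      \<open>\<theta> x\<close> into one in \<open>x\<close> modulo \<open>\<pi>\<close>, and the
      factor \<open>X ^ \<delta>\<close> supplies a zero at nonunit roots. The degree is at most
      \<open>\<delta> + (d - 1) * e\<close>, fewer than the roots in
      \<open>\<Gamma>\<close>.\<close>
    define Q' where "Q' = monom 1 \<delta> * pcompose R (monom 1 e)"
    have "degree Q' \<le> \<delta> + degree R * e"
      unfolding Q'_def by (rule order.trans[OF degree_mult_le]) (simp add: degree_pcompose degree_monom_eq)
    also have "degree R * e \<le> (d - 1) * e"
      using R d by (intro mult_le_mono1) auto
    also have "\<delta> + (d - 1) * e < card \<Gamma>"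
      using d e \<Gamma>(4) by (cases d) auto
    finally have "degree Q' < card \<Gamma>" by simp
    moreover have "ipoly Q' x \<in> nonunits" if x: "x \<in> \<Gamma>" for x
    proof -
      have R_eval: "ipoly (pcompose R (monom 1 e)) x = ipoly R (x ^ e)"
        by (induction R) (simp_all add: pcompose_pCons map_poly_pCons map_poly_of_int_add
            map_poly_of_int_mult map_poly_monom poly_monom)
      have eval: "ipoly Q' x = x ^ \<delta> * ipoly R (x ^ e)"
        by (simp add: Q'_def map_poly_of_int_mult map_poly_monom poly_monom R_eval)
      have xA: "x \<in> A" using \<Gamma>(2) x by blast
      show ?thesis
      proof (cases "x \<in> units")
        case False
        then have "x \<in> nonunits" using xA units_iff by blast
        then show ?thesis
          unfolding eval using \<Gamma>(5) x xA by (intro nonunits_mult nonunits_power ipoly_closed power) auto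
      next
        case True
        obtain y where y: "y \<in> A" "ipoly P (\<theta> x) = \<pi> ^ (d * Suc l) * y"
          using Suc.prems(3) x True by blast
        obtain u where u: "u \<in> units" "\<theta> x ^ d + of_int c = \<pi> ^ d * u"
          using \<phi> x True by blast
        have "ipoly R (\<theta> x) = \<pi> ^ (d * Suc l) * y - \<pi> ^ d * (u * ipoly Q (\<theta> x))"
          using P_eval[of "\<theta> x", unfolded u(2) y(2)] by (simp add: algebra_simps)
        also have "\<dots> \<in> nonunits"
          using \<pi>_nonunit d y u \<theta>(1)[OF x] units_closed
          by (intro nonunits_diff nonunits_mult nonunits_power mult ipoly_closed) auto
        finally have "ipoly R (\<theta> x) \<in> nonunits" .
        then have "ipoly R (x ^ e) \<in> nonunits"
          using ipoly_cong[OF \<theta>(2)[OF x], of R] \<theta>(1)[OF x] power[OF xA] nonunits_cong by blast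
        then show ?thesis unfolding eval using xA by (intro nonunits_mult' power)
      qed
    qed
    ultimately have "int p dvd coeff Q' (\<delta> + e * i)"
      using \<Gamma>(1-3) by (intro int_coeffs_dvd_of_roots[of \<Gamma>]) auto
    also have "coeff Q' (\<delta> + e * i) = coeff R i"
      using e by (simp add: Q'_def coeff_monom_mult coeff_pcompose_monom)
    finally show ?thesis .
  qed
  note p_R = this
  then obtain R' where R': "R = smult (int p) R'" using poly_int_dvd_factor by blast
  have p_Q: "int p dvd coeff Q i" for i
  proof (cases "Q = 0")
    case False
    have "degree (\<Phi> * Q) = d + degree Q" using False \<Phi>0 \<Phi>_deg by (simp add: degree_mult_eq)
    moreover have "degree P = degree (\<Phi> * Q)"
    proof (cases "R = 0")
      case False
      then show ?thesis unfolding P using R calculation by (intro degree_add_eq_left) auto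
    qed (simp add: P)
    ultimately have deg: "degree Q < d * l" using Suc.prems(2) by simp
    show ?thesis
    proof (rule Suc.IH[OF _ deg])
      show "l \<le> e" using Suc.prems(1) by simp
      fix x assume x: "x \<in> \<Gamma>" "x \<in> units"
      obtain y where y: "y \<in> A" "ipoly P (\<theta> x) = \<pi> ^ (d * Suc l) * y"
        using Suc.prems(3) x by blast
      obtain u where u: "u \<in> units" "\<theta> x ^ d + of_int c = \<pi> ^ d * u"
        using \<phi> x by blast
      \<comment> \<open>Here \<open>Suc l \<le> e\<close> is needed: a remainder divisible by
        \<open>p = \<pi> ^ (d * e)\<close> is divisible by \<open>\<pi> ^ (d * Suc l)\<close> and
        can be subtracted.\<close>
      have "d * e = d * Suc l + d * (e - Suc l)"
        using Suc.prems(1) by (metis add_mult_distrib2 le_add_diff_inverse)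
      then have p_eq: "(of_nat p :: complex) = \<pi> ^ (d * Suc l) * \<pi> ^ (d * (e - Suc l))"
        using \<pi>(2) by (simp flip: power_add)
      define w where "w = y - \<pi> ^ (d * (e - Suc l)) * ipoly R' (\<theta> x)"
      have w: "w \<in> A"
        unfolding w_def using y \<pi>(1) \<theta>(1)[OF x(1)] by (intro diff mult power ipoly_closed)
      have "ipoly R (\<theta> x) = \<pi> ^ (d * Suc l) * (\<pi> ^ (d * (e - Suc l)) * ipoly R' (\<theta> x))"
        by (simp add: R' map_poly_smult p_eq)
      then have "\<pi> ^ d * u * ipoly Q (\<theta> x) = \<pi> ^ (d * Suc l) * w"
        using P_eval[of "\<theta> x"] y(2) u(2) by (simp add: w_def right_diff_distrib)
      then have "\<pi> ^ d * (u * ipoly Q (\<theta> x)) = \<pi> ^ d * (\<pi> ^ (d * l) * w)"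
        by (simp add: power_add mult_ac)
      then have "u * ipoly Q (\<theta> x) = \<pi> ^ (d * l) * w" using \<pi>0 by simp
      then have "ipoly Q (\<theta> x) = \<pi> ^ (d * l) * (w * inverse u)"
        using units_nonzero[OF u(1)] by (simp add: field_simps)
      then show "\<exists>y\<in>A. ipoly Q (\<theta> x) = \<pi> ^ (d * l) * y"
        using w units_inverse[OF u(1)] mult by blast
    qed
  qed simp
  show ?case
    unfolding P coeff_add coeff_mult using p_R p_Q by (intro dvd_add dvd_sum dvd_mult) auto
qed simp

end

lemma trinomial9_eq: "trinomial9 a b = [:b, a, 0, 0, 0, 0, 0, 0, 0, 1:]"
  by (simp add: trinomial9_def monom_altdef numeral_eq_Suc)

lemma degree_trinomial9: "degree (trinomial9 a b) = 9"
  and lead_coeff_trinomial9: "lead_coeff (trinomial9 a b) = 1"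
  by (simp_all add: trinomial9_eq)

lemma ipoly_trinomial9: "ipoly (trinomial9 a b) x = x ^ 9 + of_int a * x + of_int b"
  by (simp add: trinomial9_eq map_poly_pCons algebra_simps flip: power_Suc2) (simp add: eval_nat_numeral)

lemma ipoly_pderiv_trinomial9: "ipoly (pderiv (trinomial9 a b)) x = 9 * x ^ 8 + of_int a"
  by (simp add: trinomial9_eq map_poly_pCons pderiv_pCons algebra_simps) (simp add: eval_nat_numeral)

lemma (in field_subring) binomial_quadratic_remainder:
  assumes "x \<in> A" "y \<in> A"
  shows "\<exists>r\<in>A. (x + y) ^ d = x ^ d + of_nat d * x ^ (d - 1) * y + y ^ 2 * r"
proof (induction d)
  case 0
  then show ?case by (intro bexI[of _ 0]) (auto intro: zero)
next
  case (Suc d)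
  then obtain r where r: "r \<in> A" "(x + y) ^ d = x ^ d + of_nat d * x ^ (d - 1) * y + y ^ 2 * r"
    by auto
  have d: "of_nat d * x ^ d = of_nat d * x ^ (d - 1) * x" by (cases d) auto
  have "(x + y) ^ Suc d = (x + y) * (x ^ d + of_nat d * x ^ (d - 1) * y + y ^ 2 * r)"
    by (simp add: r(2))
  also have "\<dots> = x ^ Suc d + (of_nat d * x ^ (d - 1) * x + x ^ d) * y
      + y ^ 2 * (of_nat d * x ^ (d - 1) + (x + y) * r)"
    by (simp add: algebra_simps power2_eq_square)
  also have "\<dots> = x ^ Suc d + of_nat (Suc d) * x ^ (Suc d - 1) * y
      + y ^ 2 * (of_nat d * x ^ (d - 1) + (x + y) * r)"
    by (simp only: d[symmetric]) (simp add: algebra_simps)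
  finally show ?case
    using r(1) assms by (intro bexI[of _ "of_nat d * x ^ (d - 1) + (x + y) * r"]) (auto intro!: closed)
qed

context p_valuation
begin

text \<open>Put \<open>\<gamma> = \<alpha> / \<pi> ^ N\<close>. The exponent conditions give
  \<open>\<gamma> ^ e = \<alpha> ^ e / p ^ M\<close> and
  \<open>\<pi> ^ d * \<gamma> ^ i = \<alpha> ^ i / p ^ j\<close>, so
  \<open>\<theta> = \<gamma> ^ e + t \<pi> ^ d \<gamma> ^ i\<close> lies in the field. The
  expression required to be a unit is, modulo nonunits, the coefficient of \<open>\<pi> ^ d\<close>
  in \<open>\<theta> ^ d + c\<close>. The case \<open>\<delta> = 1\<close> is that of a nonunit root
  of the scaled trinomial.\<close>

lemma ramified_index:
  fixes a b c t :: int and A' B' \<pi> :: complex and \<delta> :: nat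
  assumes irred: "monic_irreducible (trinomial9 a b) \<alpha>"
    and \<pi>: "algebraic_int \<pi>" "\<pi> ^ (d * e) = of_nat p" and d: "d > 0" and e: "e > 0"
    and exps: "d * e + \<delta> = 9" "\<delta> \<le> 1" "e * N = d * e * M" "i * N = d * e * j + d"
    and AB: "algebraic_int A'" "algebraic_int B'"
      "of_int a = \<pi> ^ (8 * N) * A'" "of_int b = \<pi> ^ (9 * N) * B'"
    and sep: "\<And>x. x ^ 9 + A' * x + B' = 0 \<Longrightarrow> x \<in> A \<Longrightarrow> 9 * x ^ 8 + A' \<in> units"
    and unit: "\<And>x. x ^ 9 + A' * x + B' = 0 \<Longrightarrow> x \<in> units \<Longrightarrow>
      \<exists>\<epsilon>\<in>A. x ^ (d * e) + of_int c = \<pi> ^ d * \<epsilon> \<and> \<epsilon> + of_nat d * of_int t * x ^ (e * (d - 1) + i) \<in> units"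
    and nonunit: "\<And>x. x ^ 9 + A' * x + B' = 0 \<Longrightarrow> x \<in> nonunits \<Longrightarrow> \<delta> > 0"
    and ex_nonunit: "\<delta> > 0 \<Longrightarrow> \<exists>x. x ^ 9 + A' * x + B' = 0 \<and> x \<in> nonunits"
  shows "\<not> p dvd field_index (Q_adjoin \<alpha>)"
proof -
  interpret monic_irreducible "trinomial9 a b" \<alpha> by fact
  have p0: "(of_nat p :: complex) \<noteq> 0" using prime_gt_0_nat[OF prime_p] by simp
  have \<pi>0: "\<pi> \<noteq> 0" using \<pi>(2) d e p0 by (auto simp: power_0_left)
  have \<pi>A: "\<pi> \<in> A" using \<pi>(1) by (rule algebraic_int_closed)
  have "\<pi> ^ (d * e) \<in> nonunits" using \<pi>(2) p_nonunit by simp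
  then have \<pi>_nonunit: "\<pi> \<in> nonunits" using \<pi>A by (rule nonunits_powerD)
  define F where "F = [:B', A', 0, 0, 0, 0, 0, 0, 0, 1:]"
  have F_eval: "poly F x = x ^ 9 + A' * x + B'" for x
    by (simp add: F_def algebra_simps) (simp add: eval_nat_numeral)
  have F'_eval: "poly (pderiv F) x = 9 * x ^ 8 + A'" for x
    by (simp add: F_def pderiv_pCons algebra_simps) (simp add: eval_nat_numeral)
  have F_lead: "lead_coeff F = 1" and F_deg: "degree F = 9" by (simp_all add: F_def)
  have F_int: "algebraic_int (coeff F k)" for k
    unfolding F_def using AB by (auto simp: coeff_pCons split: nat.splits)
  have F_A: "coeff F k \<in> A" for k using F_int by (rule algebraic_int_closed)
  note \<Gamma> = separable_roots[OF F_lead F_A]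
  have sep': "poly (pderiv F) x \<in> units" if "poly F x = 0" for x
    using sep that integrally_closed[OF F_lead F_A that] by (simp add: F_eval F'_eval)
  define \<theta> where "\<theta> x = x ^ e + of_int t * \<pi> ^ d * x ^ i" for x :: complex
  define T :: "rat poly" where "T = monom (1 / of_nat (p ^ M)) e + monom (of_int t / of_nat (p ^ j)) i"
  have T_eval: "rpoly T (\<pi> ^ N * x) = \<theta> x" for x
  proof -
    have "(\<pi> ^ N * x) ^ e = \<pi> ^ (e * N) * x ^ e"
      by (simp add: power_mult_distrib mult.commute flip: power_mult)
    also have "\<dots> = of_nat p ^ M * x ^ e"
      unfolding exps(3) power_mult[of \<pi> "d * e" M] \<pi>(2) ..
    finally have 1: "(\<pi> ^ N * x) ^ e = of_nat p ^ M * x ^ e" .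
    have "(\<pi> ^ N * x) ^ i = \<pi> ^ (i * N) * x ^ i"
      by (simp add: power_mult_distrib mult.commute flip: power_mult)
    also have "\<dots> = of_nat p ^ j * \<pi> ^ d * x ^ i"
      unfolding exps(4) power_add power_mult[of \<pi> "d * e" j] \<pi>(2) ..
    finally have 2: "(\<pi> ^ N * x) ^ i = of_nat p ^ j * \<pi> ^ d * x ^ i" .
    have "rpoly T (\<pi> ^ N * x) = (\<pi> ^ N * x) ^ e / of_nat p ^ M + of_int t / of_nat p ^ j * (\<pi> ^ N * x) ^ i"
      by (simp add: T_def map_poly_of_rat_add map_poly_monom poly_monom of_rat_divide of_rat_power)
    then show ?thesis unfolding 1 2 \<theta>_def using p0 by simp
  qed
  have root_iff: "ipoly (trinomial9 a b) (\<pi> ^ N * x) = \<pi> ^ (9 * N) * poly F x" for x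
  proof -
    have "(\<pi> ^ N * x) ^ 9 = \<pi> ^ (9 * N) * x ^ 9"
      by (simp add: power_mult_distrib mult.commute flip: power_mult)
    moreover have "\<pi> ^ (8 * N) * \<pi> ^ N = \<pi> ^ (9 * N)" by (simp flip: power_add)
    ultimately show ?thesis
      by (simp add: ipoly_trinomial9 F_eval AB(3,4) algebra_simps)
  qed
  define \<gamma> where "\<gamma> = \<alpha> / \<pi> ^ N"
  have \<alpha>: "\<alpha> = \<pi> ^ N * \<gamma>" using \<pi>0 by (simp add: \<gamma>_def)
  have "poly F \<gamma> = 0" using root root_iff[of \<gamma>] \<pi>0 by (simp add: \<alpha>)
  then have "algebraic_int \<gamma>" by (rule algebraic_int_integrally_closed[OF F_lead F_int])
  then have "algebraic_int (\<theta> \<gamma>)"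
    unfolding \<theta>_def using \<pi>(1)
    by (intro algebraic_int_add algebraic_int_mult algebraic_int_power algebraic_int_of_int)
  then have int: "algebraic_int (rpoly T \<alpha>)" by (simp add: \<alpha> T_eval)
  have \<theta>_A: "\<theta> x \<in> A" if "x \<in> A" for x
    unfolding \<theta>_def using that \<pi>A by (intro closed)
  have \<theta>_cong: "\<theta> x - x ^ e \<in> nonunits" if "x \<in> A" for x
  proof -
    have "\<pi> ^ d * (of_int t * x ^ i) \<in> nonunits"
      using that \<pi>_nonunit d by (intro nonunits_mult nonunits_power closed)
    then show ?thesis by (simp add: \<theta>_def mult_ac)
  qed
  have \<theta>_phi: "\<exists>u\<in>units. \<theta> x ^ d + of_int c = \<pi> ^ d * u" if x: "poly F x = 0" "x \<in> units" for x
  proof -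
    have xA: "x \<in> A" using x(2) by (rule units_closed)
    obtain \<epsilon> where \<epsilon>: "\<epsilon> \<in> A" "x ^ (d * e) + of_int c = \<pi> ^ d * \<epsilon>"
        "\<epsilon> + of_nat d * of_int t * x ^ (e * (d - 1) + i) \<in> units"
      using unit x by (auto simp: F_eval)
    define y where "y = of_int t * \<pi> ^ d * x ^ i"
    have yA: "y \<in> A" unfolding y_def using xA \<pi>A by (intro closed)
    obtain r where r: "r \<in> A" "(x ^ e + y) ^ d = (x ^ e) ^ d + of_nat d * (x ^ e) ^ (d - 1) * y + y ^ 2 * r"
      using binomial_quadratic_remainder[OF power[OF xA] yA] by blast
    \<comment> \<open>The quadratic binomial term contains \<open>\<pi> ^ (2 * d)\<close>, so after
      division by \<open>\<pi> ^ d\<close> it is still a nonunit.\<close>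
    define s where "s = \<pi> ^ d * ((of_int t * x ^ i) ^ 2 * r)"
    have "s \<in> nonunits"
      unfolding s_def using \<pi>_nonunit d xA r(1) by (intro nonunits_mult nonunits_power closed)
    then have "\<epsilon> + of_nat d * of_int t * x ^ (e * (d - 1) + i) + s \<in> units"
      by (rule units_add_nonunits[OF \<epsilon>(3)])
    moreover have "\<theta> x ^ d + of_int c = \<pi> ^ d * (\<epsilon> + of_nat d * of_int t * x ^ (e * (d - 1) + i) + s)"
    proof -
      have "\<theta> x ^ d + of_int c = (x ^ (d * e) + of_int c) + of_nat d * (x ^ e) ^ (d - 1) * y + y ^ 2 * r"
        using r(2) by (simp add: \<theta>_def y_def mult.commute flip: power_mult)
      also have "\<dots> = \<pi> ^ d * \<epsilon> + of_nat d * (x ^ e) ^ (d - 1) * y + y ^ 2 * r"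
        by (simp only: \<epsilon>(2))
      also have "\<dots> = \<pi> ^ d * (\<epsilon> + of_nat d * of_int t * x ^ (e * (d - 1) + i) + s)"
        by (simp only: power_mult[of x e "d - 1", symmetric])
           (simp add: y_def s_def power_add power2_eq_square algebra_simps)
      finally show ?thesis .
    qed
    ultimately show ?thesis by blast
  qed
  show ?thesis
  proof (rule field_index_not_dvd[OF prime_p int])
    fix P k assume P: "degree P < degree (trinomial9 a b)"
      "algebraic_int (ipoly P (rpoly T \<alpha>) / of_nat p)"
    have P_mult: "\<exists>y\<in>A. ipoly P (\<theta> x) = of_nat p * y" if "poly F x = 0" for x
    proof -
      have "ipoly (trinomial9 a b) (\<pi> ^ N * x) = 0" using root_iff that by simp
      then have "algebraic_int (ipoly P (\<theta> x) / of_nat p)"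
        using conjugate_quotient[OF P(2)] by (simp only: T_eval flip: T_eval)
      then show ?thesis
        using p0 algebraic_int_closed by (intro bexI[of _ "ipoly P (\<theta> x) / of_nat p"]) auto
    qed
    have key: "int p dvd coeff Q k"
      if "degree Q < d * e" "\<And>x. poly F x = 0 \<Longrightarrow> x \<in> units \<Longrightarrow> \<exists>y\<in>A. ipoly Q (\<theta> x) = of_nat p * y" for Q k
    proof (rule ramified_coeffs_dvd[OF \<pi>A \<pi>(2) d e, where \<Gamma> = "{x. poly F x = 0}" and \<theta> = \<theta> and \<delta> = \<delta> and c = c and l = e])
      show "finite {x. poly F x = 0}" by (rule \<Gamma>(1)[OF sep'])
      show "card {x. poly F x = 0} = d * e + \<delta>" using \<Gamma>(2)[OF sep'] F_deg exps(1) by simp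
      show "x \<in> A" if "x \<in> {x. poly F x = 0}" for x using \<Gamma>(3)[OF sep'] that by blast
      then show "\<theta> x \<in> A" "\<theta> x - x ^ e \<in> nonunits" if "x \<in> {x. poly F x = 0}" for x
        using \<theta>_A \<theta>_cong that by blast+
      show "x - y \<in> units" if "x \<in> {x. poly F x = 0}" "y \<in> {x. poly F x = 0}" "x \<noteq> y" for x y
        using \<Gamma>(4)[OF sep'] that by blast
      show "0 < \<delta>" if "x \<in> {x. poly F x = 0}" "x \<in> nonunits" for x
        using nonunit that by (simp add: F_eval)
    qed (use that \<theta>_phi \<pi>(2) in auto)
    show "int p dvd coeff P k"
    proof (cases "\<delta> = 0")
      case True
      then show ?thesis using P(1) P_mult exps(1) by (intro key) (auto simp: degree_trinomial9)
    next
      case False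
      then have \<delta>: "\<delta> = 1" using exps(2) by simp
      obtain x0 where x0: "poly F x0 = 0" "x0 \<in> nonunits"
        using ex_nonunit \<delta> by (auto simp: F_eval)
      \<comment> \<open>\<open>P\<close> may have degree \<open>d * e\<close>, one too many for
        \<open>key\<close>. As \<open>\<theta> x0\<close> is a nonunit, evaluation at
        \<open>x0\<close> gives \<open>p\<close> dividing the constant coefficient; after removing
        it, division by \<open>X\<close> is harmless since \<open>\<theta> x\<close> is a unit at
        the unit roots.\<close>
      obtain c0 Q where PQ: "P = pCons c0 Q" by (rule pCons_cases)
      have P_eval: "ipoly P x = of_int c0 + x * ipoly Q x" for x
        by (simp add: PQ map_poly_pCons)
      have "x0 \<in> A" using x0(2) by (rule nonunits_closed)
      then have "x0 ^ e + (\<theta> x0 - x0 ^ e) \<in> nonunits"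
        using x0(2) e \<theta>_cong by (intro nonunits_add nonunits_power) auto
      then have "\<theta> x0 \<in> nonunits" by simp
      then have 1: "\<theta> x0 * ipoly Q (\<theta> x0) \<in> nonunits"
        using nonunits_closed by (intro nonunits_mult ipoly_closed) auto
      obtain y where "y \<in> A" "ipoly P (\<theta> x0) = of_nat p * y" using P_mult x0 by blast
      then have "\<theta> x0 * ipoly Q (\<theta> x0) + of_int c0 \<in> nonunits"
        using nonunits_mult[OF p_nonunit] by (simp add: P_eval add.commute)
      then have "of_int c0 \<in> nonunits" using 1 by (rule nonunits_addD)
      then have c0: "int p dvd c0" by (simp add: of_int_nonunits_iff)
      then obtain c1 where c1: "c0 = int p * c1" by (rule dvdE)
      have "int p dvd coeff Q k" for k
      proof (rule key)
        show "degree Q < d * e"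
          using P(1) exps(1) \<delta> d e by (cases "Q = 0") (auto simp: PQ degree_trinomial9)
        fix x assume x: "poly F x = 0" "x \<in> units"
        have xA: "x \<in> A" using x(2) by (rule units_closed)
        have "x ^ e + (\<theta> x - x ^ e) \<in> units"
          using x(2) \<theta>_cong[OF xA] by (intro units_add_nonunits units_power)
        then have u: "\<theta> x \<in> units" by simp
        obtain y where y: "y \<in> A" "ipoly P (\<theta> x) = of_nat p * y" using P_mult x by blast
        then have "\<theta> x * ipoly Q (\<theta> x) = of_nat p * (y - of_int c1)"
          by (simp add: P_eval c1 algebra_simps)
        then have "ipoly Q (\<theta> x) = of_nat p * ((y - of_int c1) * inverse (\<theta> x))"
          using units_nonzero[OF u] by (simp add: field_simps)
        then show "\<exists>y\<in>A. ipoly Q (\<theta> x) = of_nat p * y"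
          using y(1) units_inverse[OF u] by (intro bexI[of _ "(y - of_int c1) * inverse (\<theta> x)"]) (auto intro!: closed)
      qed
      then show ?thesis using c0 by (auto simp: PQ coeff_pCons split: nat.splits)
    qed
  qed
qed

end

section \<open>The case of a discriminant prime to \<open>p\<close>\<close>

lemma power9_eq: "(x :: complex) ^ 9 = x * x ^ 8"
  by (simp flip: power_Suc)

context p_valuation
begin

text \<open>\<open>F\<close> splits over the complex numbers; if the product of the
  \<open>x - z i\<close> is a nonunit, so is one of its factors.\<close>

lemma exists_close_root:
  assumes F: "lead_coeff F = 1" "\<And>i. coeff F i \<in> A" and x: "x \<in> A" "poly F x \<in> nonunits"
  obtains z where "poly F z = 0" "x - z \<in> nonunits"
proof -
  obtain z where "smult (lead_coeff F) (\<Prod>i<degree F. [:- z i, 1:]) = F"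
    by (rule complex_poly_decompose')
  then have z: "F = (\<Prod>i<degree F. [:- z i, 1:])" using F(1) by simp
  have eval: "poly F y = (\<Prod>i<degree F. y - z i)" for y
    using arg_cong[OF z, of "\<lambda>q. poly q y"] by (simp add: poly_prod)
  have root: "poly F (z i) = 0" if "i < degree F" for i
    unfolding eval using that by auto
  have "\<exists>i\<in>{..<degree F}. x - z i \<in> nonunits"
  proof (rule nonunits_prodD)
    show "x - z i \<in> A" if "i \<in> {..<degree F}" for i
      using integrally_closed[OF F root] that x(1) by (intro diff) auto
  qed (use x(2) eval in auto)
  then show ?thesis using that root by blast
qed

text \<open>The integer in \<open>\<Delta>\<close> is the discriminant of the trinomial. If it is
  prime to \<open>p\<close>, the conjugates of \<open>\<alpha>\<close> have distinct residues and
  the generator is \<open>\<alpha>\<close> itself.\<close>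

lemma separable_index:
  assumes irred: "monic_irreducible (trinomial9 a b) \<alpha>"
    and \<Delta>: "\<not> int p dvd 8 ^ 8 * a ^ 9 + 9 ^ 9 * b ^ 8"
  shows "\<not> p dvd field_index (Q_adjoin \<alpha>)"
proof -
  interpret monic_irreducible "trinomial9 a b" \<alpha> by fact
  have closed': "x \<in> A" if "ipoly (trinomial9 a b) x = 0" for x
    using algebraic_int_root[OF that] by (rule algebraic_int_closed)
  have sep: "poly (pderiv fC) x \<in> units" if root_x: "ipoly (trinomial9 a b) x = 0" for x
  proof (rule ccontr)
    define y where "y = 9 * x ^ 8 + of_int a"
    have x: "x \<in> A" using root_x by (rule closed')
    assume "poly (pderiv fC) x \<notin> units"
    moreover have "poly (pderiv fC) x = y"
      by (simp only: map_poly_of_int_pderiv[symmetric] ipoly_pderiv_trinomial9 y_def)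
    moreover have "y \<in> A" unfolding y_def using x by (intro closed)
    ultimately have y: "y \<in> nonunits" using units_iff by simp
    \<comment> \<open>From \<open>9 f - x f' = 8 a x + 9 b\<close>, a common zero modulo the maximal
      ideal satisfies \<open>9 b = - 8 a x\<close>. Taking eighth powers and eliminating
      \<open>x ^ 8\<close> by means of \<open>9 x ^ 8 + a = y\<close> leaves the
      discriminant.\<close>
    have "9 * of_int b - (- 8 * of_int a * x) + x * y = 9 * (x ^ 9 + of_int a * x + of_int b)"
      by (simp add: y_def power9_eq algebra_simps)
    then have "9 * of_int b - (- 8 * of_int a * x) = - (x * y)"
      using root_x by (simp only: ipoly_trinomial9 mult_zero_right eq_neg_iff_add_eq_0)
    then have "9 * of_int b - (- 8 * of_int a * x) \<in> nonunits"
      using x y by (simp add: nonunits_uminus nonunits_mult')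
    then have "(9 * of_int b) ^ 8 - (- 8 * of_int a * x) ^ 8 \<in> nonunits"
      using x by (intro nonunits_power_diff closed)
    then have "9 * ((9 * of_int b) ^ 8 - (- 8 * of_int a * x) ^ 8) + 8 ^ 8 * of_int a ^ 8 * y \<in> nonunits"
      using x y by (intro nonunits_add nonunits_mult' closed)
    also have "9 * ((9 * of_int b) ^ 8 - (- 8 * of_int a * x) ^ 8) + 8 ^ 8 * of_int a ^ 8 * y =
        (of_int (8 ^ 8 * a ^ 9 + 9 ^ 9 * b ^ 8) :: complex)"
      by (simp add: y_def power_mult_distrib algebra_simps) (simp add: eval_nat_numeral)
    finally show False using \<Delta> by (simp only: of_int_nonunits_iff)
  qed
  note roots = separable_roots[OF monic_fC coeff_ipoly_closed sep]
  show ?thesis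
  proof (rule field_index_not_dvd[OF prime_p, of "[:0, 1:]"])
    show "algebraic_int (rpoly [:0, 1:] \<alpha>)"
      using algebraic_int_root[OF root] by (simp add: map_poly_pCons)
    fix P i assume P: "degree P < degree (trinomial9 a b)"
      "algebraic_int (ipoly P (rpoly [:0, 1:] \<alpha>) / of_nat p)"
    show "int p dvd coeff P i"
    proof (rule int_coeffs_dvd_of_roots[of "{x. ipoly (trinomial9 a b) x = 0}"])
      show "degree P < card {x. ipoly (trinomial9 a b) x = 0}"
        using P(1) roots(2) degree_fC by simp
      fix x assume "x \<in> {x. ipoly (trinomial9 a b) x = 0}"
      then have "algebraic_int (ipoly P x / of_nat p)"
        using conjugate_quotient[OF P(2)] by (simp add: map_poly_pCons)
      then have "of_nat p * (ipoly P x / of_nat p) \<in> nonunits"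
        using p_nonunit algebraic_int_closed by (intro nonunits_mult)
      then show "ipoly P x \<in> nonunits" using prime_gt_0_nat[OF prime_p] by simp
    qed (use roots in auto)
  qed
qed

end

section \<open>The cases where \<open>p\<close> divides both coefficients\<close>

lemma exists_algebraic_int_nth_root:
  assumes "n > 0"
  obtains \<pi> :: complex where "algebraic_int \<pi>" "\<pi> ^ n = of_nat p"
proof
  let ?r = "root n (real p)"
  show "algebraic_int (complex_of_real ?r)"
    by (intro algebraic_int_of_real algebraic_int_nth_root_real) simp
  have "?r ^ n = real p" using assms by (intro real_root_pow_pos2) auto
  then show "complex_of_real ?r ^ n = of_nat p"
    by (metis of_real_power of_real_of_nat_eq)
qed

text \<open>With these exponents, \<open>\<alpha>\<^sup>i / p\<^sup>j\<close> has valuation \<open>d/9\<close>, respectively \<open>d/8\<close>. In the boundary cases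
  \<open>k = d\<close> and \<open>m + d = 8\<close> there are two terms of this valuation in \<open>\<theta>\<^sup>d + c\<close>, and the condition on \<open>i\<close>
  makes their quotient a rational integer modulo \<open>\<pi>\<close>, so that a suitable \<open>t\<close> avoids cancellation.\<close>

lemma exponents_9:
  fixes k :: nat
  assumes "1 \<le> k" "k \<le> 8"
  obtains d e i j M where "d * e = 9" "e * k = 9 * M" "i * k = 9 * j + d" "d \<le> k" "1 \<le> i"
    "d = 1 \<or> d = 3" "k = d \<longrightarrow> e * (d - 1) + i - 1 = 0 \<or> e * (d - 1) + i - 1 = 9"
proof -
  consider "k = 1" | "k = 2" | "k = 3" | "k = 4" | "k = 5" | "k = 6" | "k = 7" | "k = 8"
    using assms by linarith
  \<comment> \<open>The arguments are \<open>d\<close>, \<open>e\<close>, \<open>M\<close>,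
    \<open>i\<close>, \<open>j\<close>, with \<open>d = gcd k 9\<close>. For \<open>k = 3\<close>
    the choice \<open>i = 1\<close> would solve the congruence, but only \<open>i = 4\<close> also
    brings the last exponent to 9.\<close>
  then show ?thesis
    by cases (use that[of 1 9 1 1 0] that[of 1 9 2 5 1] that[of 3 3 1 4 1] that[of 1 9 4 7 3]
      that[of 1 9 5 2 1] that[of 3 3 2 2 1] that[of 1 9 7 4 3] that[of 1 9 8 8 7] in auto)
qed

lemma exponents_8:
  fixes m :: nat
  assumes "1 \<le> m" "m \<le> 7"
  obtains d e i j M where "d * e = 8" "e * m = 8 * M" "i * m = 8 * j + d" "m + d \<le> 8"
    "d = 1 \<or> d = 2 \<or> d = 4" "m + d = 8 \<longrightarrow> e * (d - 1) + i + 1 = 8"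
proof -
  consider "m = 1" | "m = 2" | "m = 3" | "m = 4" | "m = 5" | "m = 6" | "m = 7"
    using assms by linarith
  then show ?thesis
    by cases (use that[of 1 8 1 1 0] that[of 2 4 1 1 0] that[of 1 8 3 3 1] that[of 4 2 1 1 0]
      that[of 1 8 5 5 3] that[of 2 4 3 3 2] that[of 1 8 7 7 6] in auto)
qed

text \<open>The values for \<open>t = 1\<close> and \<open>t = 2\<close> differ by \<open>v\<close>,
  so \<open>p\<close> cannot divide both.\<close>

lemma exists_multiplier:
  fixes u v :: int
  assumes "\<not> p dvd v"
  obtains t where "\<not> p dvd u + v * t"
proof (cases "p dvd u + v * 1")
  case True
  then have "\<not> p dvd (u + v * 1) + v" using assms dvd_add_right_iff[of p "u + v * 1" v] by blast
  moreover have "(u + v * 1) + v = u + v * 2" by simp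
  ultimately show ?thesis using that[of 2] by metis
qed (use that in blast)

context p_valuation
begin

context
  assumes p5: "p \<ge> 5"
begin

lemma small_not_dvd: "0 < n \<Longrightarrow> n < 5 \<Longrightarrow> \<not> int p dvd n"
  using p5 zdvd_not_zless by force

lemma not_dvd_9: "\<not> int p dvd 9" and not_dvd_8: "\<not> int p dvd 8"
proof -
  have p: "prime (int p)" using prime_p by simp
  show "\<not> int p dvd 9"
  proof
    assume "int p dvd 9"
    then have "int p dvd 3 ^ 2" by simp
    then have "int p dvd 3" by (rule prime_dvd_power[OF p])
    then show False using small_not_dvd[of 3] by simp
  qed
  show "\<not> int p dvd 8"
  proof
    assume "int p dvd 8"
    then have "int p dvd 2 ^ 3" by simp
    then have "int p dvd 2" by (rule prime_dvd_power[OF p])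
    then show False using small_not_dvd[of 2] by simp
  qed
qed

lemma numeral_units_iff: "(numeral n :: complex) \<in> units \<longleftrightarrow> \<not> int p dvd numeral n"
  using of_int_units_iff[of "numeral n"] by simp

text \<open>With \<open>\<pi> ^ 9 = p\<close>, scaling by \<open>\<pi> ^ k\<close> turns the
  trinomial into \<open>X ^ 9 + \<pi> ^ k a1 X + b1\<close>. Modulo \<open>\<pi>\<close> this is
  \<open>X ^ 9 + b1\<close>, which is separable with unit roots, and
  \<open>x ^ 9 + b1 = - \<pi> ^ k a1 x\<close> supplies \<open>\<epsilon>\<close>.\<close>

lemma one_slope_index:
  assumes irred: "monic_irreducible (trinomial9 a b) \<alpha>"
    and ab: "a = int p ^ k * a1" "b = int p ^ k * b1" "\<not> int p dvd b1" and k: "1 \<le> k" "k \<le> 8"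
  shows "\<not> p dvd field_index (Q_adjoin \<alpha>)"
proof -
  obtain d e i j M where ex: "d * e = 9" "e * k = 9 * M" "i * k = 9 * j + d" "d \<le> k" "1 \<le> i"
    "d = 1 \<or> d = 3" "k = d \<longrightarrow> e * (d - 1) + i - 1 = 0 \<or> e * (d - 1) + i - 1 = 9"
    by (rule exponents_9[OF k])
  obtain \<pi> :: complex where \<pi>: "algebraic_int \<pi>" "\<pi> ^ 9 = of_nat p"
    by (rule exists_algebraic_int_nth_root[of 9]) auto
  have \<pi>A: "\<pi> \<in> A" using \<pi>(1) by (rule algebraic_int_closed)
  have "\<pi> ^ 9 \<in> nonunits" using \<pi>(2) p_nonunit by simp
  then have \<pi>n: "\<pi> \<in> nonunits" using \<pi>A by (rule nonunits_powerD)
  define r where "r = e * (d - 1) + i - 1"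
  have d_unit: "\<not> int p dvd int d" using ex(6) small_not_dvd[of "int d"] by auto
  \<comment> \<open>In the boundary case \<open>k = d\<close> the exponent \<open>r\<close> is 0 or
    9, and \<open>g\<close> is the residue of \<open>x ^ r\<close>, because \<open>x ^ 9\<close> is
    congruent to \<open>- b1\<close>.\<close>
  define g where "g = (if r = 0 then 1 else - b1)"
  have "\<not> int p dvd g" unfolding g_def using ab(3) small_not_dvd[of 1] by simp
  then have "\<not> int p dvd int d * g"
    using d_unit prime_p by (simp add: prime_dvd_mult_iff)
  then obtain t where t: "\<not> int p dvd - a1 + int d * g * t"
    by (rule exists_multiplier)
  define t' where "t' = (if k = d then t else 1)"
  define A' where "A' = \<pi> ^ k * of_int a1"
  let ?B' = "of_int b1 :: complex"
  have A'n: "A' \<in> nonunits"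
    unfolding A'_def using \<pi>n k by (intro nonunits_mult nonunits_power closed) auto
  have b1u: "of_int b1 \<in> units" using ab(3) of_int_units_iff by blast
  have root_unit: "x \<in> units" if x: "x ^ 9 + A' * x + ?B' = 0" "x \<in> A" for x
  proof (rule ccontr)
    assume "x \<notin> units"
    then have "x \<in> nonunits" using x(2) units_iff by blast
    then have "- (x ^ 9 + A' * x) \<in> nonunits"
      using A'n x(2) by (intro nonunits_uminus nonunits_add nonunits_mult nonunits_power) auto
    moreover have "- (x ^ 9 + A' * x) = of_int b1"
      using x(1) by (rule add.inverse_unique)
    ultimately show False using b1u units_iff by simp
  qed
  show ?thesis
  proof (rule ramified_index[OF irred \<pi>(1), where d = d and e = e and N = k and i = i and j = j
        and M = M and c = b1 and t = t' and \<delta> = 0 and A' = A' and B' = ?B'])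
    show "\<pi> ^ (d * e) = of_nat p" using \<pi>(2) ex(1) by simp
    show "0 < d" "0 < e" using ex(1) by (auto intro: Nat.gr0I)
    show "d * e + 0 = 9" "(0::nat) \<le> 1" "e * k = d * e * M" "i * k = d * e * j + d"
      using ex by simp_all
    show "algebraic_int A'" "algebraic_int ?B'"
      using \<pi>(1) by (auto simp: A'_def intro!: algebraic_int_mult algebraic_int_power)
    have pk: "(of_int (int p ^ k) :: complex) = \<pi> ^ (9 * k)"
      using \<pi>(2) by (simp add: power_mult)
    show "of_int b = \<pi> ^ (9 * k) * ?B'" by (simp add: ab(2) pk[symmetric])
    show "of_int a = \<pi> ^ (8 * k) * A'"
    proof -
      have "\<pi> ^ (9 * k) = \<pi> ^ (8 * k) * \<pi> ^ k" by (simp flip: power_add)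
      then show ?thesis using pk by (simp add: ab(1) A'_def mult_ac)
    qed
    fix x :: complex assume x: "x ^ 9 + A' * x + ?B' = 0"
    show "9 * x ^ 8 + A' \<in> units" if "x \<in> A"
      using root_unit[OF x that] A'n not_dvd_9
      by (intro units_add_nonunits units_mult units_power) (auto simp: numeral_units_iff)
    show "0 < (0::nat)" if "x \<in> nonunits"
      using root_unit[OF x] that nonunits_closed units_iff by blast
    assume xu: "x \<in> units"
    then have xA: "x \<in> A" by (rule units_closed)
    show "\<exists>\<epsilon>\<in>A. x ^ (d * e) + of_int b1 = \<pi> ^ d * \<epsilon> \<and>
        \<epsilon> + of_nat d * of_int t' * x ^ (e * (d - 1) + i) \<in> units"
    proof (intro bexI conjI)
      let ?\<epsilon> = "- (of_int a1 * \<pi> ^ (k - d) * x)"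
      show "?\<epsilon> \<in> A" using \<pi>A xA by (intro closed)
      have "\<pi> ^ k = \<pi> ^ d * \<pi> ^ (k - d)" using ex(4) by (simp flip: power_add)
      moreover have "x ^ 9 + of_int b1 = - (A' * x)"
        using x by (simp add: eq_neg_iff_add_eq_0 algebra_simps)
      ultimately show "x ^ (d * e) + of_int b1 = \<pi> ^ d * ?\<epsilon>"
        by (simp add: ex(1) A'_def mult_ac)
      have "e * (d - 1) + i = Suc r" using ex(5) by (simp add: r_def)
      then have eq: "?\<epsilon> + of_nat d * of_int t' * x ^ (e * (d - 1) + i) =
          x * (- of_int a1 * \<pi> ^ (k - d) + of_nat d * of_int t' * x ^ r)"
        by (simp add: algebra_simps)
      \<comment> \<open>For \<open>d < k\<close> the first summand is a nonunit and the second a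
        unit. For \<open>k = d\<close> both have the same size, and \<open>t\<close> was chosen so
        that they do not cancel.\<close>
      have "- of_int a1 * \<pi> ^ (k - d) + of_nat d * of_int t' * x ^ r \<in> units"
      proof (cases "k = d")
        case True
        have "x ^ r - of_int g \<in> nonunits"
        proof (cases "r = 0")
          case False
          then have r: "r = 9" using ex(7) True r_def by simp
          have "x ^ 9 - of_int (- b1) = - (A' * x)"
            using x by (simp add: eq_neg_iff_add_eq_0 algebra_simps)
          then show ?thesis
            using False r A'n xA by (simp add: g_def nonunits_uminus nonunits_mult)
        qed (simp add: g_def nonunits_zero)
        then have "of_nat d * of_int t * (x ^ r - of_int g) \<in> nonunits"
          by (intro nonunits_mult' closed)
        moreover have "of_int (- a1 + int d * g * t) \<in> units" using t of_int_units_iff by blast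
        ultimately have "of_int (- a1 + int d * g * t) + of_nat d * of_int t * (x ^ r - of_int g) \<in> units"
          by (intro units_add_nonunits)
        then show ?thesis using True by (simp add: t'_def algebra_simps)
      next
        case False
        then have "of_nat d * x ^ r + - of_int a1 * \<pi> ^ (k - d) \<in> units"
          using xu \<pi>n ex(4) d_unit of_int_units_iff[of "int d"]
          by (intro units_add_nonunits units_mult units_power nonunits_mult' nonunits_power closed) auto
        then show ?thesis using False by (simp add: t'_def add.commute)
      qed
      then show "?\<epsilon> + of_nat d * of_int t' * x ^ (e * (d - 1) + i) \<in> units"
        unfolding eq using xu by (intro units_mult)
    qed
  qed simp
qed

text \<open>With \<open>\<pi> ^ 8 = p\<close>, scaling by \<open>\<pi> ^ m\<close> gives
  \<open>X ^ 9 + a1 X + \<pi> ^ (8 - m) b1\<close>, which is \<open>X (X ^ 8 + a1)\<close> modulo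
  \<open>\<pi>\<close>. The root reducing to 0 is accounted for by \<open>\<delta> = 1\<close>; at
  unit roots, dividing the equation by \<open>x\<close> yields \<open>\<epsilon>\<close>.\<close>

lemma two_slope_index:
  assumes irred: "monic_irreducible (trinomial9 a b) \<alpha>"
    and ab: "a = int p ^ m * a1" "b = int p ^ Suc m * b1" "\<not> int p dvd a1" and m: "1 \<le> m" "m \<le> 7"
  shows "\<not> p dvd field_index (Q_adjoin \<alpha>)"
proof -
  obtain d e i j M where ex: "d * e = 8" "e * m = 8 * M" "i * m = 8 * j + d" "m + d \<le> 8"
    "d = 1 \<or> d = 2 \<or> d = 4" "m + d = 8 \<longrightarrow> e * (d - 1) + i + 1 = 8"
    by (rule exponents_8[OF m])
  obtain \<pi> :: complex where \<pi>: "algebraic_int \<pi>" "\<pi> ^ 8 = of_nat p"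
    by (rule exists_algebraic_int_nth_root[of 8]) auto
  have \<pi>A: "\<pi> \<in> A" using \<pi>(1) by (rule algebraic_int_closed)
  have "\<pi> ^ 8 \<in> nonunits" using \<pi>(2) p_nonunit by simp
  then have \<pi>n: "\<pi> \<in> nonunits" using \<pi>A by (rule nonunits_powerD)
  define s where "s = e * (d - 1) + i + 1"
  have d_unit: "\<not> int p dvd int d" using ex(5) small_not_dvd[of "int d"] by auto
  then have "\<not> int p dvd int d * (- a1)"
    using ab(3) prime_p by (simp add: prime_dvd_mult_iff)
  then obtain t where t: "\<not> int p dvd - b1 + int d * (- a1) * t"
    by (rule exists_multiplier)
  define t' where "t' = (if m + d = 8 then t else 1)"
  define B' where "B' = \<pi> ^ (8 - m) * of_int b1"
  let ?A' = "of_int a1 :: complex"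
  have B'n: "B' \<in> nonunits"
    unfolding B'_def using \<pi>n m by (intro nonunits_mult nonunits_power closed) auto
  have a1u: "of_int a1 \<in> units" using ab(3) of_int_units_iff by blast
  show ?thesis
  proof (rule ramified_index[OF irred \<pi>(1), where d = d and e = e and N = m and i = i and j = j
        and M = M and c = a1 and t = t' and \<delta> = 1 and A' = ?A' and B' = B'])
    show "\<pi> ^ (d * e) = of_nat p" using \<pi>(2) ex(1) by simp
    show "0 < d" "0 < e" using ex(1) by (auto intro: Nat.gr0I)
    show "d * e + 1 = 9" "(1::nat) \<le> 1" "e * m = d * e * M" "i * m = d * e * j + d"
      using ex by simp_all
    show "algebraic_int ?A'" "algebraic_int B'"
      using \<pi>(1) by (auto simp: B'_def intro!: algebraic_int_mult algebraic_int_power)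
    have pm: "(of_int (int p ^ n) :: complex) = \<pi> ^ (8 * n)" for n
      using \<pi>(2) by (simp add: power_mult)
    show "of_int a = \<pi> ^ (8 * m) * ?A'" unfolding ab(1) of_int_mult pm ..
    have "8 * Suc m = 9 * m + (8 - m)" using m by simp
    then have "\<pi> ^ (8 * Suc m) = \<pi> ^ (9 * m) * \<pi> ^ (8 - m)" by (simp only: power_add)
    then show "of_int b = \<pi> ^ (9 * m) * B'" unfolding ab(2) of_int_mult pm by (simp add: B'_def mult.assoc)
    let ?F = "[:B', ?A', 0, 0, 0, 0, 0, 0, 0, 1:]"
    have F_eval: "poly ?F x = x ^ 9 + ?A' * x + B'" for x
      by (simp add: algebra_simps) (simp add: eval_nat_numeral)
    obtain z where "poly ?F z = 0" "0 - z \<in> nonunits"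
    proof (rule exists_close_root[of ?F 0])
      show "coeff ?F i \<in> A" for i
        using nonunits_closed[OF B'n] of_int zero one by (auto simp: coeff_pCons split: nat.splits)
    qed (use B'n zero in auto)
    then show "\<exists>x. x ^ 9 + ?A' * x + B' = 0 \<and> x \<in> nonunits"
      unfolding F_eval using nonunits_uminus[of "0 - z"] by auto
    fix x :: complex assume x: "x ^ 9 + ?A' * x + B' = 0"
    have x': "x * (x ^ 8 + ?A') = - B'"
      using x by (simp add: power9_eq eq_neg_iff_add_eq_0 algebra_simps)
    have xA8: "x ^ 8 + ?A' \<in> nonunits" if "x \<in> units"
    proof -
      have "x * (x ^ 8 + ?A') \<in> nonunits" unfolding x' using B'n by (rule nonunits_uminus)
      moreover have "x ^ 8 + ?A' \<in> A" using units_closed[OF that] by (intro closed)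
      ultimately show ?thesis using nonunits_unit_multD that by blast
    qed
    show "9 * x ^ 8 + ?A' \<in> units" if "x \<in> A"
    proof (cases "x \<in> units")
      case False
      then have "x \<in> nonunits" using that units_iff by blast
      then have "?A' + 9 * x ^ 8 \<in> units"
        using a1u by (intro units_add_nonunits nonunits_mult' nonunits_power closed) auto
      then show ?thesis by (simp add: add.commute)
    next
      case True
      have "(- 8) * ?A' + 9 * (x ^ 8 + ?A') \<in> units"
        using xA8[OF True] a1u not_dvd_8
        by (intro units_add_nonunits units_mult units_uminus nonunits_mult' closed) (auto simp: numeral_units_iff)
      then show ?thesis by (simp add: algebra_simps)
    qed
    assume xu: "x \<in> units"
    then have xA: "x \<in> A" and xi: "inverse x \<in> units" and x0: "x \<noteq> 0"
      by (auto simp: units_def)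
    show "\<exists>\<epsilon>\<in>A. x ^ (d * e) + of_int a1 = \<pi> ^ d * \<epsilon> \<and>
        \<epsilon> + of_nat d * of_int t' * x ^ (e * (d - 1) + i) \<in> units"
    proof (intro bexI conjI)
      let ?\<epsilon> = "- (of_int b1 * \<pi> ^ (8 - m - d) * inverse x)"
      show "?\<epsilon> \<in> A" using \<pi>A units_closed[OF xi] by (intro closed)
      have "8 - m = d + (8 - m - d)" using ex(4) by simp
      then have \<pi>_eq: "\<pi> ^ (8 - m) = \<pi> ^ d * \<pi> ^ (8 - m - d)" by (metis power_add)
      have "x ^ 8 + ?A' = - B' * inverse x"
        using x' x0 by (simp add: field_simps)
      then show "x ^ (d * e) + of_int a1 = \<pi> ^ d * ?\<epsilon>"
        by (simp add: ex(1) B'_def \<pi>_eq mult_ac)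
      have "x ^ (e * (d - 1) + i) = inverse x * x ^ s" using x0 by (simp add: s_def)
      then have eq: "?\<epsilon> + of_nat d * of_int t' * x ^ (e * (d - 1) + i) =
          inverse x * (- of_int b1 * \<pi> ^ (8 - m - d) + of_nat d * of_int t' * x ^ s)"
        by (simp add: algebra_simps)
      have "- of_int b1 * \<pi> ^ (8 - m - d) + of_nat d * of_int t' * x ^ s \<in> units"
      proof (cases "m + d = 8")
        case True
        then have s: "s = 8" and md: "8 - m - d = 0" using ex(6) s_def by simp_all
        have "of_nat d * of_int t * (x ^ 8 + ?A') \<in> nonunits"
          using xA8[OF xu] by (intro nonunits_mult' closed)
        moreover have "of_int (- b1 + int d * (- a1) * t) \<in> units" using t of_int_units_iff by blast
        ultimately have "of_int (- b1 + int d * (- a1) * t) + of_nat d * of_int t * (x ^ 8 + ?A') \<in> units"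
          by (intro units_add_nonunits)
        then show ?thesis using True by (simp add: t'_def s md algebra_simps)
      next
        case False
        then have "of_nat d * x ^ s + - of_int b1 * \<pi> ^ (8 - m - d) \<in> units"
          using xu \<pi>n ex(4) d_unit of_int_units_iff[of "int d"]
          by (intro units_add_nonunits units_mult units_power nonunits_mult' nonunits_power closed) auto
        then show ?thesis using False by (simp add: t'_def add.commute)
      qed
      then show "?\<epsilon> + of_nat d * of_int t' * x ^ (e * (d - 1) + i) \<in> units"
        unfolding eq using xi by (intro units_mult)
    qed
  qed simp
qed

end

end

section \<open>A double root modulo the prime\<close>

text \<open>A common zero of \<open>f\<close> and \<open>f'\<close> satisfies
  \<open>8 a x + 9 b = 0\<close>. Solving this modulo \<open>q ^ Suc V\<close>, where
  \<open>V\<close> is the valuation of the discriminant, gives an integer \<open>s\<close> at which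
  \<open>f\<close> has valuation exactly \<open>V\<close> and \<open>f'\<close> at least
  \<open>V\<close>.\<close>

lemma double_root_approximation:
  fixes a b q :: int
  assumes q: "prime q" "\<not> q dvd 8" "\<not> q dvd 9" and ab: "\<not> q dvd a" "\<not> q dvd b"
    and \<Delta>: "8 ^ 8 * a ^ 9 + 9 ^ 9 * b ^ 8 \<noteq> 0" "q dvd 8 ^ 8 * a ^ 9 + 9 ^ 9 * b ^ 8"
  obtains s c0 c1 k where "\<not> q dvd s" "q ^ (2 * k) * c0 = s ^ 9 + a * s + b"
    "q ^ (2 * k) * c1 = 9 * s ^ 8 + a" "q dvd 8 * a * s + 9 * b" "\<not> q\<^sup>2 dvd c0"
    "q dvd c0 \<longrightarrow> q dvd c1" "q dvd s ^ 9 + a * s + b" "q dvd 9 * s ^ 8 + a"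
proof -
  define D where "D = 8 ^ 8 * a ^ 9 + 9 ^ 9 * b ^ 8"
  define V where "V = multiplicity q D"
  have not_unit: "\<not> is_unit q" using q(1) by auto
  have V: "q ^ V dvd D" "\<not> q ^ Suc V dvd D"
    using multiplicity_dvd[of q D] power_dvd_iff_le_multiplicity[of D q "Suc V"] \<Delta>(1) not_unit
    by (auto simp: V_def D_def)
  have "V \<noteq> 0"
  proof
    assume "V = 0"
    then show False using V(2) \<Delta>(2) by (simp add: D_def)
  qed
  have "\<not> q dvd 8 * a" using q ab by (simp add: prime_dvd_mult_iff)
  then have cop_8a: "coprime (8 * a) (q ^ n)" for n
    using q(1) by (metis coprime_commute coprime_power_left_iff prime_imp_coprime)
  then obtain u v where uv: "u * (8 * a) + v * q ^ Suc V = 1"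
    using bezout_int[of "8 * a" "q ^ Suc V"] by (metis coprime_imp_gcd_eq_1)
  define s where "s = - 9 * b * u"
  have "8 * a * s + 9 * b = 9 * b * (1 - u * (8 * a))" by (simp add: s_def algebra_simps)
  also have "1 - u * (8 * a) = v * q ^ Suc V" using uv by linarith
  finally have dvd_s: "q ^ Suc V dvd 8 * a * s + 9 * b" by simp
  have q_dvd_s: "q dvd 8 * a * s + 9 * b"
    using dvd_s dvd_trans[of q "q ^ Suc V"] by simp
  have "\<not> q dvd 9 * b" using q ab by (simp add: prime_dvd_mult_iff)
  then have s: "\<not> q dvd s"
    using q_dvd_s by (metis dvd_add_right_iff dvd_mult)
  define F0 where "F0 = s ^ 9 + a * s + b"
  define F1 where "F1 = 9 * s ^ 8 + a"
  have "8 * a * s + 9 * b dvd (8 * a * s) ^ 9 - (- (9 * b)) ^ 9"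
    using power_diff_sumr2[of "8 * a * s" 9 "- (9 * b)"] by simp
  \<comment> \<open>Modulo \<open>8 * a * s + 9 * b\<close> the number
    \<open>(8 * a) ^ 9 * F0\<close> equals \<open>- b * D\<close>; this transfers the valuation of
    \<open>D\<close> to \<open>F0\<close>.\<close>
  moreover have "(8 * a) ^ 9 * F0 + b * D =
      ((8 * a * s) ^ 9 - (- (9 * b)) ^ 9) + 8 ^ 8 * a ^ 9 * (8 * a * s + 9 * b)"
    unfolding F0_def D_def by algebra
  ultimately have "8 * a * s + 9 * b dvd (8 * a) ^ 9 * F0 + b * D"
    by simp
  then have comb: "q ^ Suc V dvd (8 * a) ^ 9 * F0 + b * D" by (rule dvd_trans[OF dvd_s])
  have "q ^ V dvd (8 * a) ^ 9 * F0 + b * D"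
    using comb le_imp_power_dvd[of V "Suc V" q] dvd_trans by auto
  moreover have "q ^ V dvd b * D" using V(1) by simp
  ultimately have "q ^ V dvd (8 * a) ^ 9 * F0" using dvd_add_left_iff by blast
  then have F0: "q ^ V dvd F0"
    using cop_8a[of V] by (metis coprime_commute coprime_dvd_mult_right_iff coprime_power_right_iff)
  have F0': "\<not> q ^ Suc V dvd F0"
  proof
    assume "q ^ Suc V dvd F0"
    then have "q ^ Suc V dvd (8 * a) ^ 9 * F0" by (rule dvd_mult)
    then have "q ^ Suc V dvd b * D" using comb dvd_add_right_iff by blast
    moreover have "coprime (q ^ Suc V) b"
      using q(1) ab(2) by (simp only: coprime_power_left_iff) (simp add: prime_imp_coprime)
    ultimately show False using V(2) coprime_dvd_mult_right_iff by blast
  qed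
  have "s * F1 = 9 * F0 - (8 * a * s + 9 * b)" unfolding F0_def F1_def by algebra
  moreover have "q ^ V dvd 8 * a * s + 9 * b"
    using dvd_s le_imp_power_dvd[of V "Suc V" q] dvd_trans by auto
  ultimately have "q ^ V dvd s * F1" using F0 by simp
  moreover have "coprime (q ^ V) s" using q(1) s by (simp add: prime_imp_coprime)
  ultimately have F1: "q ^ V dvd F1" using coprime_dvd_mult_right_iff by blast
  \<comment> \<open>Rounding down leaves in \<open>c0\<close> the valuation 0 or 1, according to the
    parity of \<open>V\<close>. In the odd case one factor \<open>q\<close> also remains in
    \<open>c1\<close>.\<close>
  define k where "k = V div 2"
  have k: "2 * k \<le> V" "V \<le> Suc (2 * k)" by (auto simp: k_def)
  have q2k: "q ^ (2 * k) dvd q ^ V" using k by (intro le_imp_power_dvd)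
  obtain c0 where c0: "F0 = q ^ (2 * k) * c0" using dvd_trans[OF q2k F0] by (rule dvdE)
  obtain c1 where c1: "F1 = q ^ (2 * k) * c1" using dvd_trans[OF q2k F1] by (rule dvdE)
  have q0: "q ^ n \<noteq> 0" for n using q(1) by auto
  show ?thesis
  proof (rule that[of s k c0 c1])
    show "q ^ (2 * k) * c0 = s ^ 9 + a * s + b" "q ^ (2 * k) * c1 = 9 * s ^ 8 + a"
      using c0 c1 by (simp_all add: F0_def F1_def)
    show "\<not> q\<^sup>2 dvd c0"
    proof
      assume "q\<^sup>2 dvd c0"
      then have "q ^ (2 * k) * q\<^sup>2 dvd F0" unfolding c0 by (intro mult_dvd_mono) auto
      then have "q ^ (2 * k + 2) dvd F0" by (simp only: power_add)
      moreover have "q ^ Suc V dvd q ^ (2 * k + 2)" using k by (intro le_imp_power_dvd) simp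
      ultimately show False using F0' dvd_trans by blast
    qed
    show "q dvd c0 \<longrightarrow> q dvd c1"
    proof
      assume "q dvd c0"
      then have "q ^ (2 * k) * q dvd F0" unfolding c0 by (intro mult_dvd_mono) auto
      then have "q ^ Suc (2 * k) dvd F0" by (simp add: mult.commute)
      then have "V \<noteq> 2 * k" using F0' by metis
      then have "V = Suc (2 * k)" using k by simp
      then have "q ^ (2 * k) * q dvd q ^ (2 * k) * c1" using F1 c1 by (simp add: mult.commute)
      then show "q dvd c1" using q0 dvd_times_left_cancel_iff by blast
    qed
    have "q dvd q ^ V" using \<open>V \<noteq> 0\<close> by simp
    then show "q dvd s ^ 9 + a * s + b" "q dvd 9 * s ^ 8 + a"
      using F0 F1 dvd_trans by (auto simp: F0_def F1_def)
  qed (use s q_dvd_s in auto)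
qed

text \<open>In the application \<open>m = c ^ 4 + a\<close>, and \<open>b ^ 2 + c * m ^ 2\<close> is
  \<open>f(x) f(-x)\<close> for \<open>x ^ 2 = - c\<close>. If it vanishes modulo \<open>q\<close>,
  then \<open>- c\<close> is the square of \<open>b / m\<close>, and \<open>w = m s / b\<close>
  makes \<open>- w ^ 2 * c\<close> congruent to \<open>s ^ 2\<close>.\<close>

lemma exists_square_multiplier:
  fixes b c m s q :: int
  assumes q: "prime q" and b: "\<not> q dvd b" and s: "\<not> q dvd s"
  obtains w where "\<not> q dvd w" "q dvd w\<^sup>2 * c + s\<^sup>2 \<or> w = 1 \<and> \<not> q dvd b\<^sup>2 + c * m\<^sup>2"
proof (cases "q dvd b\<^sup>2 + c * m\<^sup>2")
  case False
  moreover have "\<not> q dvd 1" using q by auto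
  ultimately show ?thesis using that[of 1] by blast
next
  case True
  have m: "\<not> q dvd m"
  proof
    assume "q dvd m"
    then have "q dvd c * m\<^sup>2" by (simp add: power2_eq_square)
    then have "q dvd b\<^sup>2" using True dvd_add_left_iff by blast
    then show False using b q prime_dvd_power by blast
  qed
  have "coprime b q" using b q by (metis coprime_commute prime_imp_coprime)
  then obtain u v where uv: "u * b + v * q = 1" using bezout_int[of b q] by auto
  have "\<not> q dvd u"
  proof
    assume "q dvd u"
    then have "q dvd u * b + v * q" by simp
    then show False using uv q by (metis not_prime_unit)
  qed
  then have "\<not> q dvd m * s * u" using m s q by (simp add: prime_dvd_mult_iff)
  moreover have "(m * s * u)\<^sup>2 * c + s\<^sup>2 =
      (s * u)\<^sup>2 * (b\<^sup>2 + c * m\<^sup>2) + s\<^sup>2 * (1 - u * b) * (1 + u * b)"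
    by algebra
  moreover have "1 - u * b = v * q" using uv by linarith
  ultimately have "q dvd (m * s * u)\<^sup>2 * c + s\<^sup>2" using True by simp
  then show ?thesis using that \<open>\<not> q dvd m * s * u\<close> by blast
qed

lemma (in valuation_ring) poly_divided_difference:
  assumes "\<And>i. coeff q i \<in> A" "x \<in> A" "y \<in> A"
  obtains r where "r \<in> A" "poly q x - poly q y = (x - y) * r"
proof
  show "poly (synthetic_div q y) x \<in> A"
    using assms by (intro poly coeff_synthetic_div_closed)
  show "poly q x - poly q y = (x - y) * poly (synthetic_div q y) x"
    using arg_cong[OF synthetic_div_correct'[of y q], of "\<lambda>r. poly r x"] by (simp add: algebra_simps)
qed

lemma (in p_valuation) of_int_prime_square_dvd:
  assumes "of_int n = of_nat p ^ 2 * z" "z \<in> A"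
  shows "(int p)\<^sup>2 dvd n"
proof -
  have p0: "(of_nat p :: complex) \<noteq> 0" using prime_gt_0_nat[OF prime_p] by simp
  have "of_nat p * (of_nat p * z) \<in> nonunits"
    using p_nonunit assms(2) by (intro nonunits_mult closed)
  then have "int p dvd n" using assms(1) by (simp add: power2_eq_square mult.assoc flip: of_int_nonunits_iff)
  then obtain m where m: "n = int p * m" by (rule dvdE)
  then have "of_int m = of_nat p * z" using assms(1) p0 by (simp add: power2_eq_square)
  then have "int p dvd m"
    using nonunits_mult[OF p_nonunit assms(2)] by (simp flip: of_int_nonunits_iff)
  then show ?thesis unfolding m power2_eq_square by (intro mult_dvd_mono) auto
qed

text \<open>The polynomial \<open>((y + s)\<^sup>9 - 9 s\<^sup>8 y - s\<^sup>9) / y\<^sup>2\<close>.\<close>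

definition shifted_cofactor :: "int \<Rightarrow> int poly" where
  "shifted_cofactor s = [:36 * s ^ 7, 84 * s ^ 6, 126 * s ^ 5, 126 * s ^ 4, 84 * s ^ 3, 36 * s ^ 2, 9 * s, 1:]"

lemma shifted_cofactor_degree: "degree (shifted_cofactor s) = 7"
  and shifted_cofactor_monic: "lead_coeff (shifted_cofactor s) = 1"
  by (simp_all add: shifted_cofactor_def)

lemma ipoly_shifted_cofactor:
  "ipoly (shifted_cofactor s) y = 36 * of_int s ^ 7 + 84 * of_int s ^ 6 * y + 126 * of_int s ^ 5 * y ^ 2
     + 126 * of_int s ^ 4 * y ^ 3 + 84 * of_int s ^ 3 * y ^ 4 + 36 * of_int s ^ 2 * y ^ 5
     + 9 * of_int s * y ^ 6 + y ^ 7"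
  by (simp add: shifted_cofactor_def map_poly_pCons algebra_simps) (simp add: eval_nat_numeral)

lemma ipoly_pderiv_shifted_cofactor:
  "ipoly (pderiv (shifted_cofactor s)) y = 84 * of_int s ^ 6 + 252 * of_int s ^ 5 * y
     + 378 * of_int s ^ 4 * y ^ 2 + 336 * of_int s ^ 3 * y ^ 3 + 180 * of_int s ^ 2 * y ^ 4
     + 54 * of_int s * y ^ 5 + 7 * y ^ 6"
  by (simp add: shifted_cofactor_def pderiv_pCons map_poly_pCons algebra_simps) (simp add: eval_nat_numeral)

lemma trinomial9_shift:
  "ipoly (trinomial9 a b) (y + of_int s) =
     y ^ 2 * ipoly (shifted_cofactor s) y + of_int (9 * s ^ 8 + a) * y + of_int (s ^ 9 + a * s + b)"
proof -
  have "(y + S) ^ 9 + a' * (y + S) + b' = y ^ 2 * (36 * S ^ 7 + 84 * S ^ 6 * y + 126 * S ^ 5 * y ^ 2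
      + 126 * S ^ 4 * y ^ 3 + 84 * S ^ 3 * y ^ 4 + 36 * S ^ 2 * y ^ 5 + 9 * S * y ^ 6 + y ^ 7)
      + (9 * S ^ 8 + a') * y + (S ^ 9 + a' * S + b')" for S a' b' :: complex
    by algebra
  from this[of "of_int s" "of_int a" "of_int b"] show ?thesis
    by (simp add: ipoly_trinomial9 ipoly_shifted_cofactor)
qed

lemma pderiv_trinomial9_shift:
  "ipoly (pderiv (trinomial9 a b)) (y + of_int s) =
     2 * y * ipoly (shifted_cofactor s) y + y ^ 2 * ipoly (pderiv (shifted_cofactor s)) y
       + of_int (9 * s ^ 8 + a)"
proof -
  have "9 * (y + S) ^ 8 + a' = 2 * y * (36 * S ^ 7 + 84 * S ^ 6 * y + 126 * S ^ 5 * y ^ 2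
      + 126 * S ^ 4 * y ^ 3 + 84 * S ^ 3 * y ^ 4 + 36 * S ^ 2 * y ^ 5 + 9 * S * y ^ 6 + y ^ 7)
      + y ^ 2 * (84 * S ^ 6 + 252 * S ^ 5 * y + 378 * S ^ 4 * y ^ 2 + 336 * S ^ 3 * y ^ 3
      + 180 * S ^ 2 * y ^ 4 + 54 * S * y ^ 5 + 7 * y ^ 6) + (9 * S ^ 8 + a')" for S a' :: complex
    by algebra
  from this[of "of_int s" "of_int a"] show ?thesis
    by (simp add: ipoly_pderiv_trinomial9 ipoly_shifted_cofactor ipoly_pderiv_shifted_cofactor)
qed

section \<open>Expansion of the trinomial at an approximate double root\<close>

locale double_root = p_valuation A p + monic_irreducible "trinomial9 a b" \<alpha>
  for A :: "complex set" and p :: nat and a b :: int and \<alpha> :: complex +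
  fixes s c0 c1 :: int and k :: nat
  assumes p5: "p \<ge> 5"
    and pa: "\<not> int p dvd a" and pb: "\<not> int p dvd b" and ps: "\<not> int p dvd s"
    and F0: "int p ^ (2 * k) * c0 = s ^ 9 + a * s + b" and F1: "int p ^ (2 * k) * c1 = 9 * s ^ 8 + a"
    and crit: "int p dvd 8 * a * s + 9 * b"
    and c0: "\<not> (int p)\<^sup>2 dvd c0" and c01: "int p dvd c0 \<longrightarrow> int p dvd c1"
    and pF0: "int p dvd s ^ 9 + a * s + b" and pF1: "int p dvd 9 * s ^ 8 + a"
begin

abbreviation (input) "G \<equiv> shifted_cofactor s"

lemma p_nonzero: "(of_nat p :: complex) \<noteq> 0"
  using prime_gt_0_nat[OF prime_p] by simp

lemma const_cofactor_unit: "\<not> int p dvd 36 * s ^ 7"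
proof -
  have p: "prime (int p)" using prime_p by simp
  have "\<not> int p dvd 4" using small_not_dvd[OF p5, of 4] by simp
  then have "\<not> int p dvd 4 * 9" using not_dvd_9[OF p5] prime_dvd_multD[OF p, of 4 9] by blast
  moreover have "\<not> int p dvd s ^ 7" using ps prime_dvd_power[OF p] by blast
  ultimately show ?thesis by (simp add: prime_dvd_mult_iff[OF p])
qed

lemma cofactor_zero: "ipoly G 0 = of_int (36 * s ^ 7)"
  by (simp add: ipoly_shifted_cofactor)

text \<open>The constant coefficient \<open>36 s ^ 7\<close> is prime to \<open>p\<close>: the
  multiple root has multiplicity exactly two.\<close>

lemma cofactor_near_zero:
  assumes "y \<in> nonunits"
  shows "ipoly G y \<in> units"
proof -
  have "ipoly G 0 - ipoly G y \<in> nonunits"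
    using ipoly_cong[of 0 y G] assms nonunits_uminus nonunits_closed zero by simp
  moreover have "ipoly G 0 \<in> units"
    unfolding cofactor_zero of_int_units_iff by (rule const_cofactor_unit)
  ultimately show ?thesis by (rule units_cong)
qed

lemma shift_root:
  assumes "ipoly (trinomial9 a b) (y + of_int s) = 0"
  shows "y ^ 2 * ipoly G y = - (of_nat p ^ (2 * k) * (of_int c0 + of_int c1 * y))"
proof -
  have "of_int (9 * s ^ 8 + a) = (of_nat p ^ (2 * k) * of_int c1 :: complex)"
    "of_int (s ^ 9 + a * s + b) = (of_nat p ^ (2 * k) * of_int c0 :: complex)"
    using F0 F1 by (simp_all flip: F0 F1)
  then show ?thesis
    using assms unfolding trinomial9_shift by (simp add: eq_neg_iff_add_eq_0 algebra_simps)
qed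

lemma shift_closed: "ipoly (trinomial9 a b) (y + of_int s) = 0 \<Longrightarrow> algebraic_int y"
  using algebraic_int_root[of "y + of_int s"] algebraic_int_diff[of "y + of_int s" "of_int s"] by simp

lemma cofactor_root_unit:
  assumes "ipoly G g = 0"
  shows "g \<in> units"
proof -
  have "g \<in> A"
  proof (rule integrally_closed[of "map_poly of_int G"])
    show "lead_coeff (map_poly of_int G) = 1"
      using shifted_cofactor_monic[of s] by (simp add: map_poly_degree_eq coeff_map_poly)
  qed (use assms coeff_ipoly_closed in auto)
  then show ?thesis
    using cofactor_near_zero[of g] assms units_iff units_nonzero by auto
qed

text \<open>A multiple root \<open>g\<close> of the cofactor modulo the maximal ideal would make
  \<open>g + s\<close> a common zero of \<open>f\<close> and \<open>f'\<close>. But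
  \<open>9 f - x f'\<close> is the linear polynomial \<open>8 a x + 9 b\<close>, whose only residual
  zero is \<open>s\<close>, whereas \<open>g\<close> is a unit.\<close>

lemma cofactor_separable:
  assumes "ipoly G g = 0"
  shows "ipoly (pderiv G) g \<in> units"
proof (rule ccontr)
  have g: "g \<in> units" using assms by (rule cofactor_root_unit)
  then have gA: "g \<in> A" by (rule units_closed)
  assume "ipoly (pderiv G) g \<notin> units"
  then have n: "ipoly (pderiv G) g \<in> nonunits" using ipoly_closed[OF gA] units_iff by blast
  define x where "x = g + of_int s"
  have xA: "x \<in> A" unfolding x_def using gA by (intro closed)
  have f'x: "ipoly (pderiv (trinomial9 a b)) x \<in> nonunits"
    unfolding x_def pderiv_trinomial9_shift assms
    using n gA pF1 by (intro nonunits_add nonunits_mult') (auto simp: nonunits_zero of_int_nonunits_iff intro!: closed simp del: of_int_add of_int_mult)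
  have fx: "ipoly (trinomial9 a b) x \<in> nonunits"
    unfolding x_def trinomial9_shift assms mult_zero_right add_0_left
    using gA pF0 pF1 by (intro nonunits_add nonunits_mult) (auto simp: nonunits_zero of_int_nonunits_iff simp del: of_int_add of_int_mult)
  have "9 * ipoly (trinomial9 a b) x - x * ipoly (pderiv (trinomial9 a b)) x =
      of_int (8 * a * s + 9 * b) + of_int (8 * a) * g"
    by (simp add: ipoly_trinomial9 ipoly_pderiv_trinomial9 power9_eq x_def algebra_simps)
  moreover have "9 * ipoly (trinomial9 a b) x - x * ipoly (pderiv (trinomial9 a b)) x \<in> nonunits"
    using f'x fx xA by (intro nonunits_diff nonunits_mult' closed)
  ultimately have "of_int (8 * a) * g \<in> nonunits"
    using nonunits_addD of_int_nonunits_iff crit by metis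
  then have "of_int (8 * a) \<in> nonunits" using g nonunits_multD units_iff of_int gA by blast
  then have "int p dvd 8 * a" by (simp only: of_int_nonunits_iff)
  then show False using pa not_dvd_8[OF p5] prime_p by (simp add: prime_dvd_mult_iff)
qed

lemma cofactor_roots:
  "finite {g. ipoly G g = 0}" "card {g. ipoly G g = 0} = 7"
  "\<And>g. ipoly G g = 0 \<Longrightarrow> g \<in> A"
  "\<And>g h. ipoly G g = 0 \<Longrightarrow> ipoly G h = 0 \<Longrightarrow> g \<noteq> h \<Longrightarrow> g - h \<in> units"
proof -
  have 1: "lead_coeff (map_poly of_int G :: complex poly) = 1"
    using shifted_cofactor_monic[of s] by (simp add: map_poly_degree_eq coeff_map_poly)
  have 2: "poly (pderiv (map_poly of_int G :: complex poly)) g \<in> units" if "ipoly G g = 0" for g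
    using cofactor_separable[OF that] by (simp only: map_poly_of_int_pderiv)
  note r = separable_roots[OF 1 coeff_ipoly_closed 2]
  show "finite {g. ipoly G g = 0}" "card {g. ipoly G g = 0} = 7"
    using r(1,2) shifted_cofactor_monic[of s] by (simp_all add: map_poly_degree_eq shifted_cofactor_degree)
  show "g \<in> A" if "ipoly G g = 0" for g using r(3) that by blast
  show "g - h \<in> units" if "ipoly G g = 0" "ipoly G h = 0" "g \<noteq> h" for g h using r(4) that by blast
qed

lemma cofactor_root_close:
  assumes "ipoly G g = 0"
  obtains y where "ipoly (trinomial9 a b) (y + of_int s) = 0" "g - y \<in> nonunits"
proof -
  have gA: "g \<in> A" using assms by (rule cofactor_roots(3))
  have "ipoly (trinomial9 a b) (g + of_int s) \<in> nonunits"
    unfolding trinomial9_shift assms mult_zero_right add_0_left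
    using gA pF0 pF1 by (intro nonunits_add nonunits_mult) (auto simp: nonunits_zero of_int_nonunits_iff simp del: of_int_add of_int_mult)
  then obtain z where "ipoly (trinomial9 a b) z = 0" "g + of_int s - z \<in> nonunits"
    using exists_close_root[OF monic_fC coeff_ipoly_closed, of "g + of_int s"] gA add of_int by blast
  then show ?thesis using that[of "z - of_int s"] by (simp add: algebra_simps)
qed

text \<open>One root close to \<open>s\<close> comes from \<open>f(s)\<close> being a nonunit, the
  other from the factorisation of \<open>f'\<close> at the first root. The last clause later
  prevents \<open>y1 - y2\<close> from being too small.\<close>

lemma close_pair:
  obtains y1 y2 where "ipoly (trinomial9 a b) (y1 + of_int s) = 0" "ipoly (trinomial9 a b) (y2 + of_int s) = 0"
    "y1 \<noteq> y2" "y1 \<in> nonunits" "y2 \<in> nonunits"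
    "\<exists>r\<in>A. ipoly (pderiv (trinomial9 a b)) (y1 + of_int s) = (y1 - y2) * r"
proof -
  have "ipoly (trinomial9 a b) (0 + of_int s) \<in> nonunits"
    unfolding trinomial9_shift using pF0 by (simp add: of_int_nonunits_iff del: of_int_add of_int_mult)
  then obtain z where z: "ipoly (trinomial9 a b) z = 0" "of_int s - z \<in> nonunits"
    using exists_close_root[OF monic_fC coeff_ipoly_closed, of "of_int s"] of_int by auto
  define y1 where "y1 = z - of_int s"
  have y1: "y1 \<in> nonunits" "z = y1 + of_int s"
    using nonunits_uminus[OF z(2)] by (simp_all add: y1_def)
  have y1A: "y1 \<in> A" using y1(1) by (rule nonunits_closed)
  let ?S = "{x. ipoly (trinomial9 a b) x = 0}"
  have f'z: "ipoly (pderiv (trinomial9 a b)) z \<in> nonunits"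
    unfolding y1(2) pderiv_trinomial9_shift
    using y1(1) y1A pF1
    by (intro nonunits_add nonunits_mult nonunits_mult'[of y1] nonunits_power ipoly_closed)
       (auto simp: of_int_nonunits_iff numeral simp del: of_int_add of_int_mult)
  have f'_prod: "ipoly (pderiv (trinomial9 a b)) z = (\<Prod>x\<in>?S - {z}. z - x)"
    using poly_pderiv_prod_root[OF roots(2), of z] z(1) roots(1)[symmetric]
    by (simp only: map_poly_of_int_pderiv mem_Collect_eq simp_thms)
  have closed_S: "x \<in> A" if "x \<in> ?S" for x
    using that algebraic_int_root algebraic_int_closed by blast
  have "\<exists>x\<in>?S - {z}. z - x \<in> nonunits"
  proof (rule nonunits_prodD)
    show "finite (?S - {z})" using roots(2) by simp
    show "(\<Prod>x\<in>?S - {z}. z - x) \<in> nonunits" using f'z f'_prod by simp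
    show "z - x \<in> A" if "x \<in> ?S - {z}" for x using closed_S that z(1) by (intro diff) auto
  qed
  then obtain x where x: "x \<in> ?S" "x \<noteq> z" "z - x \<in> nonunits" by blast
  define y2 where "y2 = x - of_int s"
  have x_eq: "x = y2 + of_int s" by (simp add: y2_def)
  have "y1 - (z - x) \<in> nonunits" using y1(1) x(3) by (rule nonunits_diff)
  then have y2: "y2 \<in> nonunits" by (simp add: y1_def y2_def)
  have "(\<Prod>x\<in>?S - {z}. z - x) = (z - x) * (\<Prod>w\<in>?S - {z} - {x}. z - w)"
    using x roots(2) by (intro prod.remove) auto
  moreover have "(\<Prod>w\<in>?S - {z} - {x}. z - w) \<in> A"
    using closed_S z(1) by (intro prod diff) auto
  ultimately have "\<exists>r\<in>A. ipoly (pderiv (trinomial9 a b)) (y1 + of_int s) = (y1 - y2) * r"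
    using f'_prod y1(2) x_eq by auto
  then show ?thesis using that[of y1 y2] z(1) x y1 y2 x_eq by auto
qed

text \<open>At a shifted root this is an algebraic integer: its square is
  \<open>- (c0 + c1 y) G(y)\<close>. Division by \<open>p ^ k\<close> separates the two values
  coming from the double root as far as integrality permits.\<close>

definition om :: "complex \<Rightarrow> complex" where
  "om y = y * ipoly G y / of_nat p ^ k"

definition th :: "int \<Rightarrow> int \<Rightarrow> complex \<Rightarrow> complex" where
  "th u w y = y + of_int u * ipoly G y + of_int w * om y"

lemma om_square:
  assumes "ipoly (trinomial9 a b) (y + of_int s) = 0"
  shows "om y ^ 2 = - ((of_int c0 + of_int c1 * y) * ipoly G y)"
proof -
  have "om y ^ 2 = (y ^ 2 * ipoly G y) * ipoly G y / of_nat p ^ (2 * k)"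
    unfolding power_even_eq om_def by (simp add: power_divide power2_eq_square mult_ac)
  also have "\<dots> = - ((of_int c0 + of_int c1 * y) * ipoly G y)"
    unfolding shift_root[OF assms] using p_nonzero by (simp add: mult_ac)
  finally show ?thesis .
qed

lemma om_mult:
  assumes "ipoly (trinomial9 a b) (y + of_int s) = 0"
  shows "y * om y = - (of_nat p ^ k * (of_int c0 + of_int c1 * y))"
proof -
  have "y * om y = (y ^ 2 * ipoly G y) / of_nat p ^ k"
    by (simp add: om_def power2_eq_square mult_ac)
  also have "\<dots> = - (of_nat p ^ k * (of_int c0 + of_int c1 * y))"
    unfolding shift_root[OF assms] mult_2 power_add using p_nonzero by (simp add: field_simps)
  finally show ?thesis .
qed

lemma algebraic_int_om:
  assumes "ipoly (trinomial9 a b) (y + of_int s) = 0"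
  shows "algebraic_int (om y)"
proof (rule algebraic_int_integrally_closed[of "[:- (om y ^ 2), 0, 1:]"])
  have "algebraic_int (om y ^ 2)"
    unfolding om_square[OF assms] algebraic_int_minus_iff using shift_closed[OF assms]
    by (intro algebraic_int_mult algebraic_int_add algebraic_int_ipoly) auto
  then show "algebraic_int (coeff [:- (om y ^ 2), 0, 1:] i)" for i
    by (auto simp: coeff_pCons split: nat.splits)
  show "poly [:- (om y ^ 2), 0, 1:] (om y) = 0" by (simp add: power2_eq_square)
qed simp

lemma algebraic_int_th:
  assumes "ipoly (trinomial9 a b) (y + of_int s) = 0"
  shows "algebraic_int (th u w y)"
  unfolding th_def using algebraic_int_om[OF assms] shift_closed[OF assms]
  by (intro algebraic_int_mult algebraic_int_add algebraic_int_ipoly algebraic_int_of_int)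

lemma th_rpoly: "\<exists>T. \<forall>x. rpoly T x = th u w (x - of_int s)"
proof -
  define L :: "rat poly" where "L = [:- of_int s, 1:]"
  define H :: "rat poly" where "H = pcompose (map_poly of_int G) L"
  have L: "rpoly L x = x - of_int s" for x
    by (simp add: L_def map_poly_pCons of_rat_minus)
  have H: "rpoly H x = ipoly G (x - of_int s)" for x
    by (simp add: H_def rpoly_pcompose L map_poly_of_rat_of_int)
  have const: "rpoly [:c:] x = of_rat c" for c x by (simp add: map_poly_pCons)
  have "rpoly (L + [:of_int u:] * H + [:of_int w / of_nat p ^ k:] * (L * H)) x = th u w (x - of_int s)" for x
    by (simp only: map_poly_of_rat_add map_poly_of_rat_mult poly_add poly_mult L H const)
       (simp add: th_def om_def of_rat_divide of_rat_power)
  then show ?thesis by blast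
qed

section \<open>The generator \<open>th u w\<close> for suitable \<open>u\<close> and
  \<open>w\<close>\<close>

context
  fixes u w :: int
  assumes uw: "k = 0 \<and> u = 0 \<and> w = 0 \<or>
    k > 0 \<and> int p dvd u * (36 * s ^ 7) + s \<and> \<not> int p dvd w \<and>
    (int p dvd w\<^sup>2 * (c0 * (36 * s ^ 7)) + s\<^sup>2 \<or>
     w = 1 \<and> \<not> int p dvd b\<^sup>2 + c0 * (36 * s ^ 7) * ((c0 * (36 * s ^ 7)) ^ 4 + a)\<^sup>2)"
begin

text \<open>For \<open>k > 0\<close> both \<open>y ^ 2 * G(y)\<close> and \<open>y * om y\<close>
  are divisible by \<open>p ^ k\<close>; as \<open>y\<close> is a unit, the two correction terms are
  nonunits.\<close>

lemma th_near_simple_root: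
  assumes y: "ipoly (trinomial9 a b) (y + of_int s) = 0" "y \<in> units"
  shows "th u w y - y \<in> nonunits"
proof (cases "k = 0")
  case True
  then have "u = 0" "w = 0" using uw by auto
  then show ?thesis by (simp add: th_def nonunits_zero)
next
  case False
  have yA: "y \<in> A" using y(2) by (rule units_closed)
  have pk: "of_nat p ^ k * (of_int c0 + of_int c1 * y) \<in> nonunits"
    "of_nat p ^ (2 * k) * (of_int c0 + of_int c1 * y) \<in> nonunits"
    using False p_nonunit yA by (auto intro!: nonunits_mult nonunits_power closed)
  have "y ^ 2 * ipoly G y \<in> nonunits"
    unfolding shift_root[OF y(1)] using pk(2) by (rule nonunits_uminus)
  then have "ipoly G y \<in> nonunits"
    using units_power[OF y(2)] ipoly_closed[OF yA] by (rule nonunits_unit_multD)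
  moreover have "y * om y \<in> nonunits"
    unfolding om_mult[OF y(1)] using pk(1) by (rule nonunits_uminus)
  then have "om y \<in> nonunits"
    using y(2) algebraic_int_closed[OF algebraic_int_om[OF y(1)]] by (rule nonunits_unit_multD)
  ultimately have "of_int u * ipoly G y + of_int w * om y \<in> nonunits"
    by (intro nonunits_add nonunits_mult' of_int)
  then show ?thesis by (simp add: th_def add.assoc)
qed

text \<open>For \<open>k > 0\<close> let \<open>\<psi> = th u w y + s\<close>. The choice of
  \<open>u\<close> cancels \<open>s + u G(0)\<close>, so \<open>\<psi>\<close> is congruent to
  \<open>w * om y\<close> and \<open>\<psi> ^ 2\<close> to \<open>- w ^ 2 * c\<close>, where
  \<open>c = c0 G(0)\<close>. Since \<open>f(\<psi>)\<close> is congruent to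
  \<open>th ^ 2 * G(th)\<close>, it suffices that \<open>f(\<psi>)\<close> is a unit or
  \<open>th\<close> a nonunit. If \<open>\<psi>\<close> is congruent to \<open>s\<close> or
  \<open>- s\<close>, the latter holds or \<open>f(-s) = 2 b - f(s)\<close> is a unit.\<close>

lemma cofactor_th_unit:
  assumes y: "ipoly (trinomial9 a b) (y + of_int s) = 0" "y \<in> nonunits"
  shows "ipoly G (th u w y) \<in> units"
proof (cases "k = 0")
  case True
  then have "u = 0" "w = 0" using uw by auto
  then show ?thesis using cofactor_near_zero[OF y(2)] by (simp add: th_def)
next
  case False
  define c where "c = c0 * (36 * s ^ 7)"
  have u: "int p dvd u * (36 * s ^ 7) + s"
    and w: "int p dvd w\<^sup>2 * c + s\<^sup>2 \<or> w = 1 \<and> \<not> int p dvd b\<^sup>2 + c * (c ^ 4 + a)\<^sup>2"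
    using uw False by (auto simp: c_def)
  define \<psi> where "\<psi> = th u w y + of_int s"
  have yA: "y \<in> A" using y(2) by (rule nonunits_closed)
  have omA: "om y \<in> A" using algebraic_int_closed[OF algebraic_int_om[OF y(1)]] .
  have thA: "th u w y \<in> A" using algebraic_int_closed[OF algebraic_int_th[OF y(1)]] .
  have \<psi>A: "\<psi> \<in> A" unfolding \<psi>_def using thA of_int by (rule add)
  have G_cong: "ipoly G y - of_int (36 * s ^ 7) \<in> nonunits"
    using ipoly_cong[of y 0 G] y(2) yA zero by (simp add: cofactor_zero)
  have "\<psi> - of_int w * om y = y + of_int u * (ipoly G y - of_int (36 * s ^ 7)) + of_int (u * (36 * s ^ 7) + s)"
    by (simp add: \<psi>_def th_def algebra_simps)
  also have "\<dots> \<in> nonunits"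
    using y(2) G_cong u by (intro nonunits_add nonunits_mult' of_int) (simp_all only: of_int_nonunits_iff)
  finally have "\<psi> ^ 2 - (of_int w * om y) ^ 2 \<in> nonunits"
    using \<psi>A omA by (intro nonunits_power_diff mult of_int)
  moreover have "(of_int w * om y) ^ 2 - of_int (- (w\<^sup>2 * c)) \<in> nonunits"
  proof -
    have "(of_int w * om y) ^ 2 - of_int (- (w\<^sup>2 * c)) =
        of_int w ^ 2 * (- of_int c0 * (ipoly G y - of_int (36 * s ^ 7)) + y * (- of_int c1 * ipoly G y))"
      unfolding power_mult_distrib om_square[OF y(1)] by (simp add: c_def algebra_simps)
    also have "\<dots> \<in> nonunits"
      using G_cong y(2) ipoly_closed[OF yA]
      by (intro nonunits_mult' nonunits_add nonunits_mult'[OF G_cong] nonunits_mult[OF y(2)] closed)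
    finally show ?thesis .
  qed
  ultimately have \<psi>2: "\<psi> ^ 2 - of_int (- (w\<^sup>2 * c)) \<in> nonunits"
    using nonunits_add[of "\<psi> ^ 2 - (of_int w * om y) ^ 2" "(of_int w * om y) ^ 2 - of_int (- (w\<^sup>2 * c))"] by simp
  have G_of_f: "ipoly G (th u w y) \<in> units" if "ipoly (trinomial9 a b) \<psi> \<in> units"
  proof -
    let ?t = "th u w y"
    have "of_int (9 * s ^ 8 + a) * ?t + of_int (s ^ 9 + a * s + b) \<in> nonunits"
      using pF0 pF1 thA by (intro nonunits_add nonunits_mult) (simp_all only: of_int_nonunits_iff)
    then have "ipoly (trinomial9 a b) \<psi> - ?t ^ 2 * ipoly G ?t \<in> nonunits"
      unfolding \<psi>_def trinomial9_shift by (simp add: add.assoc)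
    then have "?t ^ 2 * ipoly G ?t \<in> units" using that by (rule units_cong)
    then show ?thesis
      using units_multD power[OF thA] ipoly_closed[OF thA] by blast
  qed
  have f_cong: "ipoly (trinomial9 a b) \<psi> \<in> units"
    if "of_int n - \<psi> \<in> nonunits" "\<not> int p dvd n ^ 9 + a * n + b" for n
  proof (rule units_cong)
    show "ipoly (trinomial9 a b) (of_int n) - ipoly (trinomial9 a b) \<psi> \<in> nonunits"
      using that(1) \<psi>A by (intro ipoly_cong of_int)
    have "ipoly (trinomial9 a b) (of_int n) = of_int (n ^ 9 + a * n + b)"
      by (simp add: ipoly_trinomial9)
    then show "ipoly (trinomial9 a b) (of_int n) \<in> units"
      using that(2) by (simp only: of_int_units_iff not_False_eq_True)
  qed
  from w show ?thesis
  proof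
    assume w2: "int p dvd w\<^sup>2 * c + s\<^sup>2"
    have "\<psi> ^ 2 - of_int (- (w\<^sup>2 * c)) - of_int (w\<^sup>2 * c + s\<^sup>2) \<in> nonunits"
      using w2 by (intro nonunits_diff[OF \<psi>2]) (simp only: of_int_nonunits_iff)
    also have "\<psi> ^ 2 - of_int (- (w\<^sup>2 * c)) - of_int (w\<^sup>2 * c + s\<^sup>2) = (\<psi> - of_int s) * (\<psi> + of_int s)"
      by (simp add: algebra_simps power2_eq_square)
    finally have "\<psi> - of_int s \<in> nonunits \<or> \<psi> + of_int s \<in> nonunits"
      using \<psi>A by (intro nonunits_multD closed)
    then show ?thesis
    proof
      assume "\<psi> - of_int s \<in> nonunits"
      then have "th u w y \<in> nonunits" by (simp add: \<psi>_def)
      then show ?thesis by (rule cofactor_near_zero)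
    next
      assume "\<psi> + of_int s \<in> nonunits"
      then have "- (\<psi> + of_int s) \<in> nonunits" by (rule nonunits_uminus)
      moreover have "of_int (- s) - \<psi> = - (\<psi> + of_int s)" by simp
      ultimately have "of_int (- s) - \<psi> \<in> nonunits" by metis
      moreover have "\<not> int p dvd (- s) ^ 9 + a * (- s) + b"
      proof
        assume "int p dvd (- s) ^ 9 + a * (- s) + b"
        then have "int p dvd ((- s) ^ 9 + a * (- s) + b) + (s ^ 9 + a * s + b)" using pF0 by (rule dvd_add)
        moreover have "((- s) ^ 9 + a * (- s) + b) + (s ^ 9 + a * s + b) = 2 * b" by simp
        ultimately have "int p dvd 2 * b" by simp
        then show False
          using pb small_not_dvd[OF p5, of 2] prime_p by (simp add: prime_dvd_mult_iff)
      qed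
      ultimately show ?thesis by (intro G_of_f f_cong)
    qed
  next
    assume w1: "w = 1 \<and> \<not> int p dvd b\<^sup>2 + c * (c ^ 4 + a)\<^sup>2"
    have \<psi>c: "\<psi> ^ 2 - of_int (- c) \<in> nonunits" using \<psi>2 w1 by simp
    have "(\<psi> ^ 2) ^ 4 - of_int (- c) ^ 4 \<in> nonunits"
      using \<psi>c \<psi>A by (intro nonunits_power_diff closed)
    then have 1: "(\<psi> ^ 8 + of_int a) - of_int (c ^ 4 + a) \<in> nonunits"
      by simp
    then have 2: "(\<psi> ^ 8 + of_int a) ^ 2 - of_int (c ^ 4 + a) ^ 2 \<in> nonunits"
      using \<psi>A by (intro nonunits_power_diff closed)
    \<comment> \<open>The second factor is \<open>f(-\<psi>)\<close>. The product
      \<open>f(\<psi>) f(-\<psi>)\<close> depends only on \<open>\<psi> ^ 2\<close>, whose residue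
      is \<open>- c\<close>.\<close>
    have "of_int (b\<^sup>2 + c * (c ^ 4 + a)\<^sup>2) -
        ipoly (trinomial9 a b) \<psi> * (of_int b - \<psi> * (\<psi> ^ 8 + of_int a)) =
        (\<psi> ^ 2 - of_int (- c)) * (\<psi> ^ 8 + of_int a) ^ 2
          + of_int (- c) * ((\<psi> ^ 8 + of_int a) ^ 2 - of_int (c ^ 4 + a) ^ 2)"
      unfolding ipoly_trinomial9 power9_eq by (simp add: algebra_simps power2_eq_square)
    also have "\<dots> \<in> nonunits"
      using \<psi>A by (intro nonunits_add nonunits_mult[OF \<psi>c] nonunits_mult'[OF 2] closed)
    finally have "ipoly (trinomial9 a b) \<psi> * (of_int b - \<psi> * (\<psi> ^ 8 + of_int a)) \<in> units"
      by (rule units_cong) (use w1 in \<open>simp only: of_int_units_iff not_False_eq_True\<close>)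
    moreover have "of_int b - \<psi> * (\<psi> ^ 8 + of_int a) \<in> A" using \<psi>A by (intro closed)
    ultimately have "ipoly (trinomial9 a b) \<psi> \<in> units"
      using units_multD ipoly_closed[OF \<psi>A] by blast
    then show ?thesis by (rule G_of_f)
  qed
qed

text \<open>The difference has half the valuation of \<open>c0\<close>, which is less than that of
  \<open>p\<close>. It equals \<open>y1 / p ^ k\<close> times a unit, and \<open>y1 ^ 2\<close> is
  \<open>p ^ (2 * k) * c0\<close> times a unit.\<close>

lemma th_difference:
  assumes y1: "ipoly (trinomial9 a b) (y1 + of_int s) = 0" "y1 \<in> nonunits"
    and y2: "ipoly (trinomial9 a b) (y2 + of_int s) = 0" "y2 \<in> nonunits"
    and diff_root: "\<exists>r\<in>A. ipoly (pderiv (trinomial9 a b)) (y1 + of_int s) = (y1 - y2) * r"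
  obtains v where "v \<in> units" "(th u w y1 - th u w y2) ^ 2 = of_int c0 * v"
proof -
  have c0_nz: "c0 \<noteq> 0" using c0 by auto
  \<comment> \<open>If \<open>p\<close> does not divide \<open>c0\<close>, it is a unit. Otherwise
    \<open>p\<close> divides both \<open>c0\<close> and \<open>c1\<close>, and
    \<open>p\<^sup>2\<close> not dividing \<open>c0\<close> makes the cofactor of \<open>p\<close>
    in \<open>c0\<close> a unit.\<close>
  obtain h where h: "h \<in> A" "(of_int c1 :: complex) = of_int c0 * h"
  proof (cases "int p dvd c0")
    case False
    then have "of_int c0 \<in> units" by (simp add: of_int_units_iff)
    then show ?thesis
      using that[of "inverse (of_int c0) * of_int c1"] c0_nz by (simp add: units_inverse mult of_int)
  next
    case True
    obtain d0 where d0: "c0 = int p * d0" using True by (rule dvdE)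
    obtain d1 where d1: "c1 = int p * d1" using c01 True by (auto elim: dvdE)
    have "\<not> int p dvd d0" using c0 by (auto simp: d0 power2_eq_square)
    then have "of_int d0 \<in> units" by (simp add: of_int_units_iff)
    then show ?thesis
      using that[of "inverse (of_int d0) * of_int d1"] c0_nz
      by (simp add: units_inverse mult of_int d0 d1)
  qed
  have A1: "y1 \<in> A" and A2: "y2 \<in> A" using y1 y2 nonunits_closed by auto
  define e where "e y = - (1 + h * y) * inverse (ipoly G y)" for y
  have e: "e y \<in> units" "y ^ 2 = of_nat p ^ (2 * k) * of_int c0 * e y"
    if y: "ipoly (trinomial9 a b) (y + of_int s) = 0" "y \<in> nonunits" for y
  proof -
    have Gu: "ipoly G y \<in> units" using y(2) by (rule cofactor_near_zero)
    then have "inverse (ipoly G y) \<in> units" by (auto simp: units_def)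
    then show "e y \<in> units"
      unfolding e_def using h(1) y(2)
      by (intro units_mult units_uminus units_add_nonunits units_one nonunits_mult')
    have "y ^ 2 = y ^ 2 * ipoly G y * inverse (ipoly G y)" using units_nonzero[OF Gu] by simp
    also have "\<dots> = of_nat p ^ (2 * k) * of_int c0 * e y"
      unfolding shift_root[OF y(1)] h(2) e_def by (simp add: algebra_simps)
    finally show "y ^ 2 = of_nat p ^ (2 * k) * of_int c0 * e y" .
  qed
  have "y1 ^ 2 \<noteq> 0" unfolding e(2)[OF y1] using c0_nz p_nonzero units_nonzero[OF e(1)[OF y1]] by simp
  then have y1_nz: "y1 \<noteq> 0" by auto
  define \<rho> where "\<rho> = y2 / y1"
  have y2_eq: "y2 = y1 * \<rho>" using y1_nz by (simp add: \<rho>_def)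
  have "\<rho> ^ 2 = e y2 * inverse (e y1)"
    unfolding \<rho>_def power_divide e(2)[OF y1] e(2)[OF y2]
    using c0_nz p_nonzero units_nonzero[OF e(1)[OF y1]] by (simp add: field_simps)
  then have \<rho>2: "\<rho> ^ 2 \<in> A" using e(1)[OF y1] e(1)[OF y2] by (simp add: mult units_closed units_inverse)
  have \<rho>A: "\<rho> \<in> A"
  proof (rule integrally_closed[of "[:- (\<rho> ^ 2), 0, 1:]"])
    show "coeff [:- (\<rho> ^ 2), 0, 1:] i \<in> A" for i
      using \<rho>2 by (auto simp: coeff_pCons zero one uminus split: nat.splits)
  qed (simp_all add: power2_eq_square)
  let ?G1 = "ipoly G y1" and ?G2 = "ipoly G y2"
  have G1: "?G1 \<in> units" using y1(2) by (rule cofactor_near_zero)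
  obtain r where r: "r \<in> A" "ipoly (pderiv (trinomial9 a b)) (y1 + of_int s) = (y1 - y2) * r"
    using diff_root by blast
  \<comment> \<open>The derivative of \<open>f\<close> at \<open>y1 + s\<close> is \<open>y1\<close>
    times a number congruent to \<open>2 G(y1)\<close>, hence to a unit. It is also a multiple of
    \<open>y1 - y2 = y1 (1 - \<rho>)\<close>.\<close>
  have one_minus: "1 - \<rho> \<in> units"
  proof -
    define m where "m = 2 * ?G1 + y1 * (ipoly (pderiv G) y1 + inverse (e y1) * h)"
    have two: "(2 :: complex) \<in> units"
      using small_not_dvd[OF p5, of 2] numeral_units_iff[OF p5, of "num.Bit0 num.One"] by simp
    have m: "m \<in> units"
      unfolding m_def using two G1 y1(2) A1 h(1) units_inverse[OF e(1)[OF y1]]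
      by (intro units_add_nonunits units_mult nonunits_mult add mult ipoly_closed)
    have "of_int (9 * s ^ 8 + a) = (of_nat p ^ (2 * k) * of_int c1 :: complex)"
      by (simp flip: F1)
    also have "\<dots> = y1 ^ 2 * inverse (e y1) * h"
      unfolding h(2) e(2)[OF y1] using units_nonzero[OF e(1)[OF y1]] by simp
    finally have "ipoly (pderiv (trinomial9 a b)) (y1 + of_int s) = y1 * m"
      unfolding pderiv_trinomial9_shift m_def by (simp add: algebra_simps power2_eq_square)
    moreover have "(y1 - y2) * r = y1 * ((1 - \<rho>) * r)" by (simp add: y2_eq algebra_simps)
    ultimately have "m = (1 - \<rho>) * r" using r(2) y1_nz by simp
    then show ?thesis using m units_multD \<rho>A one diff r(1) by blast
  qed
  obtain q where q: "q \<in> A" "?G1 - ?G2 = (y1 - y2) * q"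
    using poly_divided_difference[OF coeff_ipoly_closed A1 A2] by blast
  define n where "n = ?G1 - \<rho> * ?G2"
  have n: "n \<in> units"
  proof -
    have "n = (1 - \<rho>) * ?G1 + \<rho> * (?G1 - ?G2)"
      by (simp add: n_def algebra_simps)
    also have "\<dots> = (1 - \<rho>) * ?G1 + (y1 - y2) * (\<rho> * q)"
      unfolding q(2) by (simp add: mult_ac)
    also have "\<dots> \<in> units"
      using one_minus G1 y1(2) y2(2) \<rho>A q(1)
      by (intro units_add_nonunits units_mult nonunits_mult nonunits_diff mult)
    finally show ?thesis .
  qed
  \<comment> \<open>For \<open>k > 0\<close> the term \<open>w * n\<close> is a unit and the other
    one a nonunit. For \<open>k = 0\<close>, where \<open>u = w = 0\<close>, only
    \<open>1 - \<rho>\<close> remains.\<close>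
  define B where "B = of_nat p ^ k * ((1 - \<rho>) * (1 + of_int u * q)) + of_int w * n"
  have B: "B \<in> units"
  proof (cases "k = 0")
    case True
    then show ?thesis using uw one_minus by (simp add: B_def)
  next
    case False
    then have "of_int w \<in> units" using uw by (simp add: of_int_units_iff)
    then have "of_int w * n + of_nat p ^ k * ((1 - \<rho>) * (1 + of_int u * q)) \<in> units"
      using n False p_nonunit \<rho>A q(1)
      by (intro units_add_nonunits units_mult nonunits_mult nonunits_power closed) auto
    then show ?thesis by (simp add: B_def add.commute)
  qed
  have "om y1 - om y2 = y1 / of_nat p ^ k * n"
    using p_nonzero by (simp add: om_def n_def y2_eq field_simps)
  moreover have "y1 - y2 = y1 / of_nat p ^ k * (of_nat p ^ k * (1 - \<rho>))"
    using p_nonzero by (simp add: y2_eq algebra_simps)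
  moreover have "th u w y1 - th u w y2 = (y1 - y2) * (1 + of_int u * q) + of_int w * (om y1 - om y2)"
  proof -
    have "th u w y1 - th u w y2 = (y1 - y2) + of_int u * (?G1 - ?G2) + of_int w * (om y1 - om y2)"
      by (simp add: th_def algebra_simps)
    then show ?thesis unfolding q(2) by (simp add: algebra_simps)
  qed
  ultimately have "th u w y1 - th u w y2 = y1 / of_nat p ^ k * B"
    by (simp only: B_def) (simp add: algebra_simps)
  then have "(th u w y1 - th u w y2) ^ 2 = y1 ^ 2 / of_nat p ^ (2 * k) * B ^ 2"
    by (simp add: power_mult_distrib power_divide mult.commute flip: power_mult)
  also have "\<dots> = of_int c0 * (e y1 * B ^ 2)"
    unfolding e(2)[OF y1] using p_nonzero by simp
  finally show ?thesis
    using that[of "e y1 * B ^ 2"] e(1)[OF y1] B units_mult units_power by blast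
qed

text \<open>Division by the cofactor separates the simple roots from the pair. The remainder has
  degree below 7 and vanishes modulo the maximal ideal at the seven cofactor roots; the quotient is
  linear and is tested at the two values near the double root.\<close>

lemma th_coeffs_dvd:
  assumes deg: "degree P < 9"
    and P: "\<And>y. ipoly (trinomial9 a b) (y + of_int s) = 0 \<Longrightarrow> \<exists>z\<in>A. ipoly P (th u w y) = of_nat p * z"
  shows "int p dvd coeff P i"
proof -
  have p: "prime (int p)" using prime_p by simp
  have G0: "G \<noteq> 0" using shifted_cofactor_monic[of s] by auto
  obtain Q R where "pseudo_divmod P G = (Q, R)" by fastforce
  from pseudo_divmod[OF G0 this] have PQR: "P = G * Q + R" and R: "R = 0 \<or> degree R < 7"
    using shifted_cofactor_monic[of s] by (auto simp: shifted_cofactor_degree)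
  have P_eval: "ipoly P x = ipoly G x * ipoly Q x + ipoly R x" for x
    by (simp add: PQR map_poly_of_int_add map_poly_of_int_mult)
  have th_A: "th u w y \<in> A" if "ipoly (trinomial9 a b) (y + of_int s) = 0" for y
    using algebraic_int_th[OF that] by (rule algebraic_int_closed)
  have p_R: "int p dvd coeff R i" for i
  proof (rule int_coeffs_dvd_of_roots[of "{g. ipoly G g = 0}"])
    show "degree R < card {g. ipoly G g = 0}" using R cofactor_roots(2) by auto
    fix g assume "g \<in> {g. ipoly G g = 0}"
    then have g: "ipoly G g = 0" by simp
    obtain y where y: "ipoly (trinomial9 a b) (y + of_int s) = 0" "g - y \<in> nonunits"
      using cofactor_root_close[OF g] by blast
    let ?t = "th u w y"
    have gA: "g \<in> A" using g by (rule cofactor_roots(3))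
    have "y \<in> units" using y(2) cofactor_root_unit[OF g] by (rule units_cong)
    then have "?t - y \<in> nonunits" using y(1) by (intro th_near_simple_root)
    with y(2) have "(g - y) - (?t - y) \<in> nonunits" by (rule nonunits_diff)
    then have gt: "g - ?t \<in> nonunits" by simp
    have tA: "?t \<in> A" using y(1) by (rule th_A)
    have "ipoly G g - ipoly G ?t \<in> nonunits" using gt gA tA by (rule ipoly_cong)
    then have Gt: "ipoly G ?t \<in> nonunits" using g nonunits_uminus[of "- ipoly G ?t"] by simp
    obtain z where z: "z \<in> A" "ipoly P ?t = of_nat p * z" using P y(1) by blast
    have "ipoly R ?t = of_nat p * z - ipoly G ?t * ipoly Q ?t"
      using P_eval[of ?t] z(2) by simp
    also have "\<dots> \<in> nonunits"
      using z(1) Gt p_nonunit tA by (intro nonunits_diff nonunits_mult ipoly_closed)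
    finally have "ipoly R ?t \<in> nonunits" .
    moreover have "ipoly R g - ipoly R ?t \<in> nonunits" using gt gA tA by (rule ipoly_cong)
    ultimately have "ipoly R ?t + (ipoly R g - ipoly R ?t) \<in> nonunits" by (rule nonunits_add)
    then show "ipoly R g \<in> nonunits" by simp
  qed (use cofactor_roots in auto)
  then obtain R' where R': "R = smult (int p) R'" using poly_int_dvd_factor by blast
  obtain y1 y2 where y1: "ipoly (trinomial9 a b) (y1 + of_int s) = 0" "y1 \<in> nonunits"
    and y2: "ipoly (trinomial9 a b) (y2 + of_int s) = 0" "y2 \<in> nonunits"
    and y12: "\<exists>r\<in>A. ipoly (pderiv (trinomial9 a b)) (y1 + of_int s) = (y1 - y2) * r"
    by (rule close_pair)
  have Q_mult: "\<exists>z\<in>A. ipoly Q (th u w y) = of_nat p * z"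
    if y: "ipoly (trinomial9 a b) (y + of_int s) = 0" "y \<in> nonunits" for y
  proof -
    let ?t = "th u w y"
    have tA: "?t \<in> A" using y(1) by (rule th_A)
    have Gt: "ipoly G ?t \<in> units" using y by (rule cofactor_th_unit)
    obtain z where z: "z \<in> A" "ipoly P ?t = of_nat p * z" using P y(1) by blast
    have "ipoly G ?t * ipoly Q ?t = of_nat p * (z - ipoly R' ?t)"
      using P_eval[of ?t] z(2) by (simp add: R' map_poly_smult algebra_simps)
    then have "ipoly Q ?t = of_nat p * ((z - ipoly R' ?t) * inverse (ipoly G ?t))"
      using units_nonzero[OF Gt] by (simp add: field_simps)
    moreover have "(z - ipoly R' ?t) * inverse (ipoly G ?t) \<in> A"
      using z(1) tA units_inverse[OF Gt] by (intro mult diff ipoly_closed)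
    ultimately show ?thesis by blast
  qed
  have deg_Q: "degree Q \<le> 1"
  proof (cases "Q = 0")
    case False
    then have 1: "degree (G * Q) = 7 + degree Q"
      using G0 by (simp add: degree_mult_eq shifted_cofactor_degree)
    have "degree P = degree (G * Q)"
    proof (cases "R = 0")
      case False
      then show ?thesis unfolding PQR using R 1 by (intro degree_add_eq_left) auto
    qed (simp add: PQR)
    then show ?thesis using deg 1 by simp
  qed simp
  define q0 q1 where "q0 = coeff Q 0" and "q1 = coeff Q 1"
  have Q: "Q = [:q0, q1:]"
    using deg_Q by (intro poly_eqI) (auto simp: q0_def q1_def coeff_pCons coeff_eq_0 split: nat.splits)
  have Q_eval: "ipoly Q x = of_int q0 + of_int q1 * x" for x
    by (simp add: Q map_poly_pCons mult.commute)
  obtain z1 where z1: "z1 \<in> A" "ipoly Q (th u w y1) = of_nat p * z1" using Q_mult y1 by blast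
  obtain z2 where z2: "z2 \<in> A" "ipoly Q (th u w y2) = of_nat p * z2" using Q_mult y2 by blast
  obtain v where v: "v \<in> units" "(th u w y1 - th u w y2) ^ 2 = of_int c0 * v"
    using th_difference[OF y1 y2 y12] by blast
  have "of_int q1 * (th u w y1 - th u w y2) = ipoly Q (th u w y1) - ipoly Q (th u w y2)"
    by (simp add: Q_eval right_diff_distrib)
  also have "\<dots> = of_nat p * (z1 - z2)"
    unfolding z1(2) z2(2) by (simp add: right_diff_distrib)
  finally have "of_int q1 * (th u w y1 - th u w y2) = of_nat p * (z1 - z2)" .
  then have "(of_int q1 * (th u w y1 - th u w y2)) ^ 2 = (of_nat p * (z1 - z2)) ^ 2" by simp
  then have "of_int (q1 ^ 2 * c0) * v = of_nat p ^ 2 * (z1 - z2) ^ 2"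
    by (simp add: power_mult_distrib v(2) mult_ac)
  then have "of_int (q1 ^ 2 * c0) = of_nat p ^ 2 * ((z1 - z2) ^ 2 * inverse v)"
    using units_nonzero[OF v(1)] by (simp add: field_simps)
  moreover have "(z1 - z2) ^ 2 * inverse v \<in> A"
    using z1(1) z2(1) units_inverse[OF v(1)] by (intro mult power diff)
  \<comment> \<open>The slope \<open>q1\<close> times the difference of the two values is divisible
    by \<open>p\<close>. Squaring replaces that difference by the integer \<open>c0\<close>, up to a
    unit, and \<open>c0\<close> is not divisible by the square of \<open>p\<close>.\<close>
  ultimately have p2: "(int p)\<^sup>2 dvd q1 ^ 2 * c0" by (rule of_int_prime_square_dvd)
  have q1: "int p dvd q1"
  proof (rule ccontr)
    assume "\<not> int p dvd q1"
    then have "coprime (int p) q1" using p by (simp add: prime_imp_coprime)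
    then have "coprime ((int p)\<^sup>2) (q1\<^sup>2)" by simp
    then have "(int p)\<^sup>2 dvd c0" using p2 coprime_dvd_mult_right_iff by blast
    then show False using c0 by simp
  qed
  have "of_nat p * z1 - of_int q1 * th u w y1 \<in> nonunits"
    using p_nonunit z1(1) th_A[OF y1(1)] q1
    by (intro nonunits_diff nonunits_mult) (simp_all add: of_int_nonunits_iff)
  then have "of_int q0 \<in> nonunits" using z1(2) by (simp add: Q_eval flip: z1(2))
  then have "int p dvd q0" by (simp only: of_int_nonunits_iff)
  then have p_Q: "int p dvd coeff Q i" for i
    using q1 by (auto simp: Q coeff_pCons split: nat.splits)
  show ?thesis
    unfolding PQR coeff_add coeff_mult using p_R p_Q by (intro dvd_add dvd_sum dvd_mult) auto
qed

end

lemma double_root_index: "\<not> p dvd field_index (Q_adjoin \<alpha>)"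
proof -
  have p: "prime (int p)" using prime_p by simp
  obtain u w where uw: "k = 0 \<and> u = 0 \<and> w = 0 \<or>
    k > 0 \<and> int p dvd u * (36 * s ^ 7) + s \<and> \<not> int p dvd w \<and>
    (int p dvd w\<^sup>2 * (c0 * (36 * s ^ 7)) + s\<^sup>2 \<or>
     w = 1 \<and> \<not> int p dvd b\<^sup>2 + c0 * (36 * s ^ 7) * ((c0 * (36 * s ^ 7)) ^ 4 + a)\<^sup>2)"
  proof (cases "k = 0")
    case False
    have "coprime (36 * s ^ 7) (int p)"
      using const_cofactor_unit p by (metis coprime_commute prime_imp_coprime)
    then obtain x v where xv: "x * (36 * s ^ 7) + v * int p = 1"
      using bezout_int[of "36 * s ^ 7" "int p"] by (metis coprime_imp_gcd_eq_1)
    \<comment> \<open>Modulo \<open>p\<close>, \<open>u\<close> is \<open>- s\<close> divided by the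
      constant coefficient of the cofactor.\<close>
    have "(- s * x) * (36 * s ^ 7) + s = s * (1 - x * (36 * s ^ 7))" by (simp add: algebra_simps)
    also have "1 - x * (36 * s ^ 7) = v * int p" using xv by linarith
    finally have "int p dvd (- s * x) * (36 * s ^ 7) + s" by simp
    moreover obtain w where "\<not> int p dvd w"
      "int p dvd w\<^sup>2 * (c0 * (36 * s ^ 7)) + s\<^sup>2 \<or>
        w = 1 \<and> \<not> int p dvd b\<^sup>2 + c0 * (36 * s ^ 7) * ((c0 * (36 * s ^ 7)) ^ 4 + a)\<^sup>2"
      by (rule exists_square_multiplier[OF p pb ps])
    ultimately show ?thesis using that False by blast
  qed (use that in blast)
  obtain T where T: "\<And>x. rpoly T x = th u w (x - of_int s)" using th_rpoly by blast
  have root': "ipoly (trinomial9 a b) (\<alpha> - of_int s + of_int s) = 0" using root by simp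
  show ?thesis
  proof (rule field_index_not_dvd[OF prime_p, of T])
    show "algebraic_int (rpoly T \<alpha>)" unfolding T using root' by (rule algebraic_int_th)
    fix P i assume P: "degree P < degree (trinomial9 a b)" "algebraic_int (ipoly P (rpoly T \<alpha>) / of_nat p)"
    show "int p dvd coeff P i"
    proof (rule th_coeffs_dvd[OF uw])
      show "degree P < 9" using P(1) by (simp add: degree_trinomial9)
      fix y assume "ipoly (trinomial9 a b) (y + of_int s) = 0"
      then have "algebraic_int (ipoly P (th u w y) / of_nat p)"
        using conjugate_quotient[OF P(2), of "y + of_int s"] by (simp add: T)
      then show "\<exists>z\<in>A. ipoly P (th u w y) = of_nat p * z"
        using p_nonzero algebraic_int_closed by (intro bexI[of _ "ipoly P (th u w y) / of_nat p"]) auto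
    qed
  qed
qed

end

section \<open>Combination of the cases\<close>

lemma (in monic_irreducible) no_rational_root:
  assumes "ipoly f (of_rat r) = 0"
  shows "degree f \<le> 1"
proof -
  have "rpoly [:- r, 1:] (of_rat r) = 0" by (simp add: map_poly_pCons of_rat_minus)
  then have "fQ dvd [:- r, 1:]" using assms dvd_of_root by blast
  then have "degree fQ \<le> degree [:- r, 1:]" by (intro dvd_imp_degree_le) auto
  then show ?thesis by (simp add: degree_fQ)
qed

lemma padic_val_le_iff:
  assumes "prime q"
  shows "padic_val q x \<le> enat m \<longleftrightarrow> \<not> int q ^ Suc m dvd x"
proof -
  have "prime (int q)" using assms by simp
  then have "\<not> is_unit (int q)" by (metis not_prime_unit)
  then show ?thesis
    using power_dvd_iff_le_multiplicity[of x "int q" "Suc m"] by (auto simp: padic_val_def)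
qed

theorem theorem2p4:
  fixes p :: nat and a b :: int and \<alpha> :: complex
  assumes "prime p" and "p \<ge> 5"
    and "irreducible (map_poly of_int (trinomial9 a b) :: rat poly)"
    and "\<And>q :: nat. prime q \<Longrightarrow> padic_val q a \<le> 7 \<or> padic_val q b \<le> 8"
    and "poly (map_poly of_int (trinomial9 a b)) \<alpha> = 0"
  shows "\<not> p dvd field_index (Q_adjoin \<alpha>)"
proof -
  interpret monic_irreducible "trinomial9 a b" \<alpha>
    by unfold_locales (use assms lead_coeff_trinomial9 in auto)
  obtain A where "p_valuation A p" using exists_p_valuation[OF assms(1)] by blast
  then interpret p_valuation A p .
  have p: "prime (int p)" using assms(1) by simp
  note not_dvd_8' = not_dvd_8[OF assms(2)] and not_dvd_9' = not_dvd_9[OF assms(2)]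
  have no_root: "ipoly (trinomial9 a b) (of_rat r) \<noteq> 0" for r
    using no_rational_root[of r] by (auto simp: degree_trinomial9)
  have b0: "b \<noteq> 0" using no_root[of 0] by (auto simp: ipoly_trinomial9)
  define D where "D = 8 ^ 8 * a ^ 9 + 9 ^ 9 * b ^ 8"
  show ?thesis
  proof (cases "int p dvd D")
    case False
    then show ?thesis
      using separable_index[OF monic_irreducible_axioms] by (simp add: D_def)
  next
    case True
    have pow_8: "\<not> int p dvd 8 ^ 8" and pow_9: "\<not> int p dvd 9 ^ 9"
      using not_dvd_8' not_dvd_9' prime_dvd_power[OF p] by blast+
    \<comment> \<open>As \<open>p\<close> divides \<open>D\<close> but neither 8 nor 9, it divides
      both coefficients or none.\<close>
    have ab_iff: "int p dvd a \<longleftrightarrow> int p dvd b"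
    proof
      assume "int p dvd a"
      then have "int p dvd a ^ 9" by (rule dvd_trans) (rule dvd_power, simp)
      then have "int p dvd 8 ^ 8 * a ^ 9" by (rule dvd_mult)
      then have "int p dvd 9 ^ 9 * b ^ 8" using True unfolding D_def by (simp only: dvd_add_right_iff)
      then have "int p dvd b ^ 8" using pow_9 prime_dvd_multD[OF p] by blast
      then show "int p dvd b" by (rule prime_dvd_power[OF p])
    next
      assume "int p dvd b"
      then have "int p dvd b ^ 8" by (rule dvd_trans) (rule dvd_power, simp)
      then have "int p dvd 9 ^ 9 * b ^ 8" by (rule dvd_mult)
      then have "int p dvd 8 ^ 8 * a ^ 9" using True unfolding D_def by (simp only: dvd_add_left_iff)
      then have "int p dvd a ^ 9" using pow_8 prime_dvd_multD[OF p] by blast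
      then show "int p dvd a" by (rule prime_dvd_power[OF p])
    qed
    show ?thesis
    proof (cases "int p dvd a")
      case False
      then have pb: "\<not> int p dvd b" and a0: "a \<noteq> 0" using ab_iff by auto
      \<comment> \<open>With \<open>D = 0\<close> the rational number \<open>- 9 b / (8 a)\<close>
        would be an exact root, contradicting irreducibility.\<close>
      have "D \<noteq> 0"
      proof
        assume "D = 0"
        define x where "x = (of_rat (- 9 * of_int b / (8 * of_int a)) :: complex)"
        have x: "8 * of_int a * x = - (9 * of_int b)"
          using a0 by (simp add: x_def of_rat_divide of_rat_mult of_rat_minus)
        have "(8 * of_int a) ^ 9 * (x ^ 9 + of_int a * x + of_int b) =
            (8 * of_int a * x) ^ 9 + 8 ^ 8 * of_int a ^ 9 * (8 * of_int a * x) + (8 * of_int a) ^ 9 * of_int b"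
          by (simp add: power_mult_distrib algebra_simps)
        also have "\<dots> = - (of_int b * of_int D)"
          unfolding x D_def by (simp add: power_mult_distrib algebra_simps) (simp add: eval_nat_numeral)
        finally have "x ^ 9 + of_int a * x + of_int b = 0" using \<open>D = 0\<close> a0 by simp
        then show False using no_root by (simp add: ipoly_trinomial9 x_def)
      qed
      then obtain s c0 c1 k where "\<not> int p dvd s" "int p ^ (2 * k) * c0 = s ^ 9 + a * s + b"
        "int p ^ (2 * k) * c1 = 9 * s ^ 8 + a" "int p dvd 8 * a * s + 9 * b" "\<not> (int p)\<^sup>2 dvd c0"
        "int p dvd c0 \<longrightarrow> int p dvd c1" "int p dvd s ^ 9 + a * s + b" "int p dvd 9 * s ^ 8 + a"
        using double_root_approximation[OF p not_dvd_8' not_dvd_9' False pb] True unfolding D_def by metis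
      then interpret double_root A p a b \<alpha> s c0 c1 k
        using assms(2) False pb by unfold_locales
      show ?thesis by (rule double_root_index)
    next
      case pa: True
      then have pb: "int p dvd b" using ab_iff by simp
      have bound: "\<not> int p ^ 8 dvd a \<or> \<not> int p ^ 9 dvd b"
      proof -
        have "padic_val p a \<le> enat 7 \<or> padic_val p b \<le> enat 8"
          using assms(4)[OF assms(1)] by (simp add: numeral_eq_enat)
        then show ?thesis
          unfolding padic_val_le_iff[OF assms(1)] by (simp del: power_Suc)
      qed
      \<comment> \<open>\<open>N - 1\<close> is the smaller of the two valuations. Phrasing it
        through common divisibility by powers of \<open>p\<close> also covers
        \<open>a = 0\<close>.\<close>
      define N where "N = (LEAST N. \<not> (int p ^ N dvd a \<and> int p ^ N dvd b))"
      have ex: "\<not> (int p ^ 9 dvd a \<and> int p ^ 9 dvd b)"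
        using bound le_imp_power_dvd[of 8 9 "int p"] dvd_trans by auto
      then have N: "\<not> (int p ^ N dvd a \<and> int p ^ N dvd b)" and "N \<le> 9"
        unfolding N_def by (rule LeastI, rule Least_le)
      have below: "int p ^ n dvd a \<and> int p ^ n dvd b" if "n < N" for n
        using that not_less_Least unfolding N_def by blast
      have "N \<noteq> 0" using N by (metis one_dvd power_0)
      moreover have "N \<noteq> 1" using N pa pb by (metis power_one_right)
      ultimately obtain n where n: "N = Suc n" "1 \<le> n" by (cases N) auto
      obtain a1 where a1: "a = int p ^ n * a1" using below[of n] n by (auto elim: dvdE)
      obtain b1 where b1: "b = int p ^ n * b1" using below[of n] n by (auto elim: dvdE)
      have not_both: "\<not> (int p dvd a1 \<and> int p dvd b1)"
        using N by (auto simp: n a1 b1 mult.commute)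
      show ?thesis
      \<comment> \<open>If \<open>b\<close> attains the minimal valuation, the Newton polygon has a
        single side. Otherwise \<open>a\<close> does, \<open>b\<close> has one more factor
        \<open>p\<close>, and the hypothesis on the valuations excludes
        \<open>n = 8\<close>.\<close>
      proof (cases "int p dvd b1")
        case False
        show ?thesis
          by (rule one_slope_index[OF assms(2) monic_irreducible_axioms a1 b1 False n(2)])
             (use n \<open>N \<le> 9\<close> in simp)
      next
        case True
        then obtain b2 where "b1 = int p * b2" by (rule dvdE)
        then have b2: "b = int p ^ Suc n * b2" using b1 by simp
        have "n \<le> 7"
        proof (rule ccontr)
          assume "\<not> n \<le> 7"
          then have "int p ^ 8 dvd int p ^ n" "int p ^ 9 dvd int p ^ Suc n"
            by (auto intro!: le_imp_power_dvd simp del: power_Suc)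
          then have "int p ^ 8 dvd a" "int p ^ 9 dvd b" unfolding a1 b2 by (simp_all only: dvd_mult2)
          then show False using bound by blast
        qed
        then show ?thesis
          using not_both True by (intro two_slope_index[OF assms(2) monic_irreducible_axioms a1 b2 _ n(2)]) auto
      qed
    qed
  qed
qed

end
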